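(* Let $d\ge 3$ be an integer, $\kappa_c=\frac{2\sqrt{d-1}}{d}-1$, and consider loop percolation on the $d$-regular tree $\mathbb{T}_d$. Let $\alpha_c(\kappa)=\inf\{\alpha\ge 0:\theta(\alpha,\kappa)>0\}$ and $\alpha_\#(\kappa)=\sup\{\alpha>0:\mathbb{E}_{\alpha,\kappa}[|\mathcal{C}(0)|]<\infty\}$ (with $\sup\emptyset=0$). For all $\kappa\ge\kappa_c$, $$\alpha_c(\kappa)=\alpha_\#(\kappa).$$
   Context: $\mathbb{T}_d$ is the infinite $d$-regular tree with a fixed vertex $0$ (the root). A based loop is a nearest-neighbor path $\dot\ell=(v_1,\dots,v_n)$ on $\mathbb{T}_d$ ($n\ge 2$, consecutive vertices adjacent) with $v_n$ a neighbor of $v_1$. Loops are equivalence classes of based loops modulo cyclic shifts. For $\kappa>-1$, $\dot\mu_\kappa$ is the measure on based loops with $\dot\mu_\kappa(\dot\ell)=\frac1n\big(\frac1{1+\kappa}\big)^n\big(\frac1d\big)^n$ for $\dot\ell=(v_1,\dots,v_n)$, and $\mu_\kappa$ is its pushforward to loops. $\mathcal{L}_{\alpha,\kappa}$ is the Poisson point process of loops with intensity $\alpha\mu_\kappa$, $\alpha\ge 0$, with law $\mathbb{P}_{\alpha,\kappa}$ and expectation $\mathbb{E}_{\alpha,\kappa}$. A loop is open if it occurs at least once in $\mathcal{L}_{\alpha,\kappa}$. Vertices $u,v$ are loop-connected if there are open loops $\ell_1,\dots,\ell_k$ with $u\in\ell_1$, $v\in\ell_k$ and each consecutive pair $\ell_{i-1},\ell_i$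 sharing a vertex (a vertex is always loop-connected to itself). $\mathcal{C}(u)$ is the set of vertices loop-connected to $u$. $\theta(\alpha,\kappa)=\mathbb{P}_{\alpha,\kappa}(|\mathcal{C}(0)|=\infty)$. *)

theory Defs
  imports "HOL-Probability.Probability"
begin

section \<open>Poisson point processes\<close>

text \<open>The library's \<open>poisson_pmf\<close> is only specified for positive rates.\<close>

definition poisson_law :: "real \<Rightarrow> nat pmf" where
  "poisson_law r = (if 0 < r then poisson_pmf r else return_pmf 0)"

abbreviation point_count :: "'a set \<Rightarrow> ('a \<Rightarrow> nat) \<Rightarrow> ennreal" where
  "point_count A \<omega> \<equiv> \<integral>\<^sup>+x. of_nat (\<omega> x) \<partial>count_space A"

text \<open>
  The usual definition of a Poisson point process with intensity \<open>\<nu>\<close>, where the random point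
  configuration is given by the multiplicity \<open>X \<omega> x\<close> of each point \<open>x\<close>.
\<close>

definition is_poisson_process :: "'w measure \<Rightarrow> ('w \<Rightarrow> 'a \<Rightarrow> nat) \<Rightarrow> 'a measure \<Rightarrow> bool" where
  "is_poisson_process M X \<nu> \<longleftrightarrow>
     prob_space M \<and>
     (\<forall>A\<in>sets \<nu>. (\<lambda>\<omega>. point_count A (X \<omega>)) \<in> borel_measurable M) \<and>
     (\<forall>A\<in>sets \<nu>. emeasure \<nu> A \<noteq> \<infinity> \<longrightarrow>
        (\<forall>k. measure M {\<omega>\<in>space M. point_count A (X \<omega>) = of_nat k} =
             pmf (poisson_law (measure \<nu> A)) k)) \<and>
     (\<forall>A\<in>sets \<nu>. emeasure \<nu> A = \<infinity> \<longrightarrow>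
        (AE \<omega> in M. point_count A (X \<omega>) = \<infinity>)) \<and>
     (\<forall>(A :: nat \<Rightarrow> 'a set) n. (\<forall>i<n. A i \<in> sets \<nu>) \<and> disjoint_family_on A {..<n} \<longrightarrow>
        prob_space.indep_vars M (\<lambda>_. borel :: ennreal measure)
          (\<lambda>i \<omega>. point_count (A i) (X \<omega>)) {..<n})"

text \<open>
  On a countable discrete space with finite atoms, independent Poisson multiplicities realise
  the Poisson point process; see \<open>is_poisson_process_law\<close> below.
\<close>

definition poisson_process_law :: "'a measure \<Rightarrow> ('a \<Rightarrow> nat) measure" where
  "poisson_process_law \<nu> = PiM (space \<nu>) (\<lambda>x. measure_pmf (poisson_law (measure \<nu> {x})))"

lemma pmf_poisson_law: "0 \<le> r \<Longrightarrow> pmf (poisson_law r) k = r ^ k / fact k * exp (- r)"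
  by (auto simp: poisson_law_def indicator_def)

lemma pmf_poisson_law_add:
  assumes "0 \<le> r" "0 \<le> s"
  shows "(\<Sum>i\<le>k. pmf (poisson_law r) i * pmf (poisson_law s) (k - i)) = pmf (poisson_law (r + s)) k"
proof -
  have "(\<Sum>i\<le>k. pmf (poisson_law r) i * pmf (poisson_law s) (k - i)) =
        (\<Sum>i\<le>k. of_nat (k choose i) * r ^ i * s ^ (k - i) / fact k * exp (- (r + s)))"
  proof (rule sum.cong)
    fix i assume "i \<in> {..k}"
    then have "i \<le> k" by simp
    have "(of_nat (k choose i) :: real) = fact k / (fact i * fact (k - i))"
      using binomial_fact[OF \<open>i \<le> k\<close>] by simp
    then show "pmf (poisson_law r) i * pmf (poisson_law s) (k - i) =
       of_nat (k choose i) * r ^ i * s ^ (k - i) / fact k * exp (- (r + s))"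
      using assms by (simp add: pmf_poisson_law exp_add exp_diff exp_minus field_simps)
  qed simp
  also have "\<dots> = (\<Sum>i\<le>k. of_nat (k choose i) * r ^ i * s ^ (k - i)) / fact k * exp (- (r + s))"
    by (simp add: sum_divide_distrib sum_distrib_right)
  also have "\<dots> = pmf (poisson_law (r + s)) k"
    using assms by (simp add: pmf_poisson_law binomial_ring)
  finally show ?thesis .
qed

lemma borel_measurable_nn_integral_count:
  fixes f :: "'w \<Rightarrow> 'a \<Rightarrow> ennreal"
  assumes "countable A" "\<And>x. x \<in> A \<Longrightarrow> (\<lambda>\<omega>. f \<omega> x) \<in> borel_measurable M"
  shows "(\<lambda>\<omega>. \<integral>\<^sup>+x. f \<omega> x \<partial>count_space A) \<in> borel_measurable M"
proof -
  interpret sigma_finite_measure "count_space A"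
    by (rule sigma_finite_measure_count_space_countable) fact
  have "(\<lambda>(x, \<omega>). f \<omega> x) \<in> borel_measurable (count_space A \<Otimes>\<^sub>M M)"
    using assms by (intro measurable_pair_measure_countable1) auto
  then have "(\<lambda>(\<omega>, x). f \<omega> x) \<in> borel_measurable (M \<Otimes>\<^sub>M count_space A)"
    by (subst measurable_pair_swap_iff) (simp add: split_def)
  then show ?thesis by (rule borel_measurable_nn_integral)
qed

definition poisson_cdf :: "nat \<Rightarrow> real \<Rightarrow> real" where
  "poisson_cdf k r = (\<Sum>j\<le>k. r ^ j / fact j * exp (- r))"

context
  fixes \<nu> :: "'a measure" and PL :: "('a \<Rightarrow> nat) measure"
  defines "PL \<equiv> poisson_process_law \<nu>"
  assumes countable_space: "countable (space \<nu>)"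
    and sets_discrete: "sets \<nu> = Pow (space \<nu>)"
    and finite_atoms: "\<And>x. x \<in> space \<nu> \<Longrightarrow> emeasure \<nu> {x} \<noteq> \<infinity>"
begin

lemma prob_space_poisson_process_law: "prob_space PL"
  unfolding PL_def poisson_process_law_def by (intro prob_space_PiM prob_space_measure_pmf)

interpretation PL: prob_space PL by (rule prob_space_poisson_process_law)

lemma coord_meas[measurable]: "x \<in> space \<nu> \<Longrightarrow> (\<lambda>\<omega>. \<omega> x) \<in> PL \<rightarrow>\<^sub>M count_space UNIV"
proof -
  assume x: "x \<in> space \<nu>"
  have "(\<lambda>\<omega>. \<omega> x) \<in> PL \<rightarrow>\<^sub>M measure_pmf (poisson_law (measure \<nu> {x}))"
    unfolding PL_def poisson_process_law_def using x by (rule measurable_component_singleton)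
  then show ?thesis by (simp cong: measurable_cong_sets)
qed

lemma distr_coord: "x \<in> space \<nu> \<Longrightarrow>
  distr PL (measure_pmf (poisson_law (measure \<nu> {x}))) (\<lambda>\<omega>. \<omega> x) = measure_pmf (poisson_law (measure \<nu> {x}))"
  unfolding PL_def poisson_process_law_def
  by (rule distr_PiM_component[where M="\<lambda>x. measure_pmf (poisson_law (measure \<nu> {x}))"])
     (auto intro: prob_space_measure_pmf)

lemma prob_coord: assumes x: "x \<in> space \<nu>"
  shows "measure PL {\<omega>\<in>space PL. \<omega> x = k} = pmf (poisson_law (measure \<nu> {x})) k"
proof -
  have "pmf (poisson_law (measure \<nu> {x})) k =
    measure (distr PL (measure_pmf (poisson_law (measure \<nu> {x}))) (\<lambda>\<omega>. \<omega> x)) {k}"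
    by (simp add: distr_coord[OF x] pmf.rep_eq)
  also have "\<dots> = measure PL ((\<lambda>\<omega>. \<omega> x) -` {k} \<inter> space PL)"
    using coord_meas[OF x] by (subst measure_distr) (simp_all cong: measurable_cong_sets)
  also have "(\<lambda>\<omega>. \<omega> x) -` {k} \<inter> space PL = {\<omega>\<in>space PL. \<omega> x = k}" by auto
  finally show ?thesis by simp
qed

lemma indep_coord:
  "PL.indep_vars (\<lambda>x. count_space UNIV) (\<lambda>x \<omega>. \<omega> x) (space \<nu>)"
proof (cases "space \<nu> = {}")
  case True
  then show ?thesis by (simp add: PL.indep_vars_def PL.indep_sets_def)
next
  case False
  let ?P = "\<lambda>x. measure_pmf (poisson_law (measure \<nu> {x}))"
  have "PL.indep_vars ?P (\<lambda>x \<omega>. \<omega> x) (space \<nu>)"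
  proof (subst PL.indep_vars_iff_distr_eq_PiM'[OF False])
    show "(\<lambda>\<omega>. \<omega> i) \<in> PL \<rightarrow>\<^sub>M ?P i" if "i \<in> space \<nu>" for i
      using coord_meas[OF that] by (simp cong: measurable_cong_sets)
    have "distr PL (Pi\<^sub>M (space \<nu>) ?P) (\<lambda>x. restrict x (space \<nu>)) = distr PL PL (\<lambda>x. x)"
      by (rule distr_cong) (auto simp: PL_def poisson_process_law_def space_PiM)
    also have "\<dots> = PL" by (rule distr_id2) simp
    also have "\<dots> = Pi\<^sub>M (space \<nu>) (\<lambda>i. distr PL (?P i) (\<lambda>\<omega>. \<omega> i))"
      by (subst PL_def, subst poisson_process_law_def, rule PiM_cong) (simp_all add: distr_coord)
    finally show "distr PL (Pi\<^sub>M (space \<nu>) ?P) (\<lambda>x. \<lambda>i\<in>space \<nu>. x i) =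
        Pi\<^sub>M (space \<nu>) (\<lambda>i. distr PL (?P i) (\<lambda>\<omega>. \<omega> i))" by simp
  qed
  from PL.indep_vars_compose2[OF this, where Y = "\<lambda>_ y. y" and N = "\<lambda>_. count_space UNIV"]
  show ?thesis by (simp cong: measurable_cong_sets)
qed

lemma point_count_meas: assumes A: "A \<subseteq> space \<nu>" shows "point_count A \<in> borel_measurable PL"
  using countable_subset[OF A countable_space] A
  by (auto intro!: borel_measurable_nn_integral_count measurable_compose[OF coord_meas])

lemma point_count_indep: assumes A: "\<And>i. i \<in> I \<Longrightarrow> A i \<subseteq> space \<nu>" "disjoint_family_on A I"
  shows "PL.indep_vars (\<lambda>_. borel) (\<lambda>i. point_count (A i)) I"
proof -
  have meas: "(\<lambda>f. point_count (A i) f) \<in> borel_measurable (Pi\<^sub>M (A i) (\<lambda>_. count_space (UNIV::nat set)))" if "i \<in> I" for i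
    using countable_subset[OF A(1)[OF that] countable_space]
    by (auto intro!: borel_measurable_nn_integral_count measurable_compose[OF measurable_component_singleton])
  have "PL.indep_vars (\<lambda>_. borel) (\<lambda>i \<omega>. point_count (A i) (restrict (\<lambda>x. \<omega> x) (A i))) I"
    by (rule PL.indep_vars_compose2[OF PL.indep_vars_restrict[OF indep_coord A]]) (auto intro: meas)
  moreover have "point_count (A i) (restrict (\<lambda>x. \<omega> x) (A i)) = point_count (A i) \<omega>" for i \<omega>
    by (rule nn_integral_cong) simp
  ultimately show ?thesis by simp
qed

lemma emeasure_finite_set: "finite A \<Longrightarrow> A \<subseteq> space \<nu> \<Longrightarrow> emeasure \<nu> A \<noteq> \<infinity>"
proof -
  assume "finite A" "A \<subseteq> space \<nu>"
  then have "emeasure \<nu> A = (\<Sum>x\<in>A. emeasure \<nu> {x})"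
    by (intro emeasure_eq_sum_singleton) (auto simp: sets_discrete)
  also have "\<dots> \<noteq> \<infinity>" using finite_atoms \<open>finite A\<close> \<open>A \<subseteq> _\<close> by (auto simp: ennreal_sum_eq_top)
  finally show ?thesis .
qed

lemma point_count_finite: assumes "finite A" "A \<subseteq> space \<nu>"
  shows "measure PL {\<omega>\<in>space PL. point_count A \<omega> = of_nat k} = pmf (poisson_law (measure \<nu> A)) k"
  using assms
proof (induction A arbitrary: k rule: finite_induct)
  case empty
  have "{\<omega>\<in>space PL. point_count {} \<omega> = of_nat k} = (if k = 0 then space PL else {})"
    by (auto simp: nn_integral_count_space_finite)
  then show ?case by (auto simp: PL.prob_space poisson_law_def indicator_def)
next
  case (insert a A)
  define S where "S \<omega> = (\<Sum>x\<in>A. \<omega> x)" for \<omega> :: "'a \<Rightarrow> nat"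
  have cS: "point_count A \<omega> = of_nat (S \<omega>)" for \<omega>
    using insert by (simp add: nn_integral_count_space_finite S_def)
  have ca: "point_count (insert a A) \<omega> = of_nat (\<omega> a + S \<omega>)" for \<omega>
    using insert by (simp add: nn_integral_count_space_finite S_def)
  have c1: "point_count {a} \<omega> = of_nat (\<omega> a)" for \<omega>
    by (simp add: nn_integral_count_space_finite)
  have indep: "PL.indep_vars (\<lambda>_. borel) (\<lambda>i. point_count (if i then {a} else A)) (UNIV :: bool set)"
    by (rule point_count_indep) (use insert in \<open>auto simp: disjoint_family_on_def\<close>)
  have ev[measurable]: "{\<omega>\<in>space PL. \<omega> a = i} \<in> sets PL" "{\<omega>\<in>space PL. S \<omega> = i} \<in> sets PL" for i
  proof -
    have "point_count {a} \<in> borel_measurable PL" "point_count A \<in> borel_measurable PL" using insert by (auto intro!: point_count_meas)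
    then have "point_count {a} -` {of_nat i} \<inter> space PL \<in> sets PL" "point_count A -` {of_nat i} \<inter> space PL \<in> sets PL"
      by (auto intro!: measurable_sets)
    moreover have "point_count {a} -` {of_nat i} \<inter> space PL = {\<omega>\<in>space PL. \<omega> a = i}"
      "point_count A -` {of_nat i} \<inter> space PL = {\<omega>\<in>space PL. S \<omega> = i}"
      by (auto simp: c1 cS)
    ultimately show "{\<omega>\<in>space PL. \<omega> a = i} \<in> sets PL" "{\<omega>\<in>space PL. S \<omega> = i} \<in> sets PL" by auto
  qed
  have prod: "measure PL {\<omega>\<in>space PL. \<omega> a = i \<and> S \<omega> = j} =
      pmf (poisson_law (measure \<nu> {a})) i * pmf (poisson_law (measure \<nu> A)) j" for i j
  proof -
    have "measure PL (\<Inter>b\<in>UNIV. point_count (if b then {a} else A) -` (if b then {of_nat i} else {of_nat j}) \<inter> space PL)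
      = (\<Prod>b\<in>UNIV. measure PL (point_count (if b then {a} else A) -` (if b then {of_nat i} else {of_nat j}) \<inter> space PL))"
      by (rule PL.indep_varsD[OF indep]) auto
    also have "(\<Inter>b\<in>UNIV. point_count (if b then {a} else A) -` (if b then {of_nat i} else {of_nat j}) \<inter> space PL)
      = {\<omega>\<in>space PL. \<omega> a = i \<and> S \<omega> = j}"
      by (auto simp: UNIV_bool c1 cS)
    also have "(\<Prod>b\<in>UNIV. measure PL (point_count (if b then {a} else A) -` (if b then {of_nat i} else {of_nat j}) \<inter> space PL))
      = measure PL {\<omega>\<in>space PL. \<omega> a = i} * measure PL {\<omega>\<in>space PL. point_count A \<omega> = of_nat j}"
      by (simp add: UNIV_bool c1 vimage_def Int_def conj_commute mult.commute)
    also have "measure PL {\<omega>\<in>space PL. \<omega> a = i} = pmf (poisson_law (measure \<nu> {a})) i"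
      using insert by (intro prob_coord) auto
    finally show ?thesis using insert.IH[of j] insert.prems by simp
  qed
  have "{\<omega>\<in>space PL. point_count (insert a A) \<omega> = of_nat k} =
     (\<Union>i\<le>k. {\<omega>\<in>space PL. \<omega> a = i \<and> S \<omega> = k - i})"
    unfolding ca by (auto simp del: of_nat_add)
  also have "measure PL \<dots> = (\<Sum>i\<le>k. measure PL {\<omega>\<in>space PL. \<omega> a = i \<and> S \<omega> = k - i})"
  proof (rule PL.finite_measure_finite_Union)
    have "{\<omega>\<in>space PL. \<omega> a = i \<and> S \<omega> = j} = {\<omega>\<in>space PL. \<omega> a = i} \<inter> {\<omega>\<in>space PL. S \<omega> = j}" for i j
      by auto
    then show "(\<lambda>i. {\<omega>\<in>space PL. \<omega> a = i \<and> S \<omega> = k - i}) ` {..k} \<subseteq> sets PL"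
      by (auto intro!: sets.Int ev)
  qed (auto simp: disjoint_family_on_def)
  also have "\<dots> = pmf (poisson_law (measure \<nu> {a} + measure \<nu> A)) k"
    unfolding prod by (rule pmf_poisson_law_add) auto
  also have "measure \<nu> {a} + measure \<nu> A = measure \<nu> (insert a A)"
    using insert emeasure_finite_set[of A] emeasure_finite_set[of "{a}"]
    by (subst measure_Union[symmetric]) (auto simp: sets_discrete)
  finally show ?case .
qed

lemma point_count_emeasure: "point_count B \<omega> = emeasure (density (count_space UNIV) (\<lambda>x. of_nat (\<omega> x))) B"
  by (simp add: emeasure_density nn_integral_count_space_indicator mult.commute)

lemma point_count_set_meas: "A \<subseteq> space \<nu> \<Longrightarrow> {\<omega>\<in>space PL. point_count A \<omega> \<le> c} \<in> sets PL"
  using point_count_meas[of A] by measurable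

lemma point_count_cdf_finite: assumes A: "finite A" "A \<subseteq> space \<nu>"
  shows "measure PL {\<omega>\<in>space PL. point_count A \<omega> \<le> of_nat k} = poisson_cdf k (measure \<nu> A)"
proof -
  have m: "{\<omega>\<in>space PL. point_count A \<omega> = c} \<in> sets PL" for c
    using point_count_meas[OF A(2)] by measurable
  have "{\<omega>\<in>space PL. point_count A \<omega> \<le> of_nat k} = (\<Union>j\<le>k. {\<omega>\<in>space PL. point_count A \<omega> = of_nat j})"
    using A by (auto simp: nn_integral_count_space_finite simp flip: of_nat_sum)
  also have "measure PL \<dots> = (\<Sum>j\<le>k. measure PL {\<omega>\<in>space PL. point_count A \<omega> = of_nat j})"
    by (rule PL.finite_measure_finite_Union) (auto simp: disjoint_family_on_def m)
  also have "\<dots> = poisson_cdf k (measure \<nu> A)"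
    by (simp add: point_count_finite[OF A] poisson_cdf_def pmf_poisson_law)
  finally show ?thesis .
qed

lemma finite_exhaustion:
  assumes "A \<subseteq> space \<nu>"
  obtains B :: "nat \<Rightarrow> 'a set" where "incseq B" "\<And>n. finite (B n)" "\<And>n. B n \<subseteq> space \<nu>" "(\<Union>n. B n) = A"
proof (cases "A = {}")
  case True
  then show thesis by (intro that[of "\<lambda>_. {}"]) (auto simp: incseq_def)
next
  case False
  have "countable A" using assms countable_space by (rule countable_subset)
  then have r: "range (from_nat_into A) = A" using False by simp
  show thesis
  proof (rule that[of "\<lambda>n. from_nat_into A ` {..<n}"])
    show "(\<Union>n. from_nat_into A ` {..<n}) = A" using r by blast
    then show "from_nat_into A ` {..<n} \<subseteq> space \<nu>" for n using assms by blast
  qed (auto simp: incseq_def)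
qed

lemma point_count_le_iff:
  assumes "incseq B" "(\<Union>n. B n) = A"
  shows "point_count A \<omega> \<le> c \<longleftrightarrow> (\<forall>n. point_count (B n) \<omega> \<le> c)"
proof -
  have "point_count A \<omega> = (SUP n. point_count (B n) \<omega>)"
    unfolding point_count_emeasure assms(2)[symmetric] using assms(1)
    by (intro SUP_emeasure_incseq[symmetric]) auto
  then show ?thesis by (simp add: SUP_le_iff)
qed

lemma point_count_cdf_lim:
  assumes B: "incseq B" "\<And>n. finite (B n)" "\<And>n. B n \<subseteq> space \<nu>" "(\<Union>n. B n) = A"
  shows "(\<lambda>n. poisson_cdf k (measure \<nu> (B n))) \<longlonglongrightarrow> measure PL {\<omega>\<in>space PL. point_count A \<omega> \<le> of_nat k}"
proof -
  have "(\<lambda>n. measure PL {\<omega>\<in>space PL. point_count (B n) \<omega> \<le> of_nat k}) \<longlonglongrightarrow>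
      measure PL (\<Inter>n. {\<omega>\<in>space PL. point_count (B n) \<omega> \<le> of_nat k})"
  proof (rule PL.finite_Lim_measure_decseq)
    show "decseq (\<lambda>n. {\<omega>\<in>space PL. point_count (B n) \<omega> \<le> of_nat k})"
      using B(1) unfolding decseq_def incseq_def point_count_emeasure
      by (auto intro!: emeasure_mono elim!: order_trans[rotated])
  qed (use B point_count_set_meas in auto)
  also have "(\<Inter>n. {\<omega>\<in>space PL. point_count (B n) \<omega> \<le> of_nat k}) = {\<omega>\<in>space PL. point_count A \<omega> \<le> of_nat k}"
    unfolding point_count_le_iff[OF B(1,4)] by auto
  finally show ?thesis by (simp add: point_count_cdf_finite[OF B(2,3)])
qed

lemma point_count_cdf:
  assumes A: "A \<subseteq> space \<nu>" "emeasure \<nu> A \<noteq> \<infinity>"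
  shows "measure PL {\<omega>\<in>space PL. point_count A \<omega> \<le> of_nat k} = poisson_cdf k (measure \<nu> A)"
proof -
  obtain B where B: "incseq B" "\<And>n. finite (B n)" "\<And>n. B n \<subseteq> space \<nu>" "(\<Union>n. B n) = A"
    using finite_exhaustion[OF A(1)] by metis
  have "(\<lambda>n. measure \<nu> (B n)) \<longlonglongrightarrow> measure \<nu> A"
    using Lim_measure_incseq[of B \<nu>] B A by (auto simp: sets_discrete)
  then have "(\<lambda>n. poisson_cdf k (measure \<nu> (B n))) \<longlonglongrightarrow> poisson_cdf k (measure \<nu> A)"
    unfolding poisson_cdf_def by (intro tendsto_intros) auto
  then show ?thesis using point_count_cdf_lim[OF B] LIMSEQ_unique by blast
qed

lemma point_count_law:
  assumes A: "A \<subseteq> space \<nu>" "emeasure \<nu> A \<noteq> \<infinity>"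
  shows "measure PL {\<omega>\<in>space PL. point_count A \<omega> = of_nat k} = pmf (poisson_law (measure \<nu> A)) k"
proof (cases k)
  case 0
  then show ?thesis using point_count_cdf[OF A, of 0] by (simp add: poisson_cdf_def pmf_poisson_law)
next
  case (Suc m)
  obtain B where B: "incseq B" "\<And>n. finite (B n)" "\<And>n. B n \<subseteq> space \<nu>" "(\<Union>n. B n) = A"
    using finite_exhaustion[OF A(1)] by metis
  have integral: "point_count A \<omega> < of_nat k \<Longrightarrow> point_count A \<omega> \<le> of_nat m" for \<omega>
  proof -
    assume less: "point_count A \<omega> < of_nat k"
    have "point_count (B n) \<omega> \<le> of_nat m" for n
    proof -
      have "point_count (B n) \<omega> \<le> point_count A \<omega>" unfolding point_count_emeasure using B(4) by (intro emeasure_mono) auto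
      then have "point_count (B n) \<omega> < of_nat k" using less by simp
      moreover obtain q where "point_count (B n) \<omega> = of_nat q"
        using B(2)[of n] by (auto simp: nn_integral_count_space_finite simp flip: of_nat_sum)
      ultimately show ?thesis using Suc by (simp del: of_nat_Suc)
    qed
    then show ?thesis using point_count_le_iff[OF B(1,4)] by blast
  qed
  have mk: "(of_nat m :: ennreal) < of_nat k" using Suc by (simp del: of_nat_Suc)
  have "{\<omega>\<in>space PL. point_count A \<omega> = of_nat k} =
     {\<omega>\<in>space PL. point_count A \<omega> \<le> of_nat k} - {\<omega>\<in>space PL. point_count A \<omega> \<le> of_nat m}"
    using integral mk by (auto simp: order.order_iff_strict)
  also have "measure PL \<dots> = measure PL {\<omega>\<in>space PL. point_count A \<omega> \<le> of_nat k} - measure PL {\<omega>\<in>space PL. point_count A \<omega> \<le> of_nat m}"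
    using mk by (intro PL.finite_measure_Diff point_count_set_meas A) (auto intro: order_trans)
  also have "\<dots> = pmf (poisson_law (measure \<nu> A)) k"
    by (simp only: point_count_cdf[OF A]) (simp add: poisson_cdf_def Suc pmf_poisson_law)
  finally show ?thesis .
qed

lemma point_count_infinite:
  assumes A: "A \<subseteq> space \<nu>" "emeasure \<nu> A = \<infinity>"
  shows "AE \<omega> in PL. point_count A \<omega> = \<infinity>"
proof -
  obtain B where B: "incseq B" "\<And>n. finite (B n)" "\<And>n. B n \<subseteq> space \<nu>" "(\<Union>n. B n) = A"
    using finite_exhaustion[OF A(1)] by metis
  have "(\<lambda>n. emeasure \<nu> (B n)) \<longlonglongrightarrow> \<infinity>"
    using Lim_emeasure_incseq[of B \<nu>] B A by (auto simp: sets_discrete)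
  moreover have "emeasure \<nu> (B n) = ennreal (measure \<nu> (B n))" for n
    using emeasure_finite_set[OF B(2,3)] by (simp add: emeasure_eq_ennreal_measure)
  ultimately have "filterlim (\<lambda>n. measure \<nu> (B n)) at_top sequentially"
    by (simp add: ennreal_tendsto_top_eq_at_top)
  moreover have "(poisson_cdf k \<longlongrightarrow> 0) at_top" for k
  proof -
    have "((\<lambda>r::real. r ^ j / fact j * exp (- r)) \<longlongrightarrow> 0) at_top" for j
    proof -
      have "((\<lambda>r::real. (r ^ j / exp r) / fact j) \<longlongrightarrow> 0 / fact j) at_top"
        by (intro tendsto_divide tendsto_power_div_exp_0 tendsto_const) auto
      then show ?thesis by (simp add: exp_minus field_simps)
    qed
    then show ?thesis unfolding poisson_cdf_def[abs_def] by (intro tendsto_null_sum) auto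
  qed
  ultimately have lim0: "(\<lambda>n. poisson_cdf k (measure \<nu> (B n))) \<longlonglongrightarrow> 0" for k
    using filterlim_compose by blast
  have "measure PL {\<omega>\<in>space PL. point_count A \<omega> \<le> of_nat k} = 0" for k
    using point_count_cdf_lim[OF B, of k] lim0[of k] LIMSEQ_unique by blast
  then have "AE \<omega> in PL. \<not> point_count A \<omega> \<le> of_nat k" for k
    using point_count_set_meas[OF A(1)] by (subst AE_iff_measurable) (auto simp: PL.emeasure_eq_measure)
  then have "AE \<omega> in PL. \<forall>k. \<not> point_count A \<omega> \<le> of_nat k" by (subst AE_all_countable) auto
  then show ?thesis
  proof (eventually_elim)
    fix \<omega> assume *: "\<forall>k. \<not> point_count A \<omega> \<le> of_nat k"
    show "point_count A \<omega> = \<infinity>"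
    proof (rule ccontr)
      assume "point_count A \<omega> \<noteq> \<infinity>"
      then have "point_count A \<omega> < top" by (simp add: less_top)
      then obtain k where "point_count A \<omega> < of_nat k" using ennreal_Ex_less_of_nat by blast
      with * show False using less_imp_le by blast
    qed
  qed
qed

lemma is_poisson_process_law: "is_poisson_process PL (\<lambda>\<omega>. \<omega>) \<nu>"
  unfolding is_poisson_process_def
  using prob_space_poisson_process_law point_count_meas point_count_law point_count_infinite
  by (auto simp: sets_discrete intro!: point_count_indep)

end

section \<open>Loops on the regular tree\<close>

text \<open>
  The vertex set is the whole type; \<open>E\<close> is the symmetric adjacency relation. The fourth conjunct
  excludes cycles. For \<open>d \<ge> 2\<close> these conditions determine the tree up to isomorphism.
\<close>

definition regular_tree :: "'v rel \<Rightarrow> nat \<Rightarrow> bool" where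
  "regular_tree E d \<longleftrightarrow>
     sym E \<and> irrefl E \<and>
     (\<forall>u v. (u, v) \<in> E\<^sup>*) \<and>
     (\<nexists>c. 3 \<le> length c \<and> distinct c \<and> successively (\<lambda>u v. (u, v) \<in> E) c \<and> (last c, hd c) \<in> E) \<and>
     (\<forall>v. finite (E `` {v}) \<and> card (E `` {v}) = d)"

definition based_loops :: "'v rel \<Rightarrow> 'v list set" where
  "based_loops E =
     {xs. 2 \<le> length xs \<and> successively (\<lambda>u v. (u, v) \<in> E) xs \<and> (last xs, hd xs) \<in> E}"

definition cyclic_shift :: "'v rel \<Rightarrow> 'v list rel" where
  "cyclic_shift E = {(xs, ys). xs \<in> based_loops E \<and> (\<exists>k. ys = rotate k xs)}"

definition loops :: "'v rel \<Rightarrow> 'v list set set" where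
  "loops E = based_loops E // cyclic_shift E"

definition based_loop_measure :: "'v rel \<Rightarrow> nat \<Rightarrow> real \<Rightarrow> 'v list measure" where
  "based_loop_measure E d \<kappa> =
     point_measure (based_loops E)
       (\<lambda>xs. ennreal (1 / real (length xs) * (1 / (1 + \<kappa>)) ^ length xs * (1 / real d) ^ length xs))"

definition loop_measure :: "'v rel \<Rightarrow> nat \<Rightarrow> real \<Rightarrow> 'v list set measure" where
  "loop_measure E d \<kappa> =
     distr (based_loop_measure E d \<kappa>) (count_space (loops E)) (\<lambda>xs. cyclic_shift E `` {xs})"

definition loop_soup_law :: "'v rel \<Rightarrow> nat \<Rightarrow> real \<Rightarrow> real \<Rightarrow> ('v list set \<Rightarrow> nat) measure" where
  "loop_soup_law E d \<alpha> \<kappa> = poisson_process_law (scale_measure (ennreal \<alpha>) (loop_measure E d \<kappa>))"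

lemma countable_regular_tree:
  assumes "regular_tree (E :: 'v rel) d"
  shows "countable (UNIV :: 'v set)"
proof -
  fix v :: 'v
  have "finite ((E ^^ n) `` {v})" for n
  proof (induction n)
    case (Suc n)
    have "(E ^^ Suc n) `` {v} = (\<Union>w\<in>(E ^^ n) `` {v}. E `` {w})" by auto
    then show ?case using Suc assms by (auto simp: regular_tree_def)
  qed simp
  then have "countable (\<Union>n. (E ^^ n) `` {v})" by (auto intro: countable_finite)
  moreover have "(\<Union>n. (E ^^ n) `` {v}) = UNIV"
    using assms by (auto simp: regular_tree_def rtrancl_power)
  ultimately show ?thesis by simp
qed

lemma is_poisson_process_loop_soup:
  assumes "regular_tree E d" "0 \<le> \<alpha>"
  shows "is_poisson_process (loop_soup_law E d \<alpha> \<kappa>) (\<lambda>\<omega>. \<omega>)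
           (scale_measure (ennreal \<alpha>) (loop_measure E d \<kappa>))"
  unfolding loop_soup_law_def
proof (rule is_poisson_process_law)
  let ?\<nu> = "scale_measure (ennreal \<alpha>) (loop_measure E d \<kappa>)"
  have space: "space ?\<nu> = loops E" by (simp add: loop_measure_def space_scale_measure)
  show "sets ?\<nu> = Pow (space ?\<nu>)" by (simp add: space) (simp add: loop_measure_def)
  have "countable (UNIV :: 'a set)" using countable_regular_tree[OF assms(1)] .
  then have "countable (lists (UNIV :: 'a set))" by (rule countable_lists)
  then have "countable (based_loops E)" by (rule countable_subset[rotated]) auto
  then have "countable (loops E)" unfolding loops_def quotient_def by auto
  then show "countable (space ?\<nu>)" by (simp add: space)
  fix l assume "l \<in> space ?\<nu>"
  then have l: "l \<in> loops E" by (simp add: space)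
  then obtain xs where xs: "xs \<in> based_loops E" "l = cyclic_shift E `` {xs}"
    by (auto simp: loops_def elim: quotientE)
  have "l \<subseteq> (\<lambda>k. rotate k xs) ` {..<length xs}"
  proof
    fix ys assume "ys \<in> l"
    then obtain k where "ys = rotate k xs" using xs by (auto simp: cyclic_shift_def)
    then have "ys = rotate (k mod length xs) xs" using rotate_conv_mod by metis
    moreover have "0 < length xs" using xs by (auto simp: based_loops_def)
    ultimately show "ys \<in> (\<lambda>k. rotate k xs) ` {..<length xs}" by (intro image_eqI) auto
  qed
  then have fin: "finite l" by (rule finite_subset) simp
  let ?c = "\<lambda>xs. cyclic_shift E `` {xs}"
  have c: "?c \<in> based_loop_measure E d \<kappa> \<rightarrow>\<^sub>M count_space (loops E)"
    by (auto simp: based_loop_measure_def measurable_def space_point_measure sets_point_measure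
        loops_def intro!: quotientI)
  have sub: "?c -` {l} \<inter> based_loops E \<subseteq> l"
    by (auto simp: cyclic_shift_def intro: exI[of _ 0])
  have "emeasure (loop_measure E d \<kappa>) {l} = emeasure (based_loop_measure E d \<kappa>) (?c -` {l} \<inter> based_loops E)"
    unfolding loop_measure_def using l c
    by (subst emeasure_distr) (auto simp: based_loop_measure_def space_point_measure)
  also have "\<dots> < \<infinity>"
    unfolding based_loop_measure_def using finite_subset[OF sub fin]
    by (subst emeasure_point_measure_finite2) (auto simp: less_top[symmetric] ennreal_sum_eq_top)
  finally show "emeasure ?\<nu> {l} \<noteq> \<infinity>"
    by (simp add: ennreal_mult_eq_top_iff)
qed

section \<open>Loop percolation\<close>

definition open_loops :: "'v rel \<Rightarrow> ('v list set \<Rightarrow> nat) \<Rightarrow> 'v list set set" where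
  "open_loops E \<omega> = {l \<in> loops E. 1 \<le> \<omega> l}"

definition loop_vertices :: "'v list set \<Rightarrow> 'v set" where
  "loop_vertices l = (\<Union>xs\<in>l. set xs)"

definition loop_connected :: "'v rel \<Rightarrow> ('v list set \<Rightarrow> nat) \<Rightarrow> 'v \<Rightarrow> 'v \<Rightarrow> bool" where
  "loop_connected E \<omega> u v \<longleftrightarrow> u = v \<or>
     (\<exists>ls. ls \<noteq> [] \<and> set ls \<subseteq> open_loops E \<omega> \<and>
           u \<in> loop_vertices (hd ls) \<and> v \<in> loop_vertices (last ls) \<and>
           successively (\<lambda>l l'. loop_vertices l \<inter> loop_vertices l' \<noteq> {}) ls)"

definition cluster :: "'v rel \<Rightarrow> ('v list set \<Rightarrow> nat) \<Rightarrow> 'v \<Rightarrow> 'v set" where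
  "cluster E \<omega> u = {v. loop_connected E \<omega> u v}"

definition percolation_prob :: "'v rel \<Rightarrow> nat \<Rightarrow> 'v \<Rightarrow> real \<Rightarrow> real \<Rightarrow> real" where
  "percolation_prob E d v \<alpha> \<kappa> =
     measure (loop_soup_law E d \<alpha> \<kappa>)
       {\<omega> \<in> space (loop_soup_law E d \<alpha> \<kappa>). infinite (cluster E \<omega> v)}"

text \<open>
  The critical values live in \<^typ>\<open>ennreal\<close>, so that \<open>Inf {} = \<infinity>\<close>, \<open>Sup {} = 0\<close>,
  and the supremum of an unbounded set is \<open>\<infinity>\<close>.
\<close>

definition alpha_c :: "'v rel \<Rightarrow> nat \<Rightarrow> 'v \<Rightarrow> real \<Rightarrow> ennreal" where
  "alpha_c E d v \<kappa> = Inf (ennreal ` {\<alpha>. 0 \<le> \<alpha> \<and> 0 < percolation_prob E d v \<alpha> \<kappa>})"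

definition mean_cluster_size :: "'v rel \<Rightarrow> nat \<Rightarrow> 'v \<Rightarrow> real \<Rightarrow> real \<Rightarrow> ennreal" where
  "mean_cluster_size E d v \<alpha> \<kappa> =
     (\<integral>\<^sup>+\<omega>. emeasure (count_space UNIV) (cluster E \<omega> v) \<partial>loop_soup_law E d \<alpha> \<kappa>)"

definition alpha_sharp :: "'v rel \<Rightarrow> nat \<Rightarrow> 'v \<Rightarrow> real \<Rightarrow> ennreal" where
  "alpha_sharp E d v \<kappa> = Sup (ennreal ` {\<alpha>. 0 < \<alpha> \<and> mean_cluster_size E d v \<alpha> \<kappa> < \<infinity>})"

definition kappa_c :: "nat \<Rightarrow> real" where
  "kappa_c d = 2 * sqrt (real d - 1) / real d - 1"

end

theory Submission
  imports Defs
begin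

text \<open>
  Root the tree at \<open>v\<close>. A loop that meets the subtree below a vertex \<open>w\<close> and its complement contains
  both \<open>w\<close> and its parent, so the cluster of the root consists of the vertices all of whose ancestral
  edges are covered by open loops, and loops inside disjoint subtrees are independent. Let \<open>M k\<close> be
  the mean number of vertices \<open>k\<close> levels below \<open>u\<close> that are connected to \<open>u\<close> by loops in the subtree
  below \<open>u\<close>; it does not depend on \<open>u \<noteq> v\<close>.

  If \<open>M k > 1\<close> for some \<open>k\<close>, an embedded branching process survives, so \<open>\<theta> > 0\<close>. If the series of
  \<open>M k\<close> diverges at intensity \<open>\<alpha>\<close>, then the expected number of first uncovered edges is infinite;
  an independent extra soup covers each of them with probability at least \<open>\<epsilon>\<close>, and the resulting
  renewal inequality forces \<open>M k > 1\<close> for some \<open>k\<close> at every larger intensity. If the series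
  converges, then so does the mean cluster size of the root, because for \<open>\<kappa> \<ge> \<kappa>\<^sub>c\<close> the Green
  function is finite and the mass of loops through a vertex and its descendant is comparable with
  the mass of those inside the subtree.
\<close>

text \<open>The root has d children and every other vertex d - 1, so only subtrees of non-root
  vertices are translates of one another; hence \<open>M\<close> is studied away from the root and
  the root is attached at the end. Allowing only loops below \<open>u\<close> discards connections
  through loops that climb above \<open>u\<close>, but then connections concatenate and disjoint
  subtrees are independent. The discarded part is recovered at the root alone, by comparing loops
  through the root with loops inside the subtree of a child; there the critical bound on the step
  weight is used.

  Both intensities live on one space: independent soups labelled \<open>False\<close> (\<alpha>) and
  \<open>True\<close> (\<beta>), whose union has intensity \<alpha> + \<beta>. The renewal
  inequality works by contradiction: if all means at the larger intensity were at most 1, their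
  partial sums would grow at most linearly, while more than 2 / \<epsilon> expected first gaps
  within n levels make those sums double every n levels.

  The inequality \<open>alpha_sharp \<le> alpha_c\<close> only needs that a finite mean excludes an
  infinite cluster, together with monotonicity from the same coupling.\<close>

locale rooted_tree =
  fixes E :: "'v rel" and d :: nat and r :: 'v
  assumes tree: "regular_tree E d"
begin

lemma E_sym: "(u, v) \<in> E \<Longrightarrow> (v, u) \<in> E"
  using tree by (auto simp: regular_tree_def dest: symD)

lemma E_irrefl: "(u, u) \<notin> E"
  using tree by (auto simp: regular_tree_def irrefl_def)

lemma no_cycle:
  "3 \<le> length c \<Longrightarrow> distinct c \<Longrightarrow> successively (\<lambda>u v. (u, v) \<in> E) c \<Longrightarrow> (last c, hd c) \<notin> E"
  using tree unfolding regular_tree_def by blast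

lemma finite_nbrs: "finite (E `` {v})" and card_nbrs: "card (E `` {v}) = d"
  using tree by (auto simp: regular_tree_def)

lemma countable_V: "countable (A :: 'v set)"
  using countable_regular_tree[OF tree] by (rule countable_subset[rotated]) auto

section \<open>Depth, parents and the descendant order\<close>

definition depth :: "'v \<Rightarrow> nat" where
  "depth v = (LEAST n. (r, v) \<in> E ^^ n)"

lemma depth_walk: "(r, v) \<in> E ^^ depth v"
proof -
  have "\<exists>n. (r, v) \<in> E ^^ n"
    using tree by (auto simp: regular_tree_def rtrancl_power)
  then show ?thesis unfolding depth_def by (rule LeastI_ex)
qed

lemma depth_le: "(r, v) \<in> E ^^ n \<Longrightarrow> depth v \<le> n"
  unfolding depth_def by (rule Least_le)

lemma depth_root [simp]: "depth r = 0"
  using depth_le[of r 0] by simp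

lemma depth_eq_0_iff [simp]: "depth v = 0 \<longleftrightarrow> v = r"
  using depth_walk[of v] by (metis depth_root relpow_0_E)

lemma depth_edge_le: "(u, v) \<in> E \<Longrightarrow> depth v \<le> Suc (depth u)"
  using depth_walk[of u] by (intro depth_le) auto

lemma parent_exists:
  assumes "v \<noteq> r"
  shows "\<exists>u. (u, v) \<in> E \<and> Suc (depth u) = depth v"
proof -
  obtain n where n: "depth v = Suc n" using assms by (metis depth_eq_0_iff not0_implies_Suc)
  with depth_walk[of v] obtain u where u: "(r, u) \<in> E ^^ n" "(u, v) \<in> E" by auto
  have "depth u \<le> n" using u by (intro depth_le)
  with depth_edge_le[OF u(2)] n u show ?thesis by (intro exI[of _ u]) auto
qed

text \<open>Climb from both vertices in step until the parents coincide. The depth bound keeps the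
  path away from deeper vertices, so an edge between \<open>u\<close> and \<open>v\<close>, or a
  common child of them, would close a cycle; \<open>depth_edge_ne\<close> and
  \<open>parent_unique\<close> use it in these two ways.\<close>

lemma level_path:
  assumes "u \<noteq> v" "depth u = n" "depth v = n"
  shows "\<exists>c. 3 \<le> length c \<and> distinct c \<and> successively (\<lambda>u v. (u, v) \<in> E) c \<and> hd c = u \<and> last c = v \<and>
             (\<forall>x\<in>set c. depth x \<le> n)"
  using assms
proof (induction n arbitrary: u v)
  case 0
  then show ?case by simp
next
  case (Suc n)
  obtain u' where u': "(u', u) \<in> E" "depth u' = n" using parent_exists[of u] Suc.prems by force
  obtain v' where v': "(v', v) \<in> E" "depth v' = n" using parent_exists[of v] Suc.prems by force
  show ?case
  proof (cases "u' = v'")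
    case True
    then show ?thesis using u' v' Suc.prems
      by (intro exI[of _ "[u, u', v]"]) (auto intro: E_sym)
  next
    case False
    obtain c where c: "3 \<le> length c" "distinct c" "successively (\<lambda>u v. (u, v) \<in> E) c" "hd c = u'"
      "last c = v'" "\<forall>x\<in>set c. depth x \<le> n"
      using Suc.IH[OF False] u' v' by auto
    then have "c \<noteq> []" by auto
    with c u' v' Suc.prems show ?thesis
      by (intro exI[of _ "u # c @ [v]"])
        (auto simp: successively_append_iff successively_Cons E_sym)
  qed
qed

lemma depth_edge_ne: "(u, v) \<in> E \<Longrightarrow> depth u \<noteq> depth v"
proof
  assume uv: "(u, v) \<in> E" "depth u = depth v"
  then have "u \<noteq> v" using E_irrefl by auto
  from level_path[OF this uv(2) refl] show False using no_cycle uv(1) E_sym by metis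
qed

lemma parent_unique:
  assumes "(u, w) \<in> E" "(v, w) \<in> E" "Suc (depth u) = depth w" "Suc (depth v) = depth w"
  shows "u = v"
proof (rule ccontr)
  assume "u \<noteq> v"
  obtain c where c: "3 \<le> length c" "distinct c" "successively (\<lambda>u v. (u, v) \<in> E) c" "hd c = u"
      "last c = v" "\<forall>x\<in>set c. depth x \<le> depth u"
    using level_path[OF \<open>u \<noteq> v\<close> refl] assms by auto
  then have "c \<noteq> []" by auto
  have "w \<notin> set c" using c(6) assms(3) by auto
  then have "(last (c @ [w]), hd (c @ [w])) \<notin> E"
    using c assms \<open>c \<noteq> []\<close> by (intro no_cycle) (auto simp: successively_append_iff)
  then show False using c \<open>c \<noteq> []\<close> assms E_sym by auto
qed

text \<open>At the root no candidate exists and the value is arbitrary, hence the recurring side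
  condition \<open>v \<noteq> r\<close>.\<close>

definition par :: "'v \<Rightarrow> 'v" where
  "par v = (SOME u. (u, v) \<in> E \<and> Suc (depth u) = depth v)"

lemma par_edge: "v \<noteq> r \<Longrightarrow> (par v, v) \<in> E" and depth_par: "v \<noteq> r \<Longrightarrow> Suc (depth (par v)) = depth v"
  unfolding par_def using someI_ex[OF parent_exists[of v]] by auto

lemma par_eqI: "(u, v) \<in> E \<Longrightarrow> depth v = Suc (depth u) \<Longrightarrow> par v = u"
  by (rule parent_unique[of _ v]) (use depth_eq_0_iff par_edge[of v] depth_par[of v] in force)+

lemma edge_iff: "(u, v) \<in> E \<longleftrightarrow> (v \<noteq> r \<and> par v = u) \<or> (u \<noteq> r \<and> par u = v)"
proof
  assume uv: "(u, v) \<in> E"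
  have "depth v \<le> Suc (depth u)" "depth u \<le> Suc (depth v)" "depth u \<noteq> depth v"
    using uv depth_edge_le depth_edge_ne E_sym by auto
  then consider "depth v = Suc (depth u)" | "depth u = Suc (depth v)" by linarith
  then show "(v \<noteq> r \<and> par v = u) \<or> (u \<noteq> r \<and> par u = v)"
    by cases (use par_eqI uv E_sym in fastforce)+
qed (auto intro: par_edge E_sym)

definition ch :: "'v \<Rightarrow> 'v set" where
  "ch v = {w. w \<noteq> r \<and> par w = v}"

lemma nbrs_eq: "E `` {v} = ch v \<union> (if v = r then {} else {par v})"
  by (auto simp: ch_def edge_iff)

lemma finite_ch [simp]: "finite (ch v)"
  using finite_nbrs[of v] by (simp add: nbrs_eq)

lemma depth_ch: "w \<in> ch v \<Longrightarrow> depth w = Suc (depth v)"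
  using depth_par[of w] by (auto simp: ch_def)

lemma card_ch: "v \<noteq> r \<Longrightarrow> card (ch v) = d - 1"
proof -
  assume v: "v \<noteq> r"
  have "par v \<notin> ch v" using depth_ch[of "par v" v] depth_par[OF v] by auto
  then show ?thesis using card_nbrs[of v] v by (simp add: nbrs_eq)
qed

lemma card_ch_root: "card (ch r) = d"
  using card_nbrs[of r] by (simp add: nbrs_eq)

text \<open>Levels are absolute: \<open>i\<close> is the depth of the ancestor, not a number of
  steps, so a vertex and its ancestors share one indexing. Beyond \<open>depth v\<close> truncated
  subtraction returns \<open>v\<close> itself.\<close>

definition anc :: "'v \<Rightarrow> nat \<Rightarrow> 'v" where
  "anc v i = (par ^^ (depth v - i)) v"

lemma depth_par_pow: "m \<le> depth v \<Longrightarrow> depth ((par ^^ m) v) = depth v - m"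
proof (induction m)
  case (Suc m)
  then have "depth ((par ^^ m) v) \<noteq> 0" by simp
  then have "(par ^^ m) v \<noteq> r" by (simp del: depth_root add: depth_eq_0_iff)
  from depth_par[OF this] Suc show ?case by simp
qed simp

lemma depth_anc: "i \<le> depth v \<Longrightarrow> depth (anc v i) = i"
  by (simp add: anc_def depth_par_pow)

lemma anc_self [simp]: "anc v (depth v) = v"
  by (simp add: anc_def)

lemma anc_root [simp]: "anc v 0 = r"
  using depth_anc[of 0 v] by simp

lemma anc_anc: "j \<le> i \<Longrightarrow> i \<le> depth v \<Longrightarrow> anc (anc v i) j = anc v j"
proof -
  assume "j \<le> i" "i \<le> depth v"
  then have "depth v - j = (i - j) + (depth v - i)" by simp
  then show ?thesis using depth_anc[OF \<open>i \<le> depth v\<close>] unfolding anc_def[of _ j]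
    by (simp only: funpow_add) (simp add: anc_def)
qed

lemma par_anc: "Suc i \<le> depth v \<Longrightarrow> par (anc v (Suc i)) = anc v i"
proof -
  assume "Suc i \<le> depth v"
  then have "depth v - i = Suc (depth v - Suc i)" by simp
  then show ?thesis by (simp add: anc_def)
qed

lemma anc_par: "v \<noteq> r \<Longrightarrow> i < depth v \<Longrightarrow> anc (par v) i = anc v i"
  using par_anc[of "depth v - 1" v] anc_anc[of i "depth v - 1" v] by auto

definition desc :: "'v \<Rightarrow> 'v \<Rightarrow> bool" where
  "desc u v \<longleftrightarrow> depth u \<le> depth v \<and> anc v (depth u) = u"

lemma desc_refl [simp]: "desc v v" by (simp add: desc_def)

lemma desc_root [simp]: "desc r v" by (simp add: desc_def)

lemma desc_anc: "i \<le> depth v \<Longrightarrow> desc (anc v i) v" by (simp add: desc_def depth_anc)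

lemma desc_depth: "desc u v \<Longrightarrow> depth u \<le> depth v" by (simp add: desc_def)

lemma desc_trans: "desc u v \<Longrightarrow> desc v w \<Longrightarrow> desc u w"
  unfolding desc_def using anc_anc[of "depth u" "depth v" w] by auto

lemma desc_eq: "desc u v \<Longrightarrow> depth u = depth v \<Longrightarrow> u = v"
  by (auto simp: desc_def)

lemma desc_ancD: "desc u v \<Longrightarrow> depth u \<le> i \<Longrightarrow> i \<le> depth v \<Longrightarrow> desc u (anc v i)"
  by (auto simp: desc_def depth_anc anc_anc)

lemma desc_anc_eq: "desc u v \<Longrightarrow> j \<le> depth u \<Longrightarrow> anc v j = anc u j"
  by (auto simp: desc_def) (metis anc_anc)

lemma desc_linear: "desc u w \<Longrightarrow> desc v w \<Longrightarrow> depth u \<le> depth v \<Longrightarrow> desc u v"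
  by (metis desc_ancD desc_def)

lemma desc_par: "v \<noteq> r \<Longrightarrow> desc (par v) v"
  by (metis depth_par desc_anc anc_self le_Suc_eq order_refl par_anc)

lemma desc_par_iff: "v \<noteq> r \<Longrightarrow> u \<noteq> v \<Longrightarrow> desc u (par v) \<longleftrightarrow> desc u v"
proof -
  assume v: "v \<noteq> r" and uv: "u \<noteq> v"
  show ?thesis
  proof
    assume "desc u (par v)" then show "desc u v" using desc_par[OF v] desc_trans by blast
  next
    assume uw: "desc u v"
    then have "depth u < depth v" using uv desc_eq desc_depth le_neq_implies_less by blast
    then show "desc u (par v)" using uw desc_linear[OF uw desc_par[OF v]] depth_par[OF v] by simp
  qed
qed

lemma desc_par_self: "v \<noteq> r \<Longrightarrow> \<not> desc v (par v)"
  using desc_depth[of v "par v"] depth_par[of v] by auto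

lemma desc_ne_root: "desc u v \<Longrightarrow> u \<noteq> r \<Longrightarrow> v \<noteq> r"
  using desc_depth[of u v] by auto

text \<open>The tree property behind the independence statements: a child of \<open>x\<close> stays
  below \<open>w\<close>, so a step out of the subtree goes to \<open>par x\<close>, and by
  \<open>desc_par_iff\<close> this leaves the subtree only from \<open>x = w\<close>.\<close>

lemma edge_leaves:
  assumes "(x, y) \<in> E" "desc w x" "\<not> desc w y"
  shows "x = w \<and> y = par w \<and> w \<noteq> r"
proof -
  have "\<not> (y \<noteq> r \<and> par y = x)" using assms desc_par desc_trans by blast
  then have "x \<noteq> r" "par x = y" using assms(1) by (auto simp: edge_iff)
  with assms desc_par_iff[of x w] show ?thesis by auto
qed

section \<open>Levels below a vertex\<close>

definition Lv :: "'v \<Rightarrow> nat \<Rightarrow> 'v set" where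
  "Lv u k = {v. desc u v \<and> depth v = depth u + k}"

lemma Lv_0 [simp]: "Lv u 0 = {u}"
  by (auto simp: Lv_def dest: desc_eq)

lemma desc_ch: "w \<in> ch v \<Longrightarrow> desc v w"
  by (auto simp: ch_def desc_par)

lemma Lv_Suc: "Lv u (Suc k) = (\<Union>w\<in>Lv u k. ch w)"
proof safe
  fix v assume v: "v \<in> Lv u (Suc k)"
  then have "v \<noteq> r" "u \<noteq> v" by (auto simp: Lv_def)
  with v show "v \<in> (\<Union>w\<in>Lv u k. ch w)"
    using depth_par[of v] desc_par_iff[of v u] by (auto simp: Lv_def ch_def intro!: bexI[of _ "par v"])
next
  fix w v assume "w \<in> Lv u k" "v \<in> ch w"
  then show "v \<in> Lv u (Suc k)" using depth_ch[of v w] desc_ch[of v w] desc_trans[of u w v]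
    by (auto simp: Lv_def)
qed

lemma finite_Lv [simp]: "finite (Lv u k)"
  by (induction k) (auto simp: Lv_Suc)

lemma sum_Lv_Suc: "sum f (Lv u (Suc k)) = (\<Sum>w\<in>Lv u k. sum f (ch w))"
  unfolding Lv_Suc by (rule sum.UNION_disjoint) (simp_all, auto simp: ch_def)

lemma Lv_add: "Lv u (j + k) = (\<Union>w\<in>Lv u j. Lv w k)"
proof safe
  fix v assume v: "v \<in> Lv u (j + k)"
  then have *: "desc u v" "depth v = depth u + (j + k)" by (auto simp: Lv_def)
  have "anc v (depth u + j) \<in> Lv u j" "v \<in> Lv (anc v (depth u + j)) k"
    using * desc_ancD[of u v "depth u + j"] desc_anc[of "depth u + j" v] depth_anc[of "depth u + j" v]
    by (auto simp: Lv_def)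
  then show "v \<in> (\<Union>w\<in>Lv u j. Lv w k)" by blast
qed (auto simp: Lv_def dest: desc_trans)

lemma sum_Lv_add: "sum f (Lv u (j + k)) = (\<Sum>w\<in>Lv u j. sum f (Lv w k))"
  unfolding Lv_add
proof (rule sum.UNION_disjoint)
  show "\<forall>i\<in>Lv u j. \<forall>i'\<in>Lv u j. i \<noteq> i' \<longrightarrow> Lv i k \<inter> Lv i' k = {}"
    by (auto simp: Lv_def desc_def)
qed auto

subsection \<open>Loops\<close>

text \<open>Indexing modulo the length treats the closing edge like every other edge, which turns
  rotation into a shift of the index.\<close>

lemma based_loop_nth:
  "xs \<in> based_loops E \<longleftrightarrow> 2 \<le> length xs \<and> (\<forall>i<length xs. (xs ! i, xs ! (Suc i mod length xs)) \<in> E)"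
proof (cases "2 \<le> length xs")
  case True
  then have ne: "xs \<noteq> []" "Suc (length xs - Suc 0) = length xs" by auto
  have eq: "{..<length xs} = insert (length xs - 1) {..<length xs - 1}" using True by auto
  have "(\<forall>i<length xs. (xs ! i, xs ! (Suc i mod length xs)) \<in> E) \<longleftrightarrow>
      (\<forall>i\<in>insert (length xs - 1) {..<length xs - 1}. (xs ! i, xs ! (Suc i mod length xs)) \<in> E)"
    unfolding eq[symmetric] by auto
  also have "\<dots> \<longleftrightarrow> (last xs, hd xs) \<in> E \<and> successively (\<lambda>u v. (u, v) \<in> E) xs"
    using True ne by (auto simp: successively_conv_nth last_conv_nth hd_conv_nth)
  finally show ?thesis using True by (auto simp: based_loops_def)
qed (auto simp: based_loops_def)

lemma rotate_based_loop [simp]: "rotate k xs \<in> based_loops E \<longleftrightarrow> xs \<in> based_loops E"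
proof -
  have imp: "rotate k xs \<in> based_loops E" if xs: "xs \<in> based_loops E" for k xs
    unfolding based_loop_nth
  proof (intro conjI allI impI)
    let ?n = "length xs"
    show "2 \<le> length (rotate k xs)" using xs by (simp add: based_loop_nth)
    fix i assume "i < length (rotate k xs)"
    then have i: "i < ?n" by simp
    have n0: "0 < ?n" using xs by (auto simp: based_loop_nth)
    have "(xs ! ((k + i) mod ?n), xs ! (Suc ((k + i) mod ?n) mod ?n)) \<in> E"
      using xs n0 by (auto simp: based_loop_nth)
    moreover have "Suc ((k + i) mod ?n) mod ?n = (k + Suc i mod ?n) mod ?n"
      by (simp add: mod_simps)
    ultimately show "(rotate k xs ! i, rotate k xs ! (Suc i mod length (rotate k xs))) \<in> E"
      using i n0 by (simp add: nth_rotate)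
  qed
  have "xs \<in> based_loops E" if "rotate k xs \<in> based_loops E"
  proof (cases "xs = []")
    case False
    \<comment> \<open>The rotation is undone by completing it to a whole number of turns;
      \<open>length xs * k\<close> is such a number and is at least \<open>k\<close>.\<close>
    have "rotate (length xs * k - k) (rotate k xs) = rotate (length xs * k) xs"
      using False by (simp add: rotate_rotate Suc_le_eq)
    also have "\<dots> = xs" using rotate_conv_mod[of "length xs * k" xs] by simp
    finally show ?thesis using imp[OF that, of "length xs * k - k"] by simp
  qed (use that in auto)
  then show ?thesis using imp by blast
qed

text \<open>Otherwise every step from \<open>A\<close> leads back into \<open>A\<close>, and
  following the loop around from \<open>a\<close> never leaves \<open>A\<close>, although it must
  arrive at \<open>b\<close>.\<close>

lemma loop_leaves:
  assumes xs: "xs \<in> based_loops E" and a: "a \<in> set xs" "a \<in> A" and b: "b \<in> set xs" "b \<notin> A"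
  shows "\<exists>x y. x \<in> set xs \<and> y \<in> set xs \<and> (x, y) \<in> E \<and> x \<in> A \<and> y \<notin> A"
proof (rule ccontr)
  assume no: "\<not> ?thesis"
  let ?n = "length xs"
  have n0: "0 < ?n" using a by auto
  obtain i where i: "i < ?n" "xs ! i = a" using a by (auto simp: in_set_conv_nth)
  obtain j where j: "j < ?n" "xs ! j = b" using b by (auto simp: in_set_conv_nth)
  have "xs ! ((i + m) mod ?n) \<in> A" for m
  proof (induction m)
    case (Suc m)
    have "(xs ! ((i + m) mod ?n), xs ! (Suc ((i + m) mod ?n) mod ?n)) \<in> E"
      using xs n0 by (auto simp: based_loop_nth)
    moreover have "xs ! ((i + m) mod ?n) \<in> set xs" "xs ! (Suc ((i + m) mod ?n) mod ?n) \<in> set xs"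
      using n0 by auto
    ultimately have "xs ! (Suc ((i + m) mod ?n) mod ?n) \<in> A" using no Suc by blast
    then show ?case by (simp add: mod_simps)
  qed (use i a in simp)
  from this[of "?n - i + j"] i j b show False by simp
qed

lemma based_loop_crosses:
  assumes "xs \<in> based_loops E" "a \<in> set xs" "desc w a" "b \<in> set xs" "\<not> desc w b"
  shows "w \<in> set xs" "par w \<in> set xs" "w \<noteq> r"
  using loop_leaves[of xs a "{v. desc w v}" b] assms edge_leaves[of _ _ w] by auto

lemma loops_repr: "l \<in> loops E \<longleftrightarrow> (\<exists>xs\<in>based_loops E. l = cyclic_shift E `` {xs})"
  by (auto simp: loops_def quotient_def)

lemma class_eq: "xs \<in> based_loops E \<Longrightarrow> cyclic_shift E `` {xs} = {rotate k xs | k. True}"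
  by (auto simp: cyclic_shift_def)

lemma loop_vertices_class: "xs \<in> based_loops E \<Longrightarrow> loop_vertices (cyclic_shift E `` {xs}) = set xs"
  by (auto simp: class_eq loop_vertices_def)

lemma class_rotate:
  assumes "xs \<in> based_loops E" shows "cyclic_shift E `` {rotate k xs} = cyclic_shift E `` {xs}"
proof -
  have "\<exists>m. rotate j xs = rotate m (rotate k xs)" for j
  proof -
    have "0 < length xs" using assms by (auto simp: based_loops_def)
    then have "k \<le> length xs * k" by (cases "length xs") auto
    have "rotate (length xs * k - k + j) (rotate k xs) = rotate (length xs * k + j) xs"
      using le_add_diff_inverse2[OF \<open>k \<le> length xs * k\<close>] by (simp only: rotate_rotate) (metis add.commute add.left_commute)
    also have "\<dots> = rotate j xs" using rotate_conv_mod[of "length xs * k + j" xs] rotate_conv_mod[of j xs] by simp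
    finally show ?thesis by metis
  qed
  moreover have "\<exists>m. rotate j (rotate k xs) = rotate m xs" for j by (metis rotate_rotate)
  ultimately show ?thesis using assms by (simp add: class_eq) metis
qed

lemma class_memD:
  assumes "l \<in> loops E" "xs \<in> l" shows "xs \<in> based_loops E" "l = cyclic_shift E `` {xs}"
proof -
  obtain ys where ys: "ys \<in> based_loops E" "l = cyclic_shift E `` {ys}" using assms by (auto simp: loops_repr)
  then obtain k where k: "xs = rotate k ys" using assms by (auto simp: class_eq)
  show "xs \<in> based_loops E" "l = cyclic_shift E `` {xs}" using k ys class_rotate by auto
qed

lemma loop_repr_hd:
  assumes "l \<in> loops E" "w \<in> loop_vertices l"
  obtains xs where "xs \<in> based_loops E" "l = cyclic_shift E `` {xs}" "hd xs = w"
proof -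
  obtain ys where ys: "ys \<in> l" "w \<in> set ys" using assms by (auto simp: loop_vertices_def)
  note b = class_memD[OF assms(1) ys(1)]
  obtain i where i: "i < length ys" "ys ! i = w" using ys by (auto simp: in_set_conv_nth)
  have "ys \<noteq> []" using i by auto
  then have "hd (rotate i ys) = w" using i by (simp add: hd_conv_nth nth_rotate)
  with b class_rotate[OF b(1), of i] show thesis by (intro that[of "rotate i ys"]) auto
qed

lemma loop_crosses:
  assumes "l \<in> loops E" "a \<in> loop_vertices l" "desc w a" "b \<in> loop_vertices l" "\<not> desc w b"
  shows "w \<in> loop_vertices l" "par w \<in> loop_vertices l" "w \<noteq> r"
proof -
  obtain xs where "xs \<in> based_loops E" "l = cyclic_shift E `` {xs}" using assms(1) by (auto simp: loops_repr)
  with assms based_loop_crosses[of xs a w b] show "w \<in> loop_vertices l" "par w \<in> loop_vertices l" "w \<noteq> r"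
    by (auto simp: loop_vertices_class)
qed

lemma countable_loops: "countable (A \<inter> loops E)"
proof -
  have "countable (lists (UNIV :: 'v set))" by (rule countable_lists[OF countable_V])
  then have "countable (based_loops E)" by (rule countable_subset[rotated]) auto
  then have "countable (loops E)" unfolding loops_def quotient_def by auto
  then show ?thesis by auto
qed

subsection \<open>Connection along paths\<close>

text \<open>An edge is named by its lower endpoint \<open>x\<close>. The parameter \<open>u\<close>
  confines the admissible loops; \<open>u = r\<close> is no restriction.\<close>

definition cov :: "'v list set set \<Rightarrow> 'v \<Rightarrow> 'v \<Rightarrow> bool" where
  "cov Q u x \<longleftrightarrow> (\<exists>l\<in>Q. loop_vertices l \<subseteq> {v. desc u v} \<and> x \<in> loop_vertices l \<and> par x \<in> loop_vertices l)"

text \<open>Loops covering consecutive edges meet in the vertex between these edges, so this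
  edge-by-edge condition encodes a chain of loops without quantifying over chains, and it is visibly
  measurable.\<close>

definition reach :: "'v list set set \<Rightarrow> 'v \<Rightarrow> 'v \<Rightarrow> bool" where
  "reach Q u v \<longleftrightarrow> desc u v \<and> (\<forall>i. depth u < i \<and> i \<le> depth v \<longrightarrow> cov Q u (anc v i))"

lemma cov_mono: "Q \<subseteq> Q' \<Longrightarrow> desc u u' \<Longrightarrow> cov Q u' x \<Longrightarrow> cov Q' u x"
  unfolding cov_def using desc_trans by blast

lemma reach_mono: "Q \<subseteq> Q' \<Longrightarrow> reach Q u v \<Longrightarrow> reach Q' u v"
  unfolding reach_def using cov_mono[of Q Q' u u] by auto

lemma reach_refl [simp]: "reach Q u u" by (auto simp: reach_def)

lemma reach_trans: "reach Q u w \<Longrightarrow> reach Q w v \<Longrightarrow> reach Q u v"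
  unfolding reach_def
proof (intro conjI allI impI; (elim conjE)?)
  assume a: "desc u w" "\<forall>i. depth u < i \<and> i \<le> depth w \<longrightarrow> cov Q u (anc w i)"
    "desc w v" "\<forall>i. depth w < i \<and> i \<le> depth v \<longrightarrow> cov Q w (anc v i)"
  show "desc u v" using a desc_trans by blast
  fix i assume i: "depth u < i" "i \<le> depth v"
  show "cov Q u (anc v i)"
  proof (cases "i \<le> depth w")
    case True then show ?thesis using a i desc_anc_eq[of w v i] by auto
  next
    case False then show ?thesis using a i cov_mono[of Q Q u w] by auto
  qed
qed

lemma reach_par_iff:
  assumes "v \<noteq> r" "desc u v" "u \<noteq> v"
  shows "reach Q u v \<longleftrightarrow> reach Q u (par v) \<and> cov Q u v"
proof -
  have "depth u < depth v" using assms desc_eq desc_depth le_neq_implies_less by blast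
  moreover have "(\<forall>i. depth u < i \<and> i \<le> depth v \<longrightarrow> cov Q u (anc v i)) \<longleftrightarrow>
    (\<forall>i. depth u < i \<and> i < depth v \<longrightarrow> cov Q u (anc v i)) \<and> cov Q u v"
    using calculation by (metis anc_self le_neq_implies_less less_imp_le_nat order_refl)
  ultimately show ?thesis
    using assms desc_par_iff[of v u] depth_par[of v] anc_par[of v]
    unfolding reach_def by (auto simp: less_Suc_eq_le[symmetric])
qed

lemma reach_prefix: "reach Q u v \<Longrightarrow> desc u w \<Longrightarrow> desc w v \<Longrightarrow> reach Q u w"
  unfolding reach_def using desc_anc_eq[of w v] desc_depth[of w v] by fastforce

lemma loop_covers:
  assumes "l \<in> Q" "Q \<subseteq> loops E" "loop_vertices l \<subseteq> {v. desc u v}"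
    and "a \<in> loop_vertices l" "desc x a" "b \<in> loop_vertices l" "\<not> desc x b"
  shows "cov Q u x"
  unfolding cov_def using loop_crosses[of l a x b] assms by blast

text \<open>An ancestral edge of \<open>b\<close> is either also ancestral to \<open>a\<close>,
  hence covered already, or separates \<open>a\<close> from \<open>b\<close>, and then
  \<open>l\<close> crosses it.\<close>

lemma loop_extends_reach:
  assumes Q: "Q \<subseteq> loops E" and l: "l \<in> Q" "a \<in> loop_vertices l" "b \<in> loop_vertices l" and a: "reach Q r a"
  shows "reach Q r b"
  unfolding reach_def
proof (intro conjI allI impI; (elim conjE)?)
  fix i assume i: "depth r < i" "i \<le> depth b"
  show "cov Q r (anc b i)"
  proof (cases "desc (anc b i) a")
    case True
    then have "anc b i = anc a i" "i \<le> depth a"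
      using i depth_anc[of i b] by (auto simp: desc_def)
    then show ?thesis using a i by (auto simp: reach_def)
  next
    case False
    then show ?thesis using i by (intro loop_covers[OF l(1) Q _ l(3) _ l(2)]) (auto simp: desc_anc)
  qed
qed simp

text \<open>A chain of loops extends reachability one loop at a time. Conversely, by induction on
  depth, the loop covering the last edge is appended to a chain ending at \<open>par v\<close>, a
  vertex common to both.\<close>

lemma cluster_eq: "cluster E \<omega> r = {v. reach (open_loops E \<omega>) r v}"
proof -
  let ?Q = "open_loops E \<omega>"
  have Q: "?Q \<subseteq> loops E" by (auto simp: open_loops_def)
  have "reach ?Q r v" if "loop_connected E \<omega> r v" for v
  proof (cases "r = v")
    case False
    then obtain ls where ls: "ls \<noteq> []" "set ls \<subseteq> ?Q" "r \<in> loop_vertices (hd ls)" "v \<in> loop_vertices (last ls)"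
      "successively (\<lambda>l l'. loop_vertices l \<inter> loop_vertices l' \<noteq> {}) ls"
      using \<open>loop_connected E \<omega> r v\<close> by (auto simp: loop_connected_def)
    \<comment> \<open>The starting vertex is generalised to \<open>a\<close>, because the tail of a
      chain starts at an intersection vertex instead of the root.\<close>
    have "reach ?Q r v" if "ls \<noteq> []" "set ls \<subseteq> ?Q" "a \<in> loop_vertices (hd ls)" "reach ?Q r a" "v \<in> loop_vertices (last ls)"
      "successively (\<lambda>l l'. loop_vertices l \<inter> loop_vertices l' \<noteq> {}) ls" for a ls
      using that
    proof (induction ls arbitrary: a)
      case (Cons l ls)
      show ?case
      proof (cases "ls = []")
        case True then show ?thesis using Cons loop_extends_reach[OF Q, of l a v] by auto
      next
        case False
        then obtain b where b: "b \<in> loop_vertices l" "b \<in> loop_vertices (hd ls)" using Cons.prems by (auto simp: successively_Cons)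
        have "reach ?Q r b" using Cons.prems b loop_extends_reach[OF Q, of l a b] by auto
        then show ?thesis using Cons b False by (intro Cons.IH[of b]) (auto simp: successively_Cons)
      qed
    qed simp
    from this[OF ls(1-3) reach_refl ls(4,5)] show ?thesis .
  qed (metis reach_refl)
  moreover have "loop_connected E \<omega> r v" if "reach ?Q r v" for v
    using that
  proof (induction "depth v" arbitrary: v)
    case 0 then show ?case by (simp add: loop_connected_def)
  next
    case (Suc n)
    then have v: "v \<noteq> r" by auto
    then have p: "reach ?Q r (par v)" "cov ?Q r v" using Suc.prems reach_par_iff[of v r] by auto
    have "n = depth (par v)" using Suc depth_par[OF v] by simp
    from Suc.hyps(1)[OF this p(1)] have IH: "loop_connected E \<omega> r (par v)" .
    obtain l where l: "l \<in> ?Q" "v \<in> loop_vertices l" "par v \<in> loop_vertices l" using p(2) by (auto simp: cov_def)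
    show ?case
    proof (cases "r = par v")
      case True
      then show ?thesis using l by (auto simp: loop_connected_def intro!: exI[of _ "[l]"])
    next
      case False
      then obtain ls where ls: "ls \<noteq> []" "set ls \<subseteq> ?Q" "r \<in> loop_vertices (hd ls)" "par v \<in> loop_vertices (last ls)"
        "successively (\<lambda>l l'. loop_vertices l \<inter> loop_vertices l' \<noteq> {}) ls"
        using IH by (auto simp: loop_connected_def)
      then show ?thesis using l unfolding loop_connected_def
        by (intro disjI2 exI[of _ "ls @ [l]"]) (auto simp: successively_append_iff)
    qed
  qed
  ultimately show ?thesis by (auto simp: cluster_def)
qed

text \<open>Separates a connection into one loop through the root and a connection inside a subtree.
  No loop can serve in both parts, since a loop through the root is not contained below
  \<open>anc v i\<close>; this yields independence in \<open>p_root_le\<close>.\<close>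

lemma reach_root_decompose:
  assumes Q: "Q \<subseteq> loops E" and v: "v \<noteq> r" and reach: "reach Q r v"
  shows "\<exists>i. 1 \<le> i \<and> i \<le> depth v \<and> (\<exists>l\<in>Q. r \<in> loop_vertices l \<and> anc v i \<in> loop_vertices l) \<and> reach Q (anc v i) v"
proof -
  define n where "n = depth v"
  have n: "1 \<le> n" using v by (simp add: n_def Suc_le_eq) (use depth_eq_0_iff in blast)
  have cov: "cov Q r (anc v i)" if "1 \<le> i" "i \<le> n" for i using reach that by (auto simp: reach_def n_def)
  define H where "H = {j. 1 \<le> j \<and> j \<le> n \<and> (\<exists>l\<in>Q. r \<in> loop_vertices l \<and> anc v j \<in> loop_vertices l)}"
  have "par (anc v 1) = r" using n par_anc[of 0 v] by (simp add: n_def)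
  then have "1 \<in> H" using cov[of 1] n by (auto simp: H_def cov_def)
  have fH: "finite H" by (auto simp: H_def)
  \<comment> \<open>The deepest level of the path visited by a loop through the root. By maximality,
    every loop covering a deeper edge of the path misses the root.\<close>
  define J where "J = Max H"
  have J: "J \<in> H" using \<open>1 \<in> H\<close> fH unfolding J_def by (intro Max_in) auto
  have Jmax: "j \<le> J" if "j \<in> H" for j using that fH by (simp add: J_def)
  obtain l0 where l0: "l0 \<in> Q" "r \<in> loop_vertices l0" "anc v J \<in> loop_vertices l0" using J by (auto simp: H_def)
  show ?thesis
  proof (cases "J = n")
    case True
    then show ?thesis using J n l0 by (intro exI[of _ J]) (auto simp: H_def n_def)
  next
    case False
    then have Jn: "1 \<le> J" "J < n" using J by (auto simp: H_def)
    have "\<forall>j\<in>{J<..n}. \<exists>l. l \<in> Q \<and> anc v j \<in> loop_vertices l \<and> par (anc v j) \<in> loop_vertices l"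
    proof
      fix j assume "j \<in> {J<..n}"
      then have "cov Q r (anc v j)" using Jn by (intro cov) auto
      then show "\<exists>l. l \<in> Q \<and> anc v j \<in> loop_vertices l \<and> par (anc v j) \<in> loop_vertices l"
        unfolding cov_def by blast
    qed
    from bchoice[OF this] obtain L where
      "\<forall>j\<in>{J<..n}. L j \<in> Q \<and> anc v j \<in> loop_vertices (L j) \<and> par (anc v j) \<in> loop_vertices (L j)" ..
    then have L: "L j \<in> Q \<and> anc v j \<in> loop_vertices (L j) \<and> par (anc v j) \<in> loop_vertices (L j)" if "j \<in> {J<..n}" for j
      using that by simp
    \<comment> \<open>The topmost level of the path visited by \<open>L j\<close>.\<close>
    define t where "t j = (LEAST i. anc v i \<in> loop_vertices (L j))" for j
    have t: "anc v (t j) \<in> loop_vertices (L j)" "t j < j" if "j \<in> {J<..n}" for j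
    proof -
      have "anc v j \<in> loop_vertices (L j)" using L[OF that] by simp
      then show "anc v (t j) \<in> loop_vertices (L j)"
        unfolding t_def by (rule LeastI[where P = "\<lambda>i. anc v i \<in> loop_vertices (L j)"])
      have "anc v (j - 1) \<in> loop_vertices (L j)" using L[OF that] par_anc[of "j - 1" v] that Jn by (auto simp: n_def)
      then have "t j \<le> j - 1" unfolding t_def by (rule Least_le)
      then show "t j < j" using that Jn by auto
    qed
    have rL: "r \<notin> loop_vertices (L j)" if "j \<in> {J<..n}" for j
    proof
      assume "r \<in> loop_vertices (L j)"
      then have "j \<in> H" using L[OF that] that Jn by (auto simp: H_def)
      from Jmax[OF this] that show False by simp
    qed
    have t1: "1 \<le> t j" if "j \<in> {J<..n}" for j
      using t(1)[OF that] rL[OF that] by (cases "t j") auto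
    \<comment> \<open>A vertex outside this subtree would force the loop through the parent of its
      topmost path vertex.\<close>
    have sub: "loop_vertices (L j) \<subseteq> {x. desc (anc v (t j)) x}" if j: "j \<in> {J<..n}" for j
    proof (rule ccontr)
      assume "\<not> ?thesis"
      then obtain b where b: "b \<in> loop_vertices (L j)" "\<not> desc (anc v (t j)) b" by auto
      have "par (anc v (t j)) \<in> loop_vertices (L j)"
        using loop_crosses(2)[of "L j" "anc v (t j)" "anc v (t j)" b] b t(1)[OF j] L[OF j] Q by auto
      moreover have "par (anc v (t j)) = anc v (t j - 1)"
        using par_anc[of "t j - 1" v] t1[OF j] t(2)[OF j] j by (simp add: n_def)
      ultimately have "t j \<le> t j - 1" using Least_le[of "\<lambda>i. anc v i \<in> loop_vertices (L j)" "t j - 1"] by (simp add: t_def)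
      then show False using t1[OF j] by simp
    qed
    \<comment> \<open>All chosen loops lie below \<open>anc v i\<close>. Moreover
      \<open>i \<le> J\<close>, because the loop covering the edge from level \<open>J\<close> to
      level \<open>Suc J\<close> visits level \<open>J\<close>; hence \<open>l0\<close> passes
      through \<open>anc v i\<close> on its way from the root to level \<open>J\<close>.\<close>
    define i where "i = Min (t ` {J<..n})"
    have ne: "t ` {J<..n} \<noteq> {}" using Jn by auto
    have i_le: "i \<le> t j" if "j \<in> {J<..n}" for j using that by (simp add: i_def)
    have "i \<in> t ` {J<..n}" unfolding i_def using ne by (intro Min_in) auto
    then obtain j0 where j0: "j0 \<in> {J<..n}" "i = t j0" by auto
    have i1: "1 \<le> i" using j0 t1 by auto
    have iJ: "i \<le> J" using i_le[of "Suc J"] t(2)[of "Suc J"] Jn by auto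
    have da: "desc (anc v i) (anc v j)" if "i \<le> j" "j \<le> n" for i j
      using desc_ancD[of "anc v i" v j] desc_anc[of i v] depth_anc[of i v] that by (auto simp: n_def)
    have "anc v i \<in> loop_vertices l0"
      using loop_crosses(1)[of l0 "anc v J" "anc v i" r] l0 Q da[OF iJ] Jn iJ i1
        desc_depth[of "anc v i" r] depth_anc[of i v] by (auto simp: n_def)
    moreover have "reach Q (anc v i) v"
      unfolding reach_def
    proof (intro conjI allI impI; (elim conjE)?)
      show "desc (anc v i) v" using iJ Jn by (intro desc_anc) (auto simp: n_def)
      fix j assume "depth (anc v i) < j" "j \<le> depth v"
      then have j: "i < j" "j \<le> n" using iJ Jn depth_anc[of i v] by (auto simp: n_def)
      \<comment> \<open>Edges deeper than \<open>J\<close> have their own loop. Those between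
        \<open>i\<close> and \<open>J\<close> are covered by the one loop attaining the minimum,
        which stretches from level \<open>i\<close> to beyond \<open>J\<close>.\<close>
      show "cov Q (anc v i) (anc v j)"
      proof (cases "J < j")
        case True
        then have jj: "j \<in> {J<..n}" using j by auto
        have "desc (anc v i) (anc v (t j))" using i_le[OF jj] t(2)[OF jj] j by (intro da) auto
        then have "loop_vertices (L j) \<subseteq> {x. desc (anc v i) x}" using sub[OF jj] desc_trans by blast
        then show ?thesis using L[OF jj] by (auto simp: cov_def)
      next
        case False
        have "\<not> desc (anc v j) (anc v i)" using desc_depth[of "anc v j" "anc v i"] depth_anc[of i v] depth_anc[of j v] j iJ Jn
          by (auto simp: n_def)
        then show ?thesis
          using L[OF j0(1)] Q sub[OF j0(1)] t(1)[OF j0(1)] j0 False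
          by (intro loop_covers[of "L j0" Q _ "anc v j0" _ "anc v i"] da) auto
      qed
    qed
    ultimately show ?thesis using i1 iJ Jn l0 by (intro exI[of _ i]) (auto simp: n_def)
  qed
qed

subsection \<open>Closed walks\<close>

text \<open>Walks of n steps from \<open>x\<close> to the root, written without their final vertex.
  This matches the encoding of based loops, whose closing edge is implicit.\<close>

primrec Wk :: "nat \<Rightarrow> 'v \<Rightarrow> 'v list set" where
  "Wk 0 x = (if x = r then {[]} else {})"
| "Wk (Suc n) x = (#) x ` (\<Union>y\<in>E `` {x}. Wk n y)"

lemma finite_Wk [simp]: "finite (Wk n x)"
  by (induction n arbitrary: x) (auto intro!: finite_imageI simp: finite_nbrs)

lemma card_Wk_Suc: "card (Wk (Suc n) x) \<le> (\<Sum>y\<in>E `` {x}. card (Wk n y))"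
proof -
  have "card (Wk (Suc n) x) \<le> card (\<Union>y\<in>E `` {x}. Wk n y)"
    by (simp add: card_image_le finite_nbrs)
  also have "\<dots> \<le> (\<Sum>y\<in>E `` {x}. card (Wk n y))" by (rule card_UN_le[OF finite_nbrs])
  finally show ?thesis .
qed

lemma length_Wk: "xs \<in> Wk n x \<Longrightarrow> length xs = n"
  by (induction n arbitrary: x xs) (auto split: if_splits)

lemma walk_in_Wk:
  "xs \<noteq> [] \<Longrightarrow> successively (\<lambda>u v. (u, v) \<in> E) xs \<Longrightarrow> (last xs, r) \<in> E \<Longrightarrow> xs \<in> Wk (length xs) (hd xs)"
proof (induction xs)
  case (Cons x xs)
  show ?case
  proof (cases "xs = []")
    case True
    then show ?thesis using Cons by auto
  next
    case False
    then have "xs \<in> Wk (length xs) (hd xs)" "(x, hd xs) \<in> E" using Cons by (auto simp: successively_Cons)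
    then show ?thesis by auto
  qed
qed simp

text \<open>
  At the critical weight the Green function at the root is dominated by the superharmonic
  function \<open>(d - 1) powr (- depth v / 2)\<close>, which is strictly superharmonic at the root.
\<close>

lemma closed_walk_sum:
  fixes s :: real
  assumes d: "3 \<le> d" and s: "0 \<le> s" "s \<le> 1 / (2 * sqrt (real d - 1))"
  shows "(\<Sum>n<N. s ^ n * card (Wk n x)) \<le> 4 * (1 / sqrt (real d - 1)) ^ depth x"
proof -
  define q where "q = 1 / sqrt (real d - 1)"
  have q: "0 < q" "(real d - 1) * q = 1 / q" "s \<le> q / 2" "q\<^sup>2 = 1 / (real d - 1)"
    using d s by (auto simp: q_def real_div_sqrt power_divide)
  define h where "h v = q ^ depth v" for v
  have h0: "0 \<le> h v" for v using q by (simp add: h_def)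
  \<comment> \<open>The factor 4 pays for the unit source: at the root the neighbours return at most
    2 d / (d - 1), which is at most 3 and equals 3 for d = 3. Elsewhere the parent and the d - 1
    children together contribute equal shares h / q, so \<open>h\<close> is harmonic at the critical
    weight q / 2.\<close>
  have super: "(if v = r then 1 else 0) + s * (\<Sum>w\<in>E `` {v}. 4 * h w) \<le> 4 * h v" for v
  proof (cases "v = r")
    case True
    have "(\<Sum>w\<in>E `` {v}. 4 * h w) = (\<Sum>w\<in>E `` {v}. 4 * q)"
      using True depth_ch[of _ r] by (intro sum.cong) (auto simp: nbrs_eq h_def)
    also have "\<dots> = real d * (4 * q)" by (simp add: card_nbrs)
    finally have "s * (\<Sum>w\<in>E `` {v}. 4 * h w) = s * (real d * (4 * q))" by simp
    also have "\<dots> \<le> q / 2 * (real d * (4 * q))" using q by (intro mult_right_mono) auto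
    also have "\<dots> = 2 * (q\<^sup>2 * real d)" by (simp add: power2_eq_square)
    also have "\<dots> \<le> 3" unfolding q using d by (simp add: field_simps)
    finally show ?thesis using True by (simp add: h_def)
  next
    case False
    have "par v \<notin> ch v" using depth_ch[of "par v" v] depth_par[OF False] by auto
    then have "(\<Sum>w\<in>E `` {v}. 4 * h w) = 4 * h (par v) + (\<Sum>w\<in>ch v. 4 * h w)"
      using False by (simp add: nbrs_eq)
    also have "(\<Sum>w\<in>ch v. 4 * h w) = (\<Sum>w\<in>ch v. 4 * (q * h v))"
      by (intro sum.cong) (auto simp: h_def depth_ch)
    also have "\<dots> = 4 * ((real d - 1) * q) * h v" using d by (simp add: card_ch[OF False] of_nat_diff)
    also have "h (par v) = h v / q"
      using q by (simp add: h_def flip: depth_par[OF False])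
    also have "4 * (h v / q) + 4 * ((real d - 1) * q) * h v = 8 * (h v / q)"
      unfolding q by simp
    finally have "s * (\<Sum>w\<in>E `` {v}. 4 * h w) = s * (8 * (h v / q))" by simp
    also have "\<dots> \<le> q / 2 * (8 * (h v / q))" using q h0 by (intro mult_right_mono) auto
    also have "\<dots> = 4 * h v" using q by simp
    finally show ?thesis using False by simp
  qed
  have "(\<Sum>n<N. s ^ n * card (Wk n x)) \<le> 4 * h x"
  proof (induction N arbitrary: x)
    case (Suc N)
    have "(\<Sum>n<Suc N. s ^ n * card (Wk n x)) = (if x = r then 1 else 0) + (\<Sum>n<N. s ^ Suc n * card (Wk (Suc n) x))"
      by (subst sum.lessThan_Suc_shift) auto
    also have "(\<Sum>n<N. s ^ Suc n * card (Wk (Suc n) x)) \<le> (\<Sum>n<N. s ^ Suc n * real (\<Sum>y\<in>E `` {x}. card (Wk n y)))"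
      using s by (intro sum_mono mult_left_mono of_nat_mono card_Wk_Suc) auto
    also have "\<dots> = s * (\<Sum>y\<in>E `` {x}. \<Sum>n<N. s ^ n * card (Wk n y))"
      by (subst sum.swap) (simp add: sum_distrib_left mult.assoc)
    also have "\<dots> \<le> s * (\<Sum>y\<in>E `` {x}. 4 * h y)"
      using s by (intro mult_left_mono sum_mono Suc) auto
    finally show ?case using super[of x] by linarith
  qed (use h0 in simp)
  then show ?thesis by (simp add: h_def q_def)
qed

text \<open>The Green function bound for arbitrary finite families of closed walks. Since the root
  of the locale is arbitrary, it can be applied at any vertex by re-rooting the tree.\<close>

lemma closed_walk_bound:
  fixes s :: real
  assumes d: "3 \<le> d" and s: "0 \<le> s" "s \<le> 1 / (2 * sqrt (real d - 1))"
    and F: "finite F" "\<And>xs. xs \<in> F \<Longrightarrow> xs = [] \<or>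
      successively (\<lambda>u v. (u, v) \<in> E) xs \<and> hd xs = r \<and> (last xs, r) \<in> E"
  shows "(\<Sum>xs\<in>F. s ^ length xs) \<le> 4"
proof -
  define N where "N = Suc (Max (length ` F))"
  have "F \<subseteq> (\<Union>n<N. Wk n r)"
  proof
    fix xs assume xs: "xs \<in> F"
    then have "length xs < N" using F(1) by (auto simp: N_def less_Suc_eq_le)
    moreover have "xs \<in> Wk (length xs) r" using F(2)[OF xs] walk_in_Wk[of xs] by (cases "xs = []") auto
    ultimately show "xs \<in> (\<Union>n<N. Wk n r)" by blast
  qed
  then have "(\<Sum>xs\<in>F. s ^ length xs) \<le> (\<Sum>xs\<in>(\<Union>n<N. Wk n r). s ^ length xs)"
    using s by (intro sum_mono2) auto
  also have "\<dots> = (\<Sum>n<N. \<Sum>xs\<in>Wk n r. s ^ length xs)"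
    by (rule sum.UNION_disjoint) (auto dest: length_Wk)
  also have "\<dots> = (\<Sum>n<N. s ^ n * card (Wk n r))"
    by (intro sum.cong refl) (simp add: length_Wk mult.commute)
  also have "\<dots> \<le> 4" using closed_walk_sum[OF d s, where N = N and x = r] by simp
  finally show ?thesis .
qed

subsection \<open>Translations between subtrees\<close>

definition child :: "'v \<Rightarrow> nat \<Rightarrow> 'v" where
  "child x = (SOME f. bij_betw f {..<d - 1} (ch x))"

lemma child_bij: "x \<noteq> r \<Longrightarrow> bij_betw (child x) {..<d - 1} (ch x)"
proof -
  assume "x \<noteq> r"
  then have "\<exists>f. bij_betw f {..<d - 1} (ch x)"
    using ex_bij_betw_nat_finite[OF finite_ch, of x] card_ch by (auto simp: atLeast0LessThan)
  then show ?thesis unfolding child_def by (rule someI_ex)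
qed

text \<open>The head of a code is the last step down, so that taking the parent amounts to removing
  the head.\<close>

primrec node :: "'v \<Rightarrow> nat list \<Rightarrow> 'v" where
  "node u [] = u"
| "node u (i # t) = child (node u t) i"

definition codes :: "nat list set" where
  "codes = lists {..<d - 1}"

lemma codes_simps [simp]: "[] \<in> codes" "i # t \<in> codes \<longleftrightarrow> i < d - 1 \<and> t \<in> codes"
  by (auto simp: codes_def)

lemma node_props:
  assumes "u \<noteq> r" "t \<in> codes"
  shows "node u t \<noteq> r \<and> desc u (node u t) \<and> depth (node u t) = depth u + length t"
  using assms(2)
proof (induction t)
  case (Cons i t)
  then have IH: "node u t \<noteq> r \<and> desc u (node u t) \<and> depth (node u t) = depth u + length t" by simp
  then have c: "child (node u t) i \<in> ch (node u t)"
    using Cons.prems child_bij[of "node u t"] by (auto dest: bij_betwE)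
  show ?case using IH c desc_trans[OF _ desc_ch[OF c], of u] depth_ch[OF c] by (auto simp: ch_def)
qed (use assms in auto)

lemma node_Cons:
  assumes "u \<noteq> r" "t \<in> codes" "i < d - 1"
  shows "child (node u t) i \<in> ch (node u t)" "par (node u (i # t)) = node u t"
proof -
  show "child (node u t) i \<in> ch (node u t)"
    using child_bij[of "node u t"] bij_betwE node_props[OF assms(1,2)] assms by auto
  then show "par (node u (i # t)) = node u t" by (auto simp: ch_def)
qed

lemma node_inj: assumes u: "u \<noteq> r" shows "inj_on (node u) codes"
proof -
  have "t = t'" if "t \<in> codes" "t' \<in> codes" "node u t = node u t'" for t t'
    using that
  proof (induction t arbitrary: t')
    case Nil
    then show ?case using node_props[OF u, of t'] by auto
  next
    case (Cons i t)
    then obtain j t'' where t': "t' = j # t''" using node_props[OF u, of t'] node_props[OF u, of "i # t"] by (cases t') auto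
    have m: "t \<in> codes" "i < d - 1" "t'' \<in> codes" "j < d - 1" using Cons.prems t' by auto
    have "par (node u (i # t)) = par (node u (j # t''))" using Cons.prems t' by simp
    then have "node u t = node u t''" unfolding node_Cons(2)[OF u m(1,2)] node_Cons(2)[OF u m(3,4)] .
    then have "t = t''" using Cons t' by auto
    moreover have "i = j"
      using Cons.prems t' \<open>t = t''\<close> child_bij[of "node u t"] node_props[OF u, of t] by (auto simp: bij_betw_def inj_on_def)
    ultimately show ?case using t' by simp
  qed
  then show ?thesis by (intro inj_onI)
qed

lemma node_surj: assumes u: "u \<noteq> r" and v: "desc u v" shows "v \<in> node u ` codes"
proof -
  have "v \<in> Lv u k \<Longrightarrow> v \<in> node u ` codes" for k v
  proof (induction k arbitrary: v)
    case 0
    have "node u [] = u" "[] \<in> codes" by auto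
    then show ?case using 0 by (metis Lv_0 image_eqI singletonD)
  next
    case (Suc k)
    then obtain w where w: "w \<in> Lv u k" "v \<in> ch w" by (auto simp: Lv_Suc)
    then obtain t where t: "t \<in> codes" "w = node u t" using Suc.IH by auto
    have "w \<noteq> r" using t node_props[OF u] by auto
    then obtain i where "i < d - 1" "v = child w i" using child_bij[of w] w by (auto simp: bij_betw_def)
    then have "v = node u (i # t)" "i # t \<in> codes" using t by auto
    then show ?case by blast
  qed
  from this[of v "depth v - depth u"] show ?thesis using v desc_depth[OF v] by (auto simp: Lv_def)
qed

text \<open>Matches vertices with equal codes. Outside the subtree below \<open>u\<close> the value
  is unspecified, and the root is excluded because its number of children differs.\<close>

definition iso :: "'v \<Rightarrow> 'v \<Rightarrow> 'v \<Rightarrow> 'v" where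
  "iso u u' v = node u' (the_inv_into codes (node u) v)"

lemma iso_node: "u \<noteq> r \<Longrightarrow> t \<in> codes \<Longrightarrow> iso u u' (node u t) = node u' t"
  unfolding iso_def by (subst the_inv_into_f_f[OF node_inj]) auto

lemma iso_iso: "u \<noteq> r \<Longrightarrow> u' \<noteq> r \<Longrightarrow> desc u v \<Longrightarrow> iso u' u (iso u u' v) = v"
  using node_surj[of u v] by (auto simp: iso_node)

lemma iso_desc: "u \<noteq> r \<Longrightarrow> u' \<noteq> r \<Longrightarrow> desc u v \<Longrightarrow> desc u' (iso u u' v)"
  using node_surj[of u v] node_props by (auto simp: iso_node)

lemma iso_base [simp]: "u \<noteq> r \<Longrightarrow> iso u u' u = u'"
  using iso_node[of u "[]" u'] by simp

lemma iso_depth: "u \<noteq> r \<Longrightarrow> u' \<noteq> r \<Longrightarrow> desc u v \<Longrightarrow> depth (iso u u' v) + depth u = depth u' + depth v"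
  using node_surj[of u v] node_props by (auto simp: iso_node)

lemma iso_par:
  assumes "u \<noteq> r" "u' \<noteq> r" "desc u v" "v \<noteq> u"
  shows "par (iso u u' v) = iso u u' (par v)" "iso u u' v \<noteq> u'" "iso u u' v \<noteq> r"
proof -
  obtain t where t: "t \<in> codes" "v = node u t" using node_surj[OF assms(1,3)] by auto
  then obtain i t' where t': "t = i # t'" using assms by (cases t) auto
  show "par (iso u u' v) = iso u u' (par v)"
    using t t' assms node_Cons(2)[of u t' i] node_Cons(2)[of u' t' i] iso_node[of u t u'] iso_node[of u t' u'] by auto
  show "iso u u' v \<noteq> u'" by (metis assms iso_iso iso_base)
  show "iso u u' v \<noteq> r" using desc_ne_root iso_desc assms by blast
qed

lemma iso_edge:
  assumes "u \<noteq> r" "u' \<noteq> r" "desc u x" "desc u y" "(x, y) \<in> E"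
  shows "(iso u u' x, iso u u' y) \<in> E"
proof -
  have *: "(iso u u' (par y), iso u u' y) \<in> E" if "y \<noteq> r" "desc u y" "desc u (par y)" for y
  proof -
    have "y \<noteq> u" using that desc_par_self assms by auto
    then show ?thesis using iso_par[of u u' y] par_edge[of "iso u u' y"] assms that by auto
  qed
  show ?thesis using assms(5) *[of x] *[of y] assms E_sym by (auto simp: edge_iff[of x y])
qed

abbreviation LT :: "'v \<Rightarrow> 'v list set set" where
  "LT u \<equiv> {l \<in> loops E. loop_vertices l \<subseteq> {v. desc u v}}"

definition liso :: "'v \<Rightarrow> 'v \<Rightarrow> 'v list set \<Rightarrow> 'v list set" where
  "liso u u' l = map (iso u u') ` l"

lemma liso_class:
  assumes u: "u \<noteq> r" "u' \<noteq> r" and xs: "xs \<in> based_loops E" "set xs \<subseteq> {v. desc u v}"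
  shows "map (iso u u') xs \<in> based_loops E"
    "liso u u' (cyclic_shift E `` {xs}) = cyclic_shift E `` {map (iso u u') xs}"
proof -
  show b: "map (iso u u') xs \<in> based_loops E"
    unfolding based_loop_nth
  proof (intro conjI allI impI)
    show "2 \<le> length (map (iso u u') xs)" using xs by (simp add: based_loop_nth)
    fix i assume "i < length (map (iso u u') xs)"
    then have i: "i < length xs" by simp
    then have "0 < length xs" by linarith
    with i have i: "i < length xs" "Suc i mod length xs < length xs" by simp_all
    then have "(iso u u' (xs ! i), iso u u' (xs ! (Suc i mod length xs))) \<in> E"
      using xs by (intro iso_edge u) (auto simp: based_loop_nth subset_eq)
    then show "(map (iso u u') xs ! i, map (iso u u') xs ! (Suc i mod length (map (iso u u') xs))) \<in> E"
      using i by simp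
  qed
  show "liso u u' (cyclic_shift E `` {xs}) = cyclic_shift E `` {map (iso u u') xs}"
    using xs b by (auto simp: class_eq liso_def rotate_map)
qed

lemma liso_props:
  assumes u: "u \<noteq> r" "u' \<noteq> r" and l: "l \<in> LT u"
  shows "liso u u' l \<in> LT u'" "loop_vertices (liso u u' l) = iso u u' ` loop_vertices l" "liso u' u (liso u u' l) = l"
proof -
  obtain xs where xs: "xs \<in> based_loops E" "l = cyclic_shift E `` {xs}" using l by (auto simp: loops_repr)
  have sub: "set xs \<subseteq> {v. desc u v}" using l xs loop_vertices_class by auto
  show v: "loop_vertices (liso u u' l) = iso u u' ` loop_vertices l"
    using xs by (auto simp: liso_def loop_vertices_def)
  have "loop_vertices l \<subseteq> {v. desc u v}" using l by auto
  then show "liso u u' l \<in> LT u'" unfolding mem_Collect_eq v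
    using liso_class[OF u xs(1) sub] xs(2) iso_desc[OF u] by (auto simp: loops_repr)
  have "map (iso u' u) (map (iso u u') ys) = ys" if "ys \<in> l" for ys
    using \<open>loop_vertices l \<subseteq> _\<close> that by (auto simp: loop_vertices_def iso_iso u intro!: map_idI)
  then show "liso u' u (liso u u' l) = l" by (force simp: liso_def)
qed

lemma liso_bij:
  assumes "u \<noteq> r" "u' \<noteq> r"
  shows "bij_betw (liso u u') (LT u) (LT u')"
proof (rule bij_betw_byWitness[where f' = "liso u' u"])
  show "\<forall>l\<in>LT u. liso u' u (liso u u' l) = l" by (intro ballI liso_props(3) assms)
  show "\<forall>l\<in>LT u'. liso u u' (liso u' u l) = l" by (intro ballI liso_props(3) assms)
  show "liso u u' ` LT u \<subseteq> LT u'" by (intro image_subsetI liso_props(1) assms)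
  show "liso u' u ` LT u' \<subseteq> LT u" by (intro image_subsetI liso_props(1) assms)
qed

text \<open>The mass of a loop involves the number of its distinct rotations, so a translation must
  preserve this number as well as the length.\<close>

lemma card_liso:
  assumes u: "u \<noteq> r" "u' \<noteq> r" and l: "l \<in> LT u"
  shows "card (liso u u' l) = card l"
proof -
  have sub: "loop_vertices l \<subseteq> {v. desc u v}" using l by auto
  have "map (iso u' u) (map (iso u u') ys) = ys" if "ys \<in> l" for ys
    using sub that by (auto simp: loop_vertices_def iso_iso u intro!: map_idI)
  then have "inj_on (map (iso u u')) l" by (metis inj_on_inverseI)
  then show ?thesis unfolding liso_def by (rule card_image)
qed

lemma iso_Lv:
  assumes "u \<noteq> r" "u' \<noteq> r"
  shows "bij_betw (iso u u') (Lv u k) (Lv u' k)"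
proof -
  have mem: "iso u u' v \<in> Lv u' k" if "v \<in> Lv u k" "u \<noteq> r" "u' \<noteq> r" for u u' v
    using that iso_depth[of u u' v] iso_desc[of u u' v] by (simp add: Lv_def)
  show ?thesis
  proof (rule bij_betw_byWitness[where f' = "iso u' u"])
    show "iso u u' ` Lv u k \<subseteq> Lv u' k" "iso u' u ` Lv u' k \<subseteq> Lv u k"
      using mem assms by blast+
  qed (auto simp: Lv_def iso_iso assms)
qed

lemma cov_iso:
  assumes u: "u \<noteq> r" "u' \<noteq> r" and v: "desc u v" "v \<noteq> u"
    and Q: "Q \<subseteq> loops E" "\<And>l. l \<in> LT u \<Longrightarrow> l \<in> Q \<Longrightarrow> liso u u' l \<in> Q'"
    and c: "cov Q u v"
  shows "cov Q' u' (iso u u' v)"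
proof -
  obtain l where l: "l \<in> Q" "loop_vertices l \<subseteq> {v. desc u v}" "v \<in> loop_vertices l" "par v \<in> loop_vertices l"
    using c by (auto simp: cov_def)
  then have "l \<in> LT u" using Q by auto
  note p = liso_props[OF u this]
  show ?thesis unfolding cov_def using p(1,2) Q(2)[OF \<open>l \<in> LT u\<close> l(1)] l iso_par(1)[OF u v]
    by (intro bexI[of _ "liso u u' l"]) auto
qed

lemma reach_iso1:
  assumes u: "u \<noteq> r" "u' \<noteq> r" and v: "reach Q u v"
    and Q: "Q \<subseteq> loops E" "\<And>l. l \<in> LT u \<Longrightarrow> l \<in> Q \<Longrightarrow> liso u u' l \<in> Q'"
  shows "reach Q' u' (iso u u' v)"
  using v
proof (induction "depth v" arbitrary: v)
  case 0
  then show ?case using u by (auto simp: reach_def dest: desc_depth)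
next
  case (Suc n)
  show ?case
  proof (cases "v = u")
    case False
    have "v \<noteq> r" "desc u v" using Suc by (auto simp: reach_def)
    then have *: "reach Q u (par v)" "cov Q u v" using Suc.prems reach_par_iff False by auto
    have "n = depth (par v)" using Suc depth_par[of v] \<open>v \<noteq> r\<close> by simp
    from Suc.hyps(1)[OF this *(1)] have "reach Q' u' (iso u u' (par v))" .
    moreover have "cov Q' u' (iso u u' v)" using \<open>desc u v\<close> * False by (intro cov_iso[OF u _ _ Q]) auto
    ultimately show ?thesis
      using reach_par_iff[of "iso u u' v" u' Q'] iso_par[OF u \<open>desc u v\<close> False] iso_desc[OF u \<open>desc u v\<close>] by metis
  qed (use u in simp)
qed

lemma reach_iso:
  assumes u: "u \<noteq> r" "u' \<noteq> r" and v: "desc u v"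
    and Q: "Q \<subseteq> loops E" "Q' \<subseteq> loops E" "\<And>l. l \<in> LT u \<Longrightarrow> l \<in> Q \<longleftrightarrow> liso u u' l \<in> Q'"
  shows "reach Q' u' (iso u u' v) \<longleftrightarrow> reach Q u v"
proof
  assume "reach Q u v"
  then show "reach Q' u' (iso u u' v)" using Q by (intro reach_iso1 u) auto
next
  assume "reach Q' u' (iso u u' v)"
  then have "reach Q u (iso u' u (iso u u' v))"
  proof (rule reach_iso1[OF u(2,1)])
    fix l assume l: "l \<in> LT u'" "l \<in> Q'"
    show "liso u' u l \<in> Q" using Q(3)[of "liso u' u l"] liso_props[OF u(2,1) l(1)] l(2) by metis
  qed (use Q in auto)
  then show "reach Q u v" using iso_iso u v by simp
qed

end

section \<open>Measurability of countable quantifiers\<close>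

lemma pred_Bex_countable:
  assumes "countable X" "\<And>x. x \<in> X \<Longrightarrow> Measurable.pred M (\<lambda>\<omega>. R x \<omega>)"
  shows "Measurable.pred M (\<lambda>\<omega>. \<exists>x\<in>X. R x \<omega>)"
proof -
  have "{\<omega>\<in>space M. \<exists>x\<in>X. R x \<omega>} = (\<Union>x\<in>X. {\<omega>\<in>space M. R x \<omega>})" by auto
  also have "\<dots> \<in> sets M" using assms by (intro sets.countable_UN') (auto simp: pred_def)
  finally show ?thesis by (simp add: pred_def)
qed

lemma pred_Ball_countable:
  assumes "countable X" "\<And>x. x \<in> X \<Longrightarrow> Measurable.pred M (\<lambda>\<omega>. R x \<omega>)"
  shows "Measurable.pred M (\<lambda>\<omega>. \<forall>x\<in>X. R x \<omega>)"
proof -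
  have "Measurable.pred M (\<lambda>\<omega>. \<not> (\<exists>x\<in>X. \<not> R x \<omega>))"
    using assms by (intro pred_intros_logic pred_Bex_countable) auto
  then show ?thesis by simp
qed

locale loop_soup = rooted_tree E d r for E :: "'v rel" and d and r +
  fixes \<kappa> \<alpha> \<beta> :: real
  assumes d3: "3 \<le> d" and kc: "kappa_c d \<le> \<kappa>" and alpha: "0 \<le> \<alpha>" and beta: "0 \<le> \<beta>"
begin

subsection \<open>The mass of a loop\<close>

definition s :: real where "s = 1 / ((1 + \<kappa>) * d)"

text \<open>The condition \<open>kappa_c d \<le> \<kappa>\<close> in terms of the step weight:
  \<open>s\<close> is at most the inverse spectral radius of the adjacency operator of the d-regular
  tree.\<close>

lemma s_props: "0 < s" "s \<le> 1 / (2 * sqrt (real d - 1))"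
proof -
  have q: "0 < sqrt (real d - 1)" and d: "0 < real d" using d3 by auto
  have le: "2 * sqrt (real d - 1) \<le> (1 + \<kappa>) * d" using kc d by (simp add: kappa_c_def field_simps)
  moreover have "0 < 2 * sqrt (real d - 1)" using q by simp
  ultimately have pos: "0 < (1 + \<kappa>) * d" by linarith
  then show "0 < s" by (simp add: s_def)
  show "s \<le> 1 / (2 * sqrt (real d - 1))" unfolding s_def using le q by (intro divide_left_mono) (auto simp: pos)
qed

definition mu :: "'v list set \<Rightarrow> real" where
  "mu l = measure (loop_measure E d \<kappa>) {l}"

lemma card_class_le: "xs \<in> based_loops E \<Longrightarrow> finite (cyclic_shift E `` {xs}) \<and> card (cyclic_shift E `` {xs}) \<le> length xs"
proof -
  assume xs: "xs \<in> based_loops E"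
  then have "0 < length xs" by (auto simp: based_loops_def)
  then have "rotate k xs = rotate (k mod length xs) xs \<and> k mod length xs < length xs" for k
    by (simp flip: rotate_conv_mod)
  then have sub: "cyclic_shift E `` {xs} \<subseteq> (\<lambda>k. rotate k xs) ` {..<length xs}"
    unfolding class_eq[OF xs] by blast
  then show ?thesis
    using card_mono[OF _ sub] card_image_le[of "{..<length xs}" "\<lambda>k. rotate k xs"]
    by (auto intro: finite_subset)
qed

text \<open>Each of the distinct rotations carries the based mass \<open>s ^ n / n\<close>. A
  periodic loop has fewer than \<open>n\<close> of them, whence the factor
  \<open>card / length\<close>.\<close>

lemma mu_class:
  assumes xs: "xs \<in> based_loops E"
  shows "emeasure (loop_measure E d \<kappa>) {cyclic_shift E `` {xs}} = ennreal (mu (cyclic_shift E `` {xs}))"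
    and "mu (cyclic_shift E `` {xs}) = card (cyclic_shift E `` {xs}) / length xs * s ^ length xs"
proof -
  let ?l = "cyclic_shift E `` {xs}" and ?c = "\<lambda>xs. cyclic_shift E `` {xs}"
  have l: "?l \<in> loops E" using xs by (auto simp: loops_repr)
  have c: "?c \<in> based_loop_measure E d \<kappa> \<rightarrow>\<^sub>M count_space (loops E)"
    by (auto simp: based_loop_measure_def measurable_def space_point_measure sets_point_measure
        loops_def intro!: quotientI)
  have self: "ys \<in> ?c ys" if "ys \<in> based_loops E" for ys
    using that by (auto simp: cyclic_shift_def intro: exI[of _ 0])
  have pre: "?c -` {?l} \<inter> based_loops E = ?l"
    using self class_memD[OF l] by auto
  have w: "(1 / (1 + \<kappa>)) ^ n * (1 / real d) ^ n = s ^ n" for n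
    by (simp add: s_def power_mult_distrib power_divide)
  from pre have "emeasure (loop_measure E d \<kappa>) {?l} = emeasure (based_loop_measure E d \<kappa>) ?l"
    unfolding loop_measure_def using l c
    by (subst emeasure_distr) (auto simp: based_loop_measure_def space_point_measure)
  also have "\<dots> = (\<Sum>ys\<in>?l. ennreal (1 / real (length ys) * (1 / (1 + \<kappa>)) ^ length ys * (1 / real d) ^ length ys))"
    unfolding based_loop_measure_def using class_memD(1)[OF l] card_class_le[OF xs]
    by (subst emeasure_point_measure_finite2) auto
  also have "\<dots> = (\<Sum>ys\<in>?l. ennreal (1 / real (length xs) * s ^ length xs))"
    using xs by (intro sum.cong refl) (auto simp: class_eq w mult.assoc)
  also have "\<dots> = ennreal (card ?l / length xs * s ^ length xs)"
    using s_props by (simp add: ennreal_of_nat_eq_real_of_nat flip: ennreal_mult)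
  finally have *: "emeasure (loop_measure E d \<kappa>) {?l} = ennreal (card ?l / length xs * s ^ length xs)" .
  then show "mu ?l = card ?l / length xs * s ^ length xs"
    unfolding mu_def using s_props by (simp add: measure_def)
  with * show "emeasure (loop_measure E d \<kappa>) {?l} = ennreal (mu ?l)" by simp
qed

lemma mu_nonneg [simp]: "0 \<le> mu l" by (simp add: mu_def)

lemma mu_le: "xs \<in> based_loops E \<Longrightarrow> mu (cyclic_shift E `` {xs}) \<le> s ^ length xs"
proof -
  assume xs: "xs \<in> based_loops E"
  then have "real (card (cyclic_shift E `` {xs})) / length xs \<le> 1"
    using card_class_le[OF xs] by (auto simp: based_loops_def divide_le_eq)
  from mult_right_mono[OF this, of "s ^ length xs"] show ?thesis
    unfolding mu_class(2)[OF xs] using s_props by simp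
qed

text \<open>The unique position of \<open>c\<close> distinguishes all rotations, so the symmetry
  factor equals 1.\<close>

lemma mu_excursion:
  assumes xs: "c # xs \<in> based_loops E" and c: "c \<notin> set xs"
  shows "mu (cyclic_shift E `` {c # xs}) = s ^ length (c # xs)"
proof -
  let ?n = "length (c # xs)"
  have inj: "inj_on (\<lambda>k. rotate k (c # xs)) {..<?n}"
  proof (rule inj_onI)
    fix j k assume jk: "j \<in> {..<?n}" "k \<in> {..<?n}" "rotate j (c # xs) = rotate k (c # xs)"
    have first: "i = 0" if "(c # xs) ! i = c" "i < ?n" for i
      using that c by (cases i) auto
    \<comment> \<open>The position of \<open>c\<close> after rotation by \<open>k\<close>; equality
      of the two rotations puts \<open>c\<close> at the same position after rotation by
      \<open>j\<close>.\<close>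
    define i where "i = (?n - k) mod ?n"
    have i: "i < ?n" by (simp add: i_def del: length_Cons)
    have "(k + i) mod ?n = 0" using jk by (simp add: i_def mod_simps del: length_Cons)
    then have "rotate k (c # xs) ! i = c" using i by (simp add: nth_rotate del: length_Cons)
    then have "(c # xs) ! ((j + i) mod ?n) = c" using nth_rotate[OF i, of j] jk(3) by (simp only:)
    then have "(j + i) mod ?n = 0" by (rule first) simp
    then have "?n dvd j + i" "?n dvd k + i" using \<open>(k + i) mod ?n = 0\<close> by (simp_all only: dvd_eq_mod_eq_0)
    then have "?n dvd (j + i) - (k + i)" "?n dvd (k + i) - (j + i)" by (simp_all only: dvd_diff_nat)
    then have "?n dvd j - k" "?n dvd k - j" by simp_all
    then show "j = k" using jk(1,2) by (auto dest!: dvd_imp_le simp del: length_Cons)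
  qed
  have "cyclic_shift E `` {c # xs} = (\<lambda>k. rotate k (c # xs)) ` {..<?n}"
  proof -
    have "rotate k (c # xs) = rotate (k mod ?n) (c # xs)" "k mod ?n < ?n" for k
      by (rule rotate_conv_mod) simp
    then show ?thesis unfolding class_eq[OF xs] by blast
  qed
  then have "card (cyclic_shift E `` {c # xs}) = ?n" using card_image[OF inj] by simp
  then show ?thesis by (simp only: mu_class(2)[OF xs]) simp
qed

text \<open>The back-and-forth loop on one edge. Its mass does not depend on the edge, so it gives a
  covering probability for the extra soup that is uniform over edges.\<close>

definition edge_loop :: "'v \<Rightarrow> 'v list set" where
  "edge_loop w = cyclic_shift E `` {[w, par w]}"

lemma edge_loop:
  assumes "w \<noteq> r"
  shows "edge_loop w \<in> loops E" "loop_vertices (edge_loop w) = {w, par w}" "mu (edge_loop w) = s\<^sup>2"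
proof -
  have ne: "w \<noteq> par w" using depth_par[OF assms] by auto
  have b: "[w, par w] \<in> based_loops E" using par_edge[OF assms] E_sym by (auto simp: based_loops_def)
  show "edge_loop w \<in> loops E" using b by (auto simp: edge_loop_def loops_repr)
  show "loop_vertices (edge_loop w) = {w, par w}" using loop_vertices_class[OF b] by (simp add: edge_loop_def)
  show "mu (edge_loop w) = s\<^sup>2" using mu_excursion[OF b] ne by (simp add: edge_loop_def power2_eq_square)
qed

lemma mu_liso:
  assumes u: "u \<noteq> r" "u' \<noteq> r" and l: "l \<in> LT u"
  shows "mu (liso u u' l) = mu l"
proof -
  obtain xs where xs: "xs \<in> based_loops E" "l = cyclic_shift E `` {xs}" using l by (auto simp: loops_repr)
  have sub: "set xs \<subseteq> {v. desc u v}" using l xs loop_vertices_class by auto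
  note c = liso_class[OF u xs(1) sub]
  have "card (cyclic_shift E `` {map (iso u u') xs}) = card (cyclic_shift E `` {xs})"
    using card_liso[OF u l] c(2) xs(2) by simp
  then show ?thesis
    unfolding xs(2) c(2) mu_class(2)[OF c(1)] mu_class(2)[OF xs(1)] by simp
qed

subsection \<open>Coupled loop soups\<close>

text \<open>The label tells two independent soups apart: \<open>False\<close> has intensity
  \<alpha>, \<open>True\<close> the extra intensity \<beta>. A set \<open>B\<close> of labels
  selects the base soup, \<open>{False}\<close>, or the union of both, \<open>UNIV\<close>.\<close>

definition idx :: "('v list set \<times> bool) set" where "idx = loops E \<times> UNIV"

definition rate :: "'v list set \<times> bool \<Rightarrow> real" where
  "rate x = (if snd x then \<beta> else \<alpha>) * mu (fst x)"

lemma rate_nonneg [simp]: "0 \<le> rate x" using alpha beta by (auto simp: rate_def)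

definition nu :: "('v list set \<times> bool) measure" where
  "nu = point_measure idx (\<lambda>x. ennreal (rate x))"

definition N :: "('v list set \<times> bool \<Rightarrow> nat) measure" where
  "N = poisson_process_law nu"

lemma nu_props: "countable (space nu)" "sets nu = Pow (space nu)" "x \<in> space nu \<Longrightarrow> emeasure nu {x} \<noteq> \<infinity>"
  using countable_loops[of UNIV]
  by (auto simp: nu_def space_point_measure sets_point_measure emeasure_point_measure_finite2 idx_def
      intro!: countable_SIGMA)

lemma space_nu [simp]: "space nu = idx" by (simp add: nu_def space_point_measure)

lemma measure_nu: "finite A \<Longrightarrow> A \<subseteq> idx \<Longrightarrow> measure nu A = (\<Sum>x\<in>A. rate x)"
  by (simp add: measure_def nu_def emeasure_point_measure_finite2 sum_nonneg)

abbreviation "P x \<equiv> measure_pmf (poisson_law (rate x))"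

lemma N_eq: "N = PiM idx P"
  unfolding N_def poisson_process_law_def space_nu by (intro PiM_cong) (simp_all add: measure_nu)

sublocale N: prob_space N
  unfolding N_def by (rule prob_space_poisson_process_law) (use nu_props in auto)

lemma N_coord [measurable]: "x \<in> idx \<Longrightarrow> (\<lambda>\<omega>. \<omega> x) \<in> N \<rightarrow>\<^sub>M count_space UNIV"
  unfolding N_def by (rule coord_meas) (use nu_props in auto)

lemma N_indep: "N.indep_vars (\<lambda>x. count_space UNIV) (\<lambda>x \<omega>. \<omega> x) idx"
  using indep_coord[of nu] nu_props by (simp add: N_def)

lemma prob_count:
  assumes "finite A" "A \<subseteq> idx"
  shows "N.prob {\<omega>\<in>space N. (\<Sum>x\<in>A. \<omega> x) = k} = pmf (poisson_law (\<Sum>x\<in>A. rate x)) k"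
proof -
  have "N.prob {\<omega>\<in>space N. point_count A \<omega> = of_nat k} = pmf (poisson_law (measure nu A)) k"
    unfolding N_def using assms by (intro point_count_finite) (use nu_props in auto)
  moreover have "point_count A \<omega> = of_nat k \<longleftrightarrow> (\<Sum>x\<in>A. \<omega> x) = k" for \<omega>
    using assms by (simp add: nn_integral_count_space_finite flip: of_nat_sum)
  ultimately show ?thesis using assms by (simp add: measure_nu)
qed

lemma prob_none:
  assumes "finite A" "A \<subseteq> idx"
  shows "N.prob {\<omega>\<in>space N. \<forall>x\<in>A. \<omega> x = 0} = exp (- (\<Sum>x\<in>A. rate x))"
  using prob_count[OF assms, of 0] assms by (simp add: pmf_poisson_law sum_nonneg)

text \<open>The sub-sigma-algebra generated by the counts in \<open>J\<close>, on the full space of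
  configurations. Independence of two events is thereby reduced to measurability with respect to
  disjoint index sets.\<close>

definition G :: "('v list set \<times> bool) set \<Rightarrow> ('v list set \<times> bool \<Rightarrow> nat) measure" where
  "G J = vimage_algebra (space N) (\<lambda>\<omega>. restrict \<omega> J) (PiM J (\<lambda>x. count_space UNIV))"

lemma space_G [simp]: "space (G J) = space N" by (simp add: G_def)

lemma G_coord:
  assumes "x \<in> J" shows "(\<lambda>\<omega>. \<omega> x) \<in> G J \<rightarrow>\<^sub>M count_space UNIV"
proof -
  have "(\<lambda>\<omega>. restrict \<omega> J) \<in> G J \<rightarrow>\<^sub>M PiM J (\<lambda>x. count_space (UNIV :: nat set))"
    unfolding G_def by (rule measurable_vimage_algebra1) (auto simp: space_PiM)
  from measurable_compose[OF this measurable_component_singleton[OF assms]]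
  show ?thesis using assms by simp
qed

lemma sets_GD:
  assumes "A \<in> sets (G J)"
  obtains B where "B \<in> sets (PiM J (\<lambda>x. count_space UNIV))" "A = (\<lambda>\<omega>. restrict \<omega> J) -` B \<inter> space N"
proof -
  have "sets (G J) = {(\<lambda>\<omega>. restrict \<omega> J) -` B \<inter> space N | B. B \<in> sets (PiM J (\<lambda>x. count_space UNIV))}"
    unfolding G_def by (rule sets_vimage_algebra2) (auto simp: space_PiM)
  then show thesis using assms that by auto
qed

lemma G_sets_N: assumes "J \<subseteq> idx" shows "sets (G J) \<subseteq> sets N"
proof
  fix A assume "A \<in> sets (G J)"
  then obtain B where B: "B \<in> sets (PiM J (\<lambda>x. count_space UNIV))" "A = (\<lambda>\<omega>. restrict \<omega> J) -` B \<inter> space N"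
    by (rule sets_GD)
  have "(\<lambda>\<omega>. restrict \<omega> J) \<in> N \<rightarrow>\<^sub>M PiM J (\<lambda>x. count_space UNIV)"
    using assms by (intro measurable_restrict N_coord) auto
  then show "A \<in> sets N" using B by (auto intro: measurable_sets)
qed

lemma indep_G:
  assumes J: "J \<subseteq> idx" "J' \<subseteq> idx" "J \<inter> J' = {}" and A: "A \<in> sets (G J)" "A' \<in> sets (G J')"
  shows "N.prob (A \<inter> A') = N.prob A * N.prob A'"
proof -
  obtain B where B: "B \<in> sets (PiM J (\<lambda>x. count_space UNIV))" "A = (\<lambda>\<omega>. restrict \<omega> J) -` B \<inter> space N"
    using A(1) by (rule sets_GD)
  obtain B' where B': "B' \<in> sets (PiM J' (\<lambda>x. count_space UNIV))" "A' = (\<lambda>\<omega>. restrict \<omega> J') -` B' \<inter> space N"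
    using A(2) by (rule sets_GD)
  have "N.indep_var (PiM J (\<lambda>x. count_space UNIV)) (\<lambda>\<omega>. restrict \<omega> J) (PiM J' (\<lambda>x. count_space UNIV)) (\<lambda>\<omega>. restrict \<omega> J')"
    using N.indep_var_restrict[OF N_indep J(3,1,2)] by simp
  from N.indep_varD[OF this B(1) B'(1)] show ?thesis
    unfolding B(2) B'(2) by (simp add: vimage_def Int_def conj_commute conj_left_commute)
qed

definition OB :: "bool set \<Rightarrow> ('v list set \<times> bool \<Rightarrow> nat) \<Rightarrow> 'v list set set" where
  "OB B \<omega> = {l \<in> loops E. \<exists>b\<in>B. 1 \<le> \<omega> (l, b)}"

lemma OB_loops: "OB B \<omega> \<subseteq> loops E" by (auto simp: OB_def)

lemma OB_mono: "B \<subseteq> B' \<Longrightarrow> OB B \<omega> \<subseteq> OB B' \<omega>" by (auto simp: OB_def)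

lemma OB_meas: "(\<And>b. b \<in> B \<Longrightarrow> (\<lambda>\<omega>. \<omega> (l, b)) \<in> M \<rightarrow>\<^sub>M count_space UNIV) \<Longrightarrow> Measurable.pred M (\<lambda>\<omega>. l \<in> OB B \<omega>)"
proof -
  assume *: "\<And>b. b \<in> B \<Longrightarrow> (\<lambda>\<omega>. \<omega> (l, b)) \<in> M \<rightarrow>\<^sub>M count_space UNIV"
  have "Measurable.pred M (\<lambda>\<omega>. l \<in> loops E \<and> (\<exists>b\<in>B. 1 \<le> \<omega> (l, b)))"
  proof (intro pred_intros_logic pred_Bex_countable)
    show "countable B" by (rule countable_finite) (rule finite)
    fix b assume "b \<in> B"
    from measurable_compose[OF *[OF this], of "\<lambda>n. 1 \<le> n" "count_space UNIV"]
    show "Measurable.pred M (\<lambda>\<omega>. 1 \<le> \<omega> (l, b))" by simp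
  qed auto
  then show ?thesis by (simp add: OB_def)
qed

text \<open>Only loops below \<open>u\<close> that cover an edge of the path matter. The premise
  asks for no others, so that the measure space can later be a small \<open>G J\<close>.\<close>

lemma reach_meas:
  assumes "\<And>l i. l \<in> LT u \<Longrightarrow> depth u < i \<Longrightarrow> i \<le> depth v \<Longrightarrow> anc v i \<in> loop_vertices l \<Longrightarrow>
      par (anc v i) \<in> loop_vertices l \<Longrightarrow> Measurable.pred M (\<lambda>\<omega>. l \<in> Q \<omega>)"
    and Q: "\<And>\<omega>. Q \<omega> \<subseteq> loops E"
  shows "Measurable.pred M (\<lambda>\<omega>. reach (Q \<omega>) u v)"
proof -
  have cov: "cov (Q \<omega>) u x \<longleftrightarrow> (\<exists>l\<in>{l. l \<in> LT u \<and> x \<in> loop_vertices l \<and> par x \<in> loop_vertices l}. l \<in> Q \<omega>)" for \<omega> x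
    using Q[of \<omega>] unfolding cov_def by blast
  have eq: "reach (Q \<omega>) u v \<longleftrightarrow> desc u v \<and> (\<forall>i\<in>{depth u<..depth v}.
    \<exists>l\<in>{l. l \<in> LT u \<and> anc v i \<in> loop_vertices l \<and> par (anc v i) \<in> loop_vertices l}. l \<in> Q \<omega>)" for \<omega>
    unfolding reach_def cov by (simp only: Ball_def greaterThanAtMost_iff)
  show ?thesis unfolding eq
  proof (intro pred_intros_logic pred_Ball_countable pred_Bex_countable)
    show "countable {depth u<..depth v}" by simp
    fix i
    show "countable {l. l \<in> LT u \<and> anc v i \<in> loop_vertices l \<and> par (anc v i) \<in> loop_vertices l}"
      by (rule countable_subset[OF _ countable_loops[of UNIV]]) auto
  qed (auto intro: assms(1))
qed

lemma reach_N [measurable]: "Measurable.pred N (\<lambda>\<omega>. reach (OB B \<omega>) u v)"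
  by (rule reach_meas[OF _ OB_loops], rule OB_meas, rule N_coord) (auto simp: idx_def)

definition p :: "bool set \<Rightarrow> 'v \<Rightarrow> 'v \<Rightarrow> real" where
  "p B u v = N.prob {\<omega>\<in>space N. reach (OB B \<omega>) u v}"

lemma reach_cong:
  assumes "Q \<subseteq> loops E" "Q' \<subseteq> loops E" "\<And>l. l \<in> LT u \<Longrightarrow> l \<in> Q \<longleftrightarrow> l \<in> Q'"
  shows "reach Q u v \<longleftrightarrow> reach Q' u v"
proof -
  have "cov Q u x \<longleftrightarrow> cov Q' u x" for x unfolding cov_def using assms by blast
  then show ?thesis by (simp add: reach_def)
qed

text \<open>Translation invariance: the soups inside two subtrees differ by a relabelling of the loops.\<close>

lemma reach_homogeneous:
  assumes u: "u \<noteq> r" "u' \<noteq> r" and V: "V \<subseteq> {v. desc u v}"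
  shows "N.prob {\<omega>\<in>space N. \<exists>v\<in>V. reach (OB B \<omega>) u v} =
         N.prob {\<omega>\<in>space N. \<exists>v\<in>iso u u' ` V. reach (OB B \<omega>) u' v}"
proof -
  define K where "K = LT u \<times> (UNIV :: bool set)"
  define f where "f x = (liso u u' (fst x), snd x)" for x :: "'v list set \<times> bool"
  have K: "K \<subseteq> idx" by (auto simp: K_def idx_def)
  have fK: "f \<in> K \<rightarrow> idx" using liso_props(1)[OF u] by (auto simp: f_def K_def idx_def)
  have "inj_on (liso u u') (LT u)" using liso_bij[OF u] by (simp add: bij_betw_def)
  then have inj: "inj_on f K" by (auto simp: f_def K_def inj_on_def)
  have P: "P (f x) = P x" if "x \<in> K" for x
    using that mu_liso[OF u] by (auto simp: f_def K_def rate_def)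
  have 1: "distr N (PiM K P) (\<lambda>\<omega>. \<lambda>x\<in>K. \<omega> x) = PiM K P"
    unfolding N_eq using distr_PiM_reindex[of idx P "\<lambda>x. x" K] K prob_space_measure_pmf by auto
  \<comment> \<open>By \<open>mu_liso\<close> a loop and its translate have equal rates, so reading
    off the translated counts yields the same product law as plain restriction.\<close>
  have 2: "distr N (PiM K P) (\<lambda>\<omega>. \<lambda>x\<in>K. \<omega> (f x)) = PiM K P"
  proof -
    have "PiM K (\<lambda>x. P (f x)) = PiM K P" by (intro PiM_cong refl P)
    with distr_PiM_reindex[OF prob_space_measure_pmf inj fK, of "\<lambda>x. poisson_law (rate x)"]
    show ?thesis unfolding N_eq by (simp only:)
  qed
  let ?A = "{\<eta>\<in>space (PiM K P). \<exists>v\<in>V. reach (OB B \<eta>) u v}"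
  have cK: "(\<lambda>\<eta>. \<eta> x) \<in> PiM K P \<rightarrow>\<^sub>M count_space UNIV" if "x \<in> K" for x
    using measurable_component_singleton[OF that, of P] by (simp cong: measurable_cong_sets)
  have "Measurable.pred (PiM K P) (\<lambda>\<eta>. reach (OB B \<eta>) u v)" for v
    by (rule reach_meas[OF _ OB_loops], rule OB_meas, rule cK) (auto simp: K_def)
  then have A: "?A \<in> sets (PiM K P)"
    unfolding pred_def[symmetric] by (intro pred_Bex_countable countable_V)
  have m: "(\<lambda>\<omega>. \<lambda>x\<in>K. \<omega> (g x)) \<in> N \<rightarrow>\<^sub>M PiM K P" if "g \<in> K \<rightarrow> idx" for g
  proof (rule measurable_restrict)
    fix x assume "x \<in> K"
    then have "g x \<in> idx" using that by auto
    from N_coord[OF this] show "(\<lambda>\<omega>. \<omega> (g x)) \<in> N \<rightarrow>\<^sub>M P x" by (simp cong: measurable_cong_sets)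
  qed
  have "N.prob {\<omega>\<in>space N. \<exists>v\<in>V. reach (OB B \<omega>) u v} = N.prob ((\<lambda>\<omega>. \<lambda>x\<in>K. \<omega> x) -` ?A \<inter> space N)"
  proof -
    have "reach (OB B (\<lambda>x\<in>K. \<omega> x)) u v \<longleftrightarrow> reach (OB B \<omega>) u v" for \<omega> v
      by (rule reach_cong[OF OB_loops OB_loops]) (auto simp: OB_def K_def)
    then show ?thesis by (intro arg_cong[where f = N.prob]) (auto simp: space_PiM)
  qed
  also have "\<dots> = measure (PiM K P) ?A"
    using measure_distr[OF m A, of "\<lambda>x. x"] K 1 by (auto simp: subset_eq)
  also have "\<dots> = N.prob ((\<lambda>\<omega>. \<lambda>x\<in>K. \<omega> (f x)) -` ?A \<inter> space N)"
    using measure_distr[OF m[OF fK] A] 2 by simp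
  also have "\<dots> = N.prob {\<omega>\<in>space N. \<exists>v\<in>iso u u' ` V. reach (OB B \<omega>) u' v}"
  proof -
    have "reach (OB B (\<lambda>x\<in>K. \<omega> (f x))) u v \<longleftrightarrow> reach (OB B \<omega>) u' (iso u u' v)" if "v \<in> V" for \<omega> v
    proof (rule reach_iso[OF u _ OB_loops OB_loops, symmetric])
      show "desc u v" using that V by auto
      fix l assume l: "l \<in> LT u"
      show "l \<in> OB B (\<lambda>x\<in>K. \<omega> (f x)) \<longleftrightarrow> liso u u' l \<in> OB B \<omega>"
        using l liso_props(1)[OF u l] by (auto simp: OB_def K_def f_def)
    qed
    then show ?thesis by (intro arg_cong[where f = N.prob]) (auto simp: space_PiM)
  qed
  finally show ?thesis .
qed

lemma p_homogeneous: "u \<noteq> r \<Longrightarrow> u' \<noteq> r \<Longrightarrow> desc u v \<Longrightarrow> p B u v = p B u' (iso u u' v)"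
  using reach_homogeneous[of u u' "{v}" B] by (simp add: p_def)

section \<open>Superposition, and transfer to the loop soup law\<close>

definition rt :: "bool set \<Rightarrow> real" where "rt B = (\<Sum>b\<in>B. if b then \<beta> else \<alpha>)"

definition Xs :: "bool set \<Rightarrow> ('v list set \<times> bool \<Rightarrow> nat) \<Rightarrow> 'v list set \<Rightarrow> nat" where
  "Xs B \<omega> = (\<lambda>l\<in>loops E. \<Sum>b\<in>B. \<omega> (l, b))"

lemma rt_nonneg: "0 \<le> rt B" using alpha beta by (auto simp: rt_def intro: sum_nonneg)

lemma open_loops_Xs: "open_loops E (Xs B \<omega>) = OB B \<omega>"
  by (auto simp: open_loops_def Xs_def OB_def Suc_le_eq sum_nonneg_eq_0_iff)
    (metis One_nat_def Suc_le_eq neq0_conv finite sum_eq_0_iff)+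

lemma soup_law: "loop_soup_law E d (rt B) \<kappa> = PiM (loops E) (\<lambda>l. measure_pmf (poisson_law (rt B * mu l)))"
proof -
  have "space (scale_measure (ennreal (rt B)) (loop_measure E d \<kappa>)) = loops E"
    by (simp add: loop_measure_def space_scale_measure)
  then show ?thesis using rt_nonneg[of B]
    by (simp add: loop_soup_law_def poisson_process_law_def mu_def)
qed

lemma Xs_meas: "Xs B \<in> N \<rightarrow>\<^sub>M loop_soup_law E d (rt B) \<kappa>"
proof -
  have "(\<lambda>\<omega>. \<Sum>b\<in>B. \<omega> (l, b)) \<in> N \<rightarrow>\<^sub>M count_space UNIV" if "l \<in> loops E" for l
    using that by (intro measurable_sum_nat) (auto intro!: N_coord simp: idx_def)
  then show ?thesis unfolding soup_law Xs_def
    by (intro measurable_restrict) (simp cong: measurable_cong_sets)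
qed

lemma loops_ne: "loops E \<noteq> {}"
proof -
  have "card (ch r) \<noteq> 0" using card_ch_root d3 by simp
  then obtain c where "c \<in> ch r" by fastforce
  then show ?thesis using edge_loop(1)[of c] by (auto simp: ch_def)
qed

text \<open>The blocks of labelled copies of distinct loops are disjoint, hence independent, and
  within a block the rates of independent Poisson counts add up.\<close>

lemma distr_Xs: "distr N (loop_soup_law E d (rt B) \<kappa>) (Xs B) = loop_soup_law E d (rt B) \<kappa>"
proof -
  let ?q = "\<lambda>l. measure_pmf (poisson_law (rt B * mu l))"
  let ?X = "\<lambda>l \<omega>. \<Sum>b\<in>B. (\<omega> (l, b) :: nat)"
  have Kidx: "Pair l ` B \<subseteq> idx" if "l \<in> loops E" for l using that by (auto simp: idx_def)
  have rv: "?X l \<in> N \<rightarrow>\<^sub>M ?q l" if "l \<in> loops E" for l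
  proof -
    have "?X l \<in> N \<rightarrow>\<^sub>M count_space UNIV"
      using that by (intro measurable_sum_nat) (auto intro!: N_coord simp: idx_def)
    then show ?thesis by (simp cong: measurable_cong_sets)
  qed
  have "N.indep_vars (\<lambda>l. PiM (Pair l ` B) (\<lambda>_. count_space UNIV)) (\<lambda>l \<omega>. restrict (\<lambda>x. \<omega> x) (Pair l ` B)) (loops E)"
    by (rule N.indep_vars_restrict[OF N_indep Kidx]) (auto simp: disjoint_family_on_def)
  then have "N.indep_vars ?q (\<lambda>l \<omega>. ?X l (restrict (\<lambda>x. \<omega> x) (Pair l ` B))) (loops E)"
  proof (rule N.indep_vars_compose2)
    fix l :: "'v list set"
    have "?X l \<in> PiM (Pair l ` B) (\<lambda>_. count_space UNIV) \<rightarrow>\<^sub>M count_space UNIV"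
      by (intro measurable_sum_nat measurable_component_singleton) auto
    then show "?X l \<in> PiM (Pair l ` B) (\<lambda>_. count_space UNIV) \<rightarrow>\<^sub>M ?q l" by (simp cong: measurable_cong_sets)
  qed
  then have ind: "N.indep_vars ?q ?X (loops E)" by simp
  have marg: "distr N (?q l) (?X l) = ?q l" if l: "l \<in> loops E" for l
  proof (rule measure_eqI_countable[of _ UNIV])
    fix k :: nat
    have "emeasure (distr N (?q l) (?X l)) {k} = emeasure N (?X l -` {k} \<inter> space N)"
      by (rule emeasure_distr[OF rv[OF l]]) simp
    also have "?X l -` {k} \<inter> space N = {\<omega>\<in>space N. (\<Sum>x\<in>Pair l ` B. \<omega> x) = k}"
      by (subst sum.reindex) (auto simp: inj_on_def)
    also have "emeasure N \<dots> = ennreal (pmf (poisson_law (\<Sum>x\<in>Pair l ` B. rate x)) k)"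
      using prob_count[OF _ Kidx[OF l], of k] by (simp add: N.emeasure_eq_measure)
    also have "(\<Sum>x\<in>Pair l ` B. rate x) = rt B * mu l"
      by (subst sum.reindex) (auto simp: inj_on_def rate_def rt_def sum_distrib_right)
    finally show "emeasure (distr N (?q l) (?X l)) {k} = emeasure (?q l) {k}"
      by (simp add: emeasure_pmf_single)
  qed auto
  have "distr N (PiM (loops E) ?q) (\<lambda>\<omega>. \<lambda>l\<in>loops E. ?X l \<omega>) = PiM (loops E) (\<lambda>l. distr N (?q l) (?X l))"
    by (rule iffD1[OF N.indep_vars_iff_distr_eq_PiM'[where X = ?X and M' = ?q, OF loops_ne rv] ind])
  also have "\<dots> = PiM (loops E) ?q" by (intro PiM_cong marg refl)
  finally show ?thesis unfolding soup_law Xs_def .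
qed

lemma soup_coord: "l \<in> loops E \<Longrightarrow> (\<lambda>\<omega>. \<omega> l) \<in> loop_soup_law E d (rt B) \<kappa> \<rightarrow>\<^sub>M count_space UNIV"
proof -
  assume l: "l \<in> loops E"
  have "(\<lambda>\<omega>. \<omega> l) \<in> loop_soup_law E d (rt B) \<kappa> \<rightarrow>\<^sub>M measure_pmf (poisson_law (rt B * mu l))"
    unfolding soup_law using l by (rule measurable_component_singleton)
  then show ?thesis by (simp cong: measurable_cong_sets)
qed

lemma reach_soup: "Measurable.pred (loop_soup_law E d (rt B) \<kappa>) (\<lambda>\<omega>. reach (open_loops E \<omega>) u v)"
proof (rule reach_meas)
  fix l assume l: "l \<in> LT u"
  have "Measurable.pred (loop_soup_law E d (rt B) \<kappa>) (\<lambda>\<omega>. 1 \<le> \<omega> l)"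
    using measurable_compose[OF soup_coord[of l B], of "\<lambda>n. 1 \<le> n" "count_space UNIV"] l by simp
  then show "Measurable.pred (loop_soup_law E d (rt B) \<kappa>) (\<lambda>\<omega>. l \<in> open_loops E \<omega>)"
    using l by (simp add: open_loops_def)
qed (auto simp: open_loops_def)

text \<open>Levels are finite, so a set is infinite exactly when its depth is unbounded. This makes
  the event expressible by countable quantifiers.\<close>

lemma infinite_vertices_iff: "infinite S \<longleftrightarrow> (\<forall>n. \<exists>v\<in>{v. n \<le> depth v}. v \<in> S)"
proof
  assume inf: "infinite S"
  show "\<forall>n. \<exists>v\<in>{v. n \<le> depth v}. v \<in> S"
  proof (rule ccontr)
    assume "\<not> ?thesis"
    then obtain n where "\<forall>v\<in>S. depth v < n" by (auto simp: not_le)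
    then have "S \<subseteq> (\<Union>k<n. Lv r k)" by (auto simp: Lv_def)
    from finite_subset[OF this] show False using inf by simp
  qed
next
  assume *: "\<forall>n. \<exists>v\<in>{v. n \<le> depth v}. v \<in> S"
  show "infinite S"
  proof
    assume "finite S"
    then have "\<forall>v\<in>S. depth v < Suc (Max (depth ` S))" by (auto simp: less_Suc_eq_le)
    moreover obtain v where "Suc (Max (depth ` S)) \<le> depth v" "v \<in> S" using * by blast
    ultimately show False by auto
  qed
qed

lemma infinite_meas:
  assumes "\<And>v. Measurable.pred M (\<lambda>\<omega>. reach (Q \<omega>) u v)"
  shows "{\<omega>\<in>space M. infinite {v. reach (Q \<omega>) u v}} \<in> sets M"
proof -
  have "Measurable.pred M (\<lambda>\<omega>. \<forall>n. \<exists>v\<in>{v. n \<le> depth v}. v \<in> {v. reach (Q \<omega>) u v})"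
    using assms by (intro pred_intros_countable pred_Bex_countable countable_V) simp
  then show ?thesis unfolding infinite_vertices_iff pred_def .
qed

lemma percolation_prob_eq:
  "percolation_prob E d r (rt B) \<kappa> = N.prob {\<omega>\<in>space N. infinite {v. reach (OB B \<omega>) r v}}"
proof -
  let ?L = "loop_soup_law E d (rt B) \<kappa>"
  have "percolation_prob E d r (rt B) \<kappa> = measure (distr N ?L (Xs B)) {\<omega>\<in>space ?L. infinite {v. reach (open_loops E \<omega>) r v}}"
    by (simp add: percolation_prob_def distr_Xs cluster_eq)
  also have "\<dots> = N.prob (Xs B -` {\<omega>\<in>space ?L. infinite {v. reach (open_loops E \<omega>) r v}} \<inter> space N)"
    by (rule measure_distr[OF Xs_meas infinite_meas[OF reach_soup]])
  also have "Xs B -` {\<omega>\<in>space ?L. infinite {v. reach (open_loops E \<omega>) r v}} \<inter> space N =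
      {\<omega>\<in>space N. infinite {v. reach (OB B \<omega>) r v}}"
    using measurable_space[OF Xs_meas] by (auto simp: open_loops_Xs)
  finally show ?thesis .
qed

lemma count_meas:
  assumes "\<And>v. Measurable.pred M (\<lambda>\<omega>. reach (Q \<omega>) u v)"
  shows "(\<lambda>\<omega>. emeasure (count_space UNIV) {v. reach (Q \<omega>) u v}) \<in> borel_measurable M"
proof -
  have "(\<lambda>\<omega>. \<integral>\<^sup>+v. indicator {v. reach (Q \<omega>) u v} v \<partial>count_space UNIV) \<in> borel_measurable M"
  proof (rule borel_measurable_nn_integral_count[OF countable_V])
    fix v
    have "(\<lambda>\<omega>. indicator {\<omega>\<in>space M. reach (Q \<omega>) u v} \<omega> :: ennreal) \<in> borel_measurable M"
      using assms[of v] by (intro borel_measurable_indicator) (simp add: pred_def)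
    then show "(\<lambda>\<omega>. indicator {v. reach (Q \<omega>) u v} v :: ennreal) \<in> borel_measurable M"
      by (rule measurable_cong[THEN iffD1, rotated]) (simp add: indicator_def)
  qed
  then show ?thesis by simp
qed

lemma mean_cluster_size_eq:
  "mean_cluster_size E d r (rt B) \<kappa> = (\<integral>\<^sup>+v. ennreal (p B r v) \<partial>count_space UNIV)"
proof -
  let ?L = "loop_soup_law E d (rt B) \<kappa>"
  interpret C: sigma_finite_measure "count_space (UNIV :: 'v set)"
    by (rule sigma_finite_measure_count_space_countable[OF countable_V])
  interpret NC: pair_sigma_finite N "count_space (UNIV :: 'v set)" ..
  have "mean_cluster_size E d r (rt B) \<kappa> =
      (\<integral>\<^sup>+\<omega>. emeasure (count_space UNIV) {v. reach (open_loops E \<omega>) r v} \<partial>distr N ?L (Xs B))"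
    by (simp add: mean_cluster_size_def distr_Xs cluster_eq)
  also have "\<dots> = (\<integral>\<^sup>+\<omega>. emeasure (count_space UNIV) {v. reach (OB B \<omega>) r v} \<partial>N)"
    by (subst nn_integral_distr[OF Xs_meas])
      (auto intro!: count_meas reach_soup simp: open_loops_Xs)
  also have "\<dots> = (\<integral>\<^sup>+\<omega>. \<integral>\<^sup>+v. indicator {v. reach (OB B \<omega>) r v} v \<partial>count_space UNIV \<partial>N)"
    by simp
  also have "\<dots> = (\<integral>\<^sup>+v. \<integral>\<^sup>+\<omega>. indicator {v. reach (OB B \<omega>) r v} v \<partial>N \<partial>count_space UNIV)"
  proof (rule NC.Fubini'[symmetric])
    have "(\<lambda>(v, \<omega>). indicator {v. reach (OB B \<omega>) r v} v :: ennreal) \<in> borel_measurable (count_space UNIV \<Otimes>\<^sub>M N)"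
    proof (rule measurable_pair_measure_countable1)
      show "countable (UNIV :: 'v set)" by (rule countable_V)
      fix v
      have "(\<lambda>\<omega>. indicator {\<omega>\<in>space N. reach (OB B \<omega>) r v} \<omega> :: ennreal) \<in> borel_measurable N"
        using reach_N[of B r v] by (intro borel_measurable_indicator) (simp add: pred_def)
      then show "(\<lambda>y. case (v, y) of (v, \<omega>) \<Rightarrow> (indicator {v. reach (OB B \<omega>) r v} v :: ennreal)) \<in> borel_measurable N"
        by (auto intro: measurable_cong[THEN iffD1, rotated] simp: indicator_def)
    qed
    then show "(\<lambda>(\<omega>, v). indicator {v. reach (OB B \<omega>) r v} v :: ennreal) \<in> borel_measurable (N \<Otimes>\<^sub>M count_space UNIV)"
      by (subst measurable_pair_swap_iff) (simp add: split_def)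
  qed
  also have "\<dots> = (\<integral>\<^sup>+v. ennreal (p B r v) \<partial>count_space UNIV)"
  proof (rule nn_integral_cong)
    fix v
    have "(\<integral>\<^sup>+\<omega>. indicator {v. reach (OB B \<omega>) r v} v \<partial>N) = (\<integral>\<^sup>+\<omega>. indicator {\<omega>\<in>space N. reach (OB B \<omega>) r v} \<omega> \<partial>N)"
      by (rule nn_integral_cong) (simp add: indicator_def)
    also have "\<dots> = emeasure N {\<omega>\<in>space N. reach (OB B \<omega>) r v}"
      using reach_N[of B r v] by (intro nn_integral_indicator) (simp add: pred_def)
    finally show "(\<integral>\<^sup>+\<omega>. indicator {v. reach (OB B \<omega>) r v} v \<partial>N) = ennreal (p B r v)"
      by (simp add: p_def N.emeasure_eq_measure)
  qed
  finally show ?thesis .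
qed

lemma p_nonneg [simp]: "0 \<le> p B u v" and p_le_1 [simp]: "p B u v \<le> 1"
  by (simp_all add: p_def)

lemma p_refl [simp]: "p B u u = 1"
  by (simp add: p_def N.prob_space)

lemma ev_N: "Measurable.pred N R \<Longrightarrow> {\<omega>\<in>space N. R \<omega>} \<in> sets N"
  by (simp add: pred_def)

lemma p_mono: "B \<subseteq> B' \<Longrightarrow> p B u v \<le> p B' u v"
  unfolding p_def using reach_mono[OF OB_mono]
  by (intro N.finite_measure_mono ev_N reach_N) blast

text \<open>A loop covering an edge above \<open>w\<close> leaves the subtree below \<open>w\<close>.\<close>

lemma reach_above_G:
  assumes "desc u w" "\<And>l b. l \<in> LT u \<Longrightarrow> \<not> loop_vertices l \<subseteq> {v. desc w v} \<Longrightarrow> b \<in> B \<Longrightarrow> (l, b) \<in> J"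
  shows "{\<omega>\<in>space N. reach (OB B \<omega>) u w} \<in> sets (G J)"
proof -
  have "Measurable.pred (G J) (\<lambda>\<omega>. reach (OB B \<omega>) u w)"
  proof (rule reach_meas[OF _ OB_loops], rule OB_meas, rule G_coord, rule assms(2))
    fix l i assume "depth u < i" "i \<le> depth w" "par (anc w i) \<in> loop_vertices l"
    moreover have "depth (par (anc w i)) < depth w"
      using calculation(1,2) par_anc[of "i - 1" w] depth_anc[of "i - 1" w] by simp
    ultimately show "\<not> loop_vertices l \<subseteq> {v. desc w v}" using desc_depth[of w "par (anc w i)"] by auto
  qed auto
  then show ?thesis by (simp add: pred_def)
qed

lemma reach_below_G: "(\<And>l b. l \<in> LT u \<Longrightarrow> b \<in> B \<Longrightarrow> (l, b) \<in> J) \<Longrightarrow> Measurable.pred (G J) (\<lambda>\<omega>. reach (OB B \<omega>) u w)"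
  by (rule reach_meas[OF _ OB_loops], rule OB_meas, rule G_coord) auto

text \<open>Complement of \<open>below w\<close> in \<open>idx\<close>. Arrival at \<open>w\<close>
  from an ancestor depends on this part only, the continuation below \<open>w\<close> on the
  other.\<close>

definition above :: "'v \<Rightarrow> ('v list set \<times> bool) set" where
  "above w = {l \<in> loops E. \<not> loop_vertices l \<subseteq> {v. desc w v}} \<times> UNIV"

definition below :: "'v \<Rightarrow> ('v list set \<times> bool) set" where
  "below w = LT w \<times> UNIV"

lemma above_below: "above w \<subseteq> idx" "below w \<subseteq> idx" "above w \<inter> below w = {}"
  by (auto simp: above_def below_def idx_def)

subsection \<open>Survival of a supercritical embedded branching process\<close>

text \<open>Inclusion-exclusion truncated after pairs. The square of the cardinality is a crude
  count of pairs that absorbs the loss \<open>card F * b\<close> of adding one more event.\<close>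

lemma bonferroni:
  assumes F: "finite F" "\<And>w. w \<in> F \<Longrightarrow> D w \<in> sets N" and b: "0 \<le> b"
    and pair: "\<And>w w'. w \<in> F \<Longrightarrow> w' \<in> F \<Longrightarrow> w \<noteq> w' \<Longrightarrow> N.prob (D w \<inter> D w') \<le> b"
  shows "(\<Sum>w\<in>F. N.prob (D w)) - (real (card F))\<^sup>2 * b \<le> N.prob (\<Union>w\<in>F. D w)"
  using F pair
proof (induction F rule: finite_induct)
  case (insert x F)
  let ?U = "\<Union>w\<in>F. D w"
  have U: "?U \<in> sets N" using insert by auto
  have "N.prob (D x \<inter> ?U) = N.prob (\<Union>w\<in>F. D x \<inter> D w)" by (rule arg_cong[where f = N.prob]) auto
  also have "\<dots> \<le> (\<Sum>w\<in>F. N.prob (D x \<inter> D w))"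
    using insert by (intro N.finite_measure_subadditive_finite) auto
  also have "\<dots> \<le> (\<Sum>w\<in>F. b)" using insert by (intro sum_mono) auto
  finally have *: "N.prob (D x \<inter> ?U) \<le> real (card F) * b" by simp
  have "N.prob (D x \<union> ?U) = N.prob (D x) + N.prob ?U - N.prob (D x \<inter> ?U)"
    using insert U by (intro measure_Un3) (auto simp: N.fmeasurable_eq_sets)
  moreover have "(\<Sum>w\<in>F. N.prob (D w)) - (real (card F))\<^sup>2 * b \<le> N.prob ?U" using insert by auto
  moreover have "(real (card F))\<^sup>2 * b + real (card F) * b \<le> (real (card (insert x F)))\<^sup>2 * b"
    using b insert by (auto simp: power2_eq_square algebra_simps)
  ultimately show ?case using * insert by simp
qed simp

definition M :: "bool set \<Rightarrow> 'v \<Rightarrow> nat \<Rightarrow> real" where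
  "M B u k = (\<Sum>v\<in>Lv u k. p B u v)"

lemma M_nonneg [simp]: "0 \<le> M B u k" by (simp add: M_def sum_nonneg)

lemma M_0 [simp]: "M B u 0 = 1" by (simp add: M_def)

lemma M_mono: "B \<subseteq> B' \<Longrightarrow> M B u k \<le> M B' u k" by (auto simp: M_def intro: sum_mono p_mono)

lemma M_homogeneous: "u \<noteq> r \<Longrightarrow> u' \<noteq> r \<Longrightarrow> M B u' k = M B u k"
proof -
  assume u: "u \<noteq> r" "u' \<noteq> r"
  have "M B u k = (\<Sum>v\<in>Lv u k. p B u' (iso u u' v))"
    unfolding M_def using p_homogeneous[OF u] by (intro sum.cong) (auto simp: Lv_def)
  also have "\<dots> = M B u' k" unfolding M_def by (rule sum.reindex_bij_betw[OF iso_Lv[OF u]])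
  finally show ?thesis by simp
qed

definition Z :: "bool set \<Rightarrow> 'v \<Rightarrow> nat \<Rightarrow> ('v list set \<times> bool \<Rightarrow> nat) set" where
  "Z B u n = {\<omega>\<in>space N. \<exists>v\<in>Lv u n. reach (OB B \<omega>) u v}"

lemma Z_G: "Z B u n \<in> sets (G (below u))"
proof -
  have "Measurable.pred (G (below u)) (\<lambda>\<omega>. \<exists>v\<in>Lv u n. reach (OB B \<omega>) u v)"
    by (intro pred_Bex_countable countable_V reach_below_G) (auto simp: below_def)
  then show ?thesis by (simp add: pred_def Z_def)
qed

lemma Z_sets [measurable]: "Z B u n \<in> sets N"
  using Z_G G_sets_N[OF above_below(2)] by blast

lemma Z_homogeneous:
  assumes "u \<noteq> r" "u' \<noteq> r"
  shows "N.prob (Z B u' n) = N.prob (Z B u n)"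
proof -
  have "Lv u n \<subseteq> {v. desc u v}" by (auto simp: Lv_def)
  moreover have "iso u u' ` Lv u n = Lv u' n" using iso_Lv[OF assms, of n] by (simp add: bij_betw_def)
  ultimately show ?thesis unfolding Z_def using reach_homogeneous[OF assms, of "Lv u n" B] by (simp only:)
qed

lemma reach_G_above: "desc u w \<Longrightarrow> {\<omega>\<in>space N. reach (OB B \<omega>) u w} \<in> sets (G (above w))"
  by (rule reach_above_G) (auto simp: above_def)

lemma loop_vertices_ne: "l \<in> loops E \<Longrightarrow> loop_vertices l \<noteq> {}"
  by (auto simp: loops_repr loop_vertices_class) (auto simp: based_loops_def loop_vertices_class)

text \<open>Condition on the vertices reached at level \<open>k\<close>: arrival at \<open>w\<close>
  and survival below \<open>w\<close> are independent. The first bound combines all \<open>w\<close>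
  by Bonferroni and is strong when survival is unlikely; the second follows a single
  \<open>w\<close> and serves when survival is likely.\<close>

lemma Z_step:
  assumes u: "u \<noteq> r"
  shows "M B u k * N.prob (Z B u n) - (real (card (Lv u k)))\<^sup>2 * (N.prob (Z B u n))\<^sup>2 \<le> N.prob (Z B u (k + n))"
    and "w \<in> Lv u k \<Longrightarrow> p B u w * N.prob (Z B u n) \<le> N.prob (Z B u (k + n))"
proof -
  define A where "A w = {\<omega>\<in>space N. reach (OB B \<omega>) u w}" for w
  define D where "D w = A w \<inter> Z B w n" for w
  have wr: "w \<noteq> r" "desc u w" if "w \<in> Lv u k" for w using that u desc_ne_root by (auto simp: Lv_def)
  have A: "A w \<in> sets N" for w unfolding A_def by (intro ev_N reach_N)
  have D: "D w \<in> sets N" for w using A by (auto simp: D_def)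
  have pD: "N.prob (D w) = p B u w * N.prob (Z B u n)" if w: "w \<in> Lv u k" for w
    unfolding D_def A_def p_def Z_homogeneous[OF u wr(1)[OF w], of B n, symmetric]
    by (rule indep_G[OF above_below reach_G_above[OF wr(2)[OF w]] Z_G])
  have pair: "N.prob (D w \<inter> D w') \<le> (N.prob (Z B u n))\<^sup>2" if w: "w \<in> Lv u k" "w' \<in> Lv u k" "w \<noteq> w'" for w w'
  proof -
    have "below w \<inter> below w' = {}"
    proof (rule ccontr)
      assume "\<not> ?thesis"
      then obtain l where l: "l \<in> loops E" "loop_vertices l \<subseteq> {v. desc w v}" "loop_vertices l \<subseteq> {v. desc w' v}"
        by (auto simp: below_def)
      then obtain x where "desc w x" "desc w' x" using loop_vertices_ne[OF l(1)] by blast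
      then show False using w by (auto simp: Lv_def desc_def)
    qed
    \<comment> \<open>The two arrivals may share loops and are dropped; the survival events live in
      disjoint subtrees.\<close>
    have "N.prob (D w \<inter> D w') \<le> N.prob (Z B w n \<inter> Z B w' n)"
      by (intro N.finite_measure_mono) (auto simp: D_def)
    also have "\<dots> = N.prob (Z B w n) * N.prob (Z B w' n)"
      by (rule indep_G[OF above_below(2) above_below(2) \<open>below w \<inter> below w' = {}\<close> Z_G Z_G])
    also have "\<dots> = (N.prob (Z B u n))\<^sup>2"
      using Z_homogeneous[OF u wr(1)] w by (simp add: power2_eq_square)
    finally show ?thesis .
  qed
  have sub: "D w \<subseteq> Z B u (k + n)" if "w \<in> Lv u k" for w
  proof
    fix \<omega> assume "\<omega> \<in> D w"
    then obtain v where v: "\<omega> \<in> space N" "reach (OB B \<omega>) u w" "v \<in> Lv w n" "reach (OB B \<omega>) w v"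
      by (auto simp: D_def A_def Z_def)
    then have "v \<in> Lv u (k + n)" using that by (auto simp: Lv_add)
    then show "\<omega> \<in> Z B u (k + n)" using v(1) reach_trans[OF v(2,4)] by (auto simp: Z_def)
  qed
  show "p B u w * N.prob (Z B u n) \<le> N.prob (Z B u (k + n))" if "w \<in> Lv u k"
    unfolding pD[OF that, symmetric] using sub[OF that] by (intro N.finite_measure_mono) auto
  have "(\<Sum>w\<in>Lv u k. N.prob (D w)) - (real (card (Lv u k)))\<^sup>2 * (N.prob (Z B u n))\<^sup>2 \<le> N.prob (\<Union>w\<in>Lv u k. D w)"
    using D pair by (intro bonferroni) auto
  also have "\<dots> \<le> N.prob (Z B u (k + n))" using sub by (intro N.finite_measure_mono) auto
  finally show "M B u k * N.prob (Z B u n) - (real (card (Lv u k)))\<^sup>2 * (N.prob (Z B u n))\<^sup>2 \<le> N.prob (Z B u (k + n))"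
    by (simp add: pD M_def sum_distrib_right)
qed

text \<open>The lower bound \<open>m * q - K\<^sup>2 * q\<^sup>2\<close> expands near 0 because
  \<open>m > 1\<close>, so the survival probabilities cannot sink below a fixed positive
  level.\<close>

lemma survival:
  assumes u: "u \<noteq> r" and M1: "1 < M B u k"
  shows "\<exists>\<delta>>0. \<forall>h. \<delta> \<le> N.prob (Z B u (h * k))"
proof -
  define m where "m = M B u k"
  define K where "K = real (card (Lv u k))"
  define q where "q h = N.prob (Z B u (h * k))" for h
  have mK: "m \<le> K" unfolding m_def M_def K_def using sum_mono[of "Lv u k" "p B u" "\<lambda>_. 1"] by simp
  then have K: "1 < K" "1 < m" using M1 by (auto simp: m_def)
  have "\<exists>w\<in>Lv u k. p B u w \<noteq> 0"
  proof (rule ccontr)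
    assume "\<not> ?thesis"
    then have "M B u k = 0" by (simp add: M_def)
    then show False using M1 by simp
  qed
  then obtain w where w: "w \<in> Lv u k" "p B u w \<noteq> 0" by blast
  then have w0: "0 < p B u w" by (simp add: less_le)
  \<comment> \<open>The first term is the one-vertex bound at \<open>q = 1 / K\<^sup>2\<close>, the
    second the value of the quadratic bound at both \<open>q = (m - 1) / K\<^sup>2\<close> and
    \<open>q = 1 / K\<^sup>2\<close>.\<close>
  define \<delta> where "\<delta> = min (p B u w / K\<^sup>2) ((m - 1) / K\<^sup>2)"
  have K2: "1 \<le> K\<^sup>2" "0 < K\<^sup>2" using K by (auto intro: one_le_power)
  have "\<delta> > 0" using w0 K K2 by (simp add: \<delta>_def)
  moreover have "\<delta> \<le> q h" for h
  proof (induction h)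
    case 0
    have "q 0 = 1" by (simp add: q_def Z_def N.prob_space)
    moreover have "p B u w / K\<^sup>2 \<le> 1" using K2 p_le_1[of B u w] by (simp add: divide_le_eq del: p_le_1)
    ultimately show ?case by (simp add: \<delta>_def min.coboundedI1)
  next
    case (Suc h)
    have q0: "0 \<le> q h" by (simp add: q_def)
    have 1: "m * q h - K\<^sup>2 * (q h)\<^sup>2 \<le> q (Suc h)" and 2: "p B u w * q h \<le> q (Suc h)"
      using Z_step[OF u, where B = B and k = k and n = "h * k"] w(1) unfolding q_def m_def K_def by auto
    show ?case
    proof (cases "1 / K\<^sup>2 \<le> q h")
      case True
      have "\<delta> \<le> p B u w * (1 / K\<^sup>2)" by (simp add: \<delta>_def)
      also have "\<dots> \<le> p B u w * q h" using True by (intro mult_left_mono) auto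
      finally show ?thesis using 2 by linarith
    next
      case False
      \<comment> \<open>Rescaled, the quadratic bound multiplies \<open>q h\<close> by
        \<open>m - t\<close>. For \<open>t \<le> m - 1\<close> nothing is lost; for t between m - 1
        and 1 concavity of \<open>t * (m - t)\<close> keeps it above its value m - 1 at both
        ends.\<close>
      define t where "t = K\<^sup>2 * q h"
      have t: "t < 1" "q h = t / K\<^sup>2" "0 \<le> t" using False K2 q0 by (auto simp: t_def field_simps)
      have eq: "m * q h - K\<^sup>2 * (q h)\<^sup>2 = q h * (m - t)" by (simp add: t_def power2_eq_square algebra_simps)
      show ?thesis
      proof (cases "t \<le> m - 1")
        case True
        then have "q h * 1 \<le> q h * (m - t)" using q0 by (intro mult_left_mono) auto
        then show ?thesis using 1 eq Suc by linarith
      next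
        case False
        have "0 \<le> (1 - t) * (t - (m - 1))" using t False by (intro mult_nonneg_nonneg) auto
        then have "m - 1 \<le> t * (m - t)" by (simp add: algebra_simps)
        then have "(m - 1) / K\<^sup>2 \<le> q h * (m - t)" using K2 t(2) by (simp add: field_simps)
        then show ?thesis using 1 eq by (simp add: \<delta>_def)
      qed
    qed
  qed
  ultimately show ?thesis unfolding q_def by blast
qed

lemma Z_antimono: "n \<le> n' \<Longrightarrow> Z B u n' \<subseteq> Z B u n"
proof
  fix \<omega> assume n: "n \<le> n'" and "\<omega> \<in> Z B u n'"
  then obtain v where v: "\<omega> \<in> space N" "desc u v" "depth v = depth u + n'" "reach (OB B \<omega>) u v"
    by (auto simp: Z_def Lv_def)
  let ?w = "anc v (depth u + n)"
  have "desc u ?w" "desc ?w v" "depth ?w = depth u + n"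
    using v n by (auto intro!: desc_ancD desc_anc depth_anc)
  then show "\<omega> \<in> Z B u n" using v reach_prefix[OF v(4), of ?w] by (auto simp: Z_def Lv_def)
qed

lemma infinite_positive:
  assumes u: "u \<noteq> r" and M1: "1 < M B u k"
  shows "0 < N.prob {\<omega>\<in>space N. infinite {v. reach (OB B \<omega>) u v}}"
proof -
  \<comment> \<open>\<open>M B u 0 = 1\<close>, so a mean above 1 cannot occur at level 0; hence the
    levels \<open>h * k\<close> are unbounded.\<close>
  have k: "0 < k" using M1 by (cases k) auto
  obtain \<delta> where \<delta>: "0 < \<delta>" "\<And>h. \<delta> \<le> N.prob (Z B u (h * k))" using survival[OF assms] by blast
  have "(\<lambda>h. N.prob (Z B u (h * k))) \<longlonglongrightarrow> N.prob (\<Inter>h. Z B u (h * k))"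
    by (rule N.finite_Lim_measure_decseq) (auto simp: decseq_def intro!: Z_antimono)
  then have "\<delta> \<le> N.prob (\<Inter>h. Z B u (h * k))" by (rule LIMSEQ_le_const) (use \<delta> in auto)
  also have "\<dots> \<le> N.prob {\<omega>\<in>space N. infinite {v. reach (OB B \<omega>) u v}}"
  proof (rule N.finite_measure_mono)
    show "(\<Inter>h. Z B u (h * k)) \<subseteq> {\<omega>\<in>space N. infinite {v. reach (OB B \<omega>) u v}}"
    proof
      fix \<omega> assume *: "\<omega> \<in> (\<Inter>h. Z B u (h * k))"
      have "\<exists>v\<in>{v. n \<le> depth v}. v \<in> {v. reach (OB B \<omega>) u v}" for n
      proof -
        have "\<omega> \<in> Z B u (n * k)" using * by blast
        then obtain v where "v \<in> Lv u (n * k)" "reach (OB B \<omega>) u v" by (auto simp: Z_def)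
        moreover have "n \<le> n * k" using k by simp
        then have "n \<le> depth u + n * k" by (rule trans_le_add2)
        ultimately show ?thesis by (intro bexI[of _ v]) (auto simp: Lv_def)
      qed
      moreover have "\<omega> \<in> space N" using * by (auto simp: Z_def)
      ultimately show "\<omega> \<in> {\<omega>\<in>space N. infinite {v. reach (OB B \<omega>) u v}}"
        by (simp add: infinite_vertices_iff)
    qed
  qed (rule infinite_meas, rule reach_N)
  finally show ?thesis using \<delta> by linarith
qed

text \<open>The probability that the extra soup contains a given \<open>edge_loop\<close>, whose
  rate there is \<open>\<beta> * s\<^sup>2\<close>.\<close>

definition \<epsilon> :: real where "\<epsilon> = 1 - exp (- (\<beta> * s\<^sup>2))"

lemma eps: "0 \<le> \<epsilon>" "0 < \<beta> \<Longrightarrow> 0 < \<epsilon>" using beta s_props by (auto simp: \<epsilon>_def)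

definition Y :: "'v \<Rightarrow> ('v list set \<times> bool \<Rightarrow> nat) set" where
  "Y w = {\<omega>\<in>space N. 1 \<le> \<omega> (edge_loop w, True)}"

lemma Y_G: "(edge_loop w, True) \<in> J \<Longrightarrow> Y w \<in> sets (G J)"
  using measurable_compose[OF G_coord[of "(edge_loop w, True)" J], of "\<lambda>n. 1 \<le> n" "count_space UNIV"]
  by (simp add: Y_def pred_def)

lemma prob_Y: assumes "w \<noteq> r" shows "N.prob (Y w) = \<epsilon>"
proof -
  let ?x = "(edge_loop w, True)"
  have x: "?x \<in> idx" using edge_loop(1)[OF assms] by (simp add: idx_def)
  have "Y w = space N - {\<omega>\<in>space N. \<forall>x\<in>{?x}. \<omega> x = 0}" by (auto simp: Y_def)
  also have "N.prob \<dots> = 1 - N.prob {\<omega>\<in>space N. \<forall>x\<in>{?x}. \<omega> x = 0}"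
  proof (rule N.prob_compl)
    have "Measurable.pred N (\<lambda>\<omega>. \<omega> ?x = 0)"
      using measurable_compose[OF N_coord[OF x], of "\<lambda>n. n = 0" "count_space UNIV"] by simp
    then show "{\<omega>\<in>space N. \<forall>x\<in>{?x}. \<omega> x = 0} \<in> N.events" by (simp add: pred_def)
  qed
  also have "\<dots> = \<epsilon>"
    using prob_none[of "{?x}"] x edge_loop(3)[OF assms] by (simp add: \<epsilon>_def rate_def)
  finally show ?thesis .
qed

lemma Y_reach: "\<omega> \<in> Y w \<Longrightarrow> w \<noteq> r \<Longrightarrow> desc u w \<Longrightarrow> w \<noteq> u \<Longrightarrow> cov (OB UNIV \<omega>) u w"
  unfolding cov_def using edge_loop[of w] desc_par_iff[of w u]
  by (intro bexI[of _ "edge_loop w"]) (auto simp: Y_def OB_def)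

lemma edge_loop_above: "w \<noteq> r \<Longrightarrow> (edge_loop w, b) \<in> above w"
  using edge_loop[of w] desc_par_self[of w] by (auto simp: above_def)

text \<open>By homogeneity the subtree of a child of the root survives with positive probability.
  Independently of it, the extra soup joins this child to the root by an edge loop.\<close>

lemma percolation_positive:
  assumes u: "u \<noteq> r" and M1: "1 < M UNIV u k" and beta0: "0 < \<beta>"
  shows "0 < percolation_prob E d r (rt UNIV) \<kappa>"
proof -
  have "card (ch r) \<noteq> 0" using card_ch_root d3 by simp
  then obtain c where c: "c \<in> ch r" by fastforce
  then have cr: "c \<noteq> r" "par c = r" by (auto simp: ch_def)
  have M1': "1 < M UNIV c k" using M1 M_homogeneous[OF u cr(1)] by simp
  let ?I = "{\<omega>\<in>space N. infinite {v. reach (OB UNIV \<omega>) c v}}"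
  have "0 < N.prob (Y c) * N.prob ?I"
    using infinite_positive[OF cr(1) M1'] prob_Y[OF cr(1)] eps(2)[OF beta0] by simp
  also have "\<dots> = N.prob (Y c \<inter> ?I)"
  proof (rule indep_G[OF above_below(1,2,3), symmetric])
    show "Y c \<in> sets (G (above c))" using edge_loop_above[OF cr(1)] by (rule Y_G)
    have "{\<omega>\<in>space (G (below c)). infinite {v. reach (OB UNIV \<omega>) c v}} \<in> sets (G (below c))"
      by (rule infinite_meas, rule reach_below_G) (auto simp: below_def)
    then show "?I \<in> sets (G (below c))" by simp
  qed
  also have "\<dots> \<le> N.prob {\<omega>\<in>space N. infinite {v. reach (OB UNIV \<omega>) r v}}"
  proof (rule N.finite_measure_mono)
    show "Y c \<inter> ?I \<subseteq> {\<omega>\<in>space N. infinite {v. reach (OB UNIV \<omega>) r v}}"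
    proof
      fix \<omega> assume *: "\<omega> \<in> Y c \<inter> ?I"
      have "cov (OB UNIV \<omega>) r c" using Y_reach[of \<omega> c r] * cr by auto
      then have "reach (OB UNIV \<omega>) r c" using reach_par_iff[of c r] cr by auto
      then have "{v. reach (OB UNIV \<omega>) c v} \<subseteq> {v. reach (OB UNIV \<omega>) r v}" using reach_trans by blast
      then show "\<omega> \<in> {\<omega>\<in>space N. infinite {v. reach (OB UNIV \<omega>) r v}}" using * by (auto dest: finite_subset)
    qed
  qed (rule infinite_meas, rule reach_N)
  finally show ?thesis by (simp add: percolation_prob_eq)
qed

subsection \<open>Sprinkling\<close>

text \<open>
  The first edge on the path from \<open>u\<close> to \<open>v\<close> that the soup of intensity \<open>\<alpha>\<close> leaves uncovered is
  covered by the independent extra soup with probability at least \<open>\<epsilon>\<close>.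
\<close>

definition first_gap :: "'v \<Rightarrow> 'v \<Rightarrow> ('v list set \<times> bool \<Rightarrow> nat) set" where
  "first_gap u w = {\<omega>\<in>space N. reach (OB {False} \<omega>) u (par w) \<and> \<not> reach (OB {False} \<omega>) u w}"

lemma prob_first_gap:
  assumes "w \<noteq> r" "desc u w" "w \<noteq> u"
  shows "N.prob (first_gap u w) = p {False} u (par w) - p {False} u w"
proof -
  have "first_gap u w = {\<omega>\<in>space N. reach (OB {False} \<omega>) u (par w)} - {\<omega>\<in>space N. reach (OB {False} \<omega>) u w}"
    by (auto simp: first_gap_def)
  also have "N.prob \<dots> = p {False} u (par w) - p {False} u w"
    unfolding p_def using assms reach_par_iff[of w u]
    by (intro N.finite_measure_Diff ev_N reach_N) auto
  finally show ?thesis .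
qed

text \<open>After the repaired gap the path may use both soups, so that the recursion closes on the
  means of the union.\<close>

definition sprinkled :: "'v \<Rightarrow> 'v \<Rightarrow> 'v \<Rightarrow> ('v list set \<times> bool \<Rightarrow> nat) set" where
  "sprinkled u w v = first_gap u w \<inter> (Y w \<inter> {\<omega>\<in>space N. reach (OB UNIV \<omega>) w v})"

lemma prob_sprinkled:
  assumes w: "w \<noteq> r" "desc u w" "w \<noteq> u"
  shows "sprinkled u w v \<in> sets N"
    and "N.prob (sprinkled u w v) = (p {False} u (par w) - p {False} u w) * (\<epsilon> * p UNIV w v)"
proof -
  let ?R = "{\<omega>\<in>space N. reach (OB UNIV \<omega>) w v}"
  \<comment> \<open>The gap concerns base loops that are not inside the subtree of \<open>w\<close>.
    The repair uses the \<open>True\<close> copy of the edge loop, the continuation both copies of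
    loops below \<open>w\<close>; these three index sets are pairwise disjoint.\<close>
  let ?J1 = "{l \<in> loops E. \<not> loop_vertices l \<subseteq> {v. desc w v}} \<times> {False}"
  let ?J2 = "{(edge_loop w, True)} \<union> below w"
  have J: "?J1 \<subseteq> idx" "?J2 \<subseteq> idx" "?J1 \<inter> ?J2 = {}"
    using edge_loop(1)[OF w(1)] above_below(2)[of w] by (auto simp: idx_def below_def)
  have dw: "desc u (par w)" using w desc_par_iff[of w u] by auto
  have 1: "first_gap u w \<in> sets (G ?J1)"
  proof -
    have "{\<omega>\<in>space N. reach (OB {False} \<omega>) u w} \<in> sets (G ?J1)"
      by (rule reach_above_G[OF w(2)]) auto
    moreover have "{\<omega>\<in>space N. reach (OB {False} \<omega>) u (par w)} \<in> sets (G ?J1)"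
      using desc_trans[OF desc_par[OF w(1)]] by (intro reach_above_G[OF dw]) auto
    ultimately have "{\<omega>\<in>space N. reach (OB {False} \<omega>) u (par w)} - {\<omega>\<in>space N. reach (OB {False} \<omega>) u w} \<in> sets (G ?J1)"
      by (intro sets.Diff)
    also have "{\<omega>\<in>space N. reach (OB {False} \<omega>) u (par w)} - {\<omega>\<in>space N. reach (OB {False} \<omega>) u w} = first_gap u w"
      by (auto simp: first_gap_def)
    finally show ?thesis .
  qed
  have R: "?R \<in> sets (G J)" if "below w \<subseteq> J" for J
  proof -
    have "Measurable.pred (G J) (\<lambda>\<omega>. reach (OB UNIV \<omega>) w v)"
      by (rule reach_below_G) (use that in \<open>auto simp: below_def\<close>)
    then show ?thesis by (simp add: pred_def)
  qed
  have 2: "Y w \<inter> ?R \<in> sets (G ?J2)" using R by (intro sets.Int Y_G) auto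
  show "sprinkled u w v \<in> sets N"
    unfolding sprinkled_def by (rule sets.Int[OF subsetD[OF G_sets_N[OF J(1)] 1] subsetD[OF G_sets_N[OF J(2)] 2]])
  have "N.prob (sprinkled u w v) = N.prob (first_gap u w) * N.prob (Y w \<inter> ?R)"
    unfolding sprinkled_def by (rule indep_G[OF J 1 2])
  also have "N.prob (Y w \<inter> ?R) = N.prob (Y w) * N.prob ?R"
    using edge_loop_above[OF w(1)] by (intro indep_G[OF above_below] Y_G R) auto
  finally show "N.prob (sprinkled u w v) = (p {False} u (par w) - p {False} u w) * (\<epsilon> * p UNIV w v)"
    using prob_first_gap[OF w] prob_Y[OF w(1)] by (simp add: p_def)
qed

lemma sprinkled_reach:
  assumes w: "w \<noteq> r" "desc u w" "w \<noteq> u"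
  shows "sprinkled u w v \<subseteq> {\<omega>\<in>space N. reach (OB UNIV \<omega>) u v}"
proof
  fix \<omega> assume *: "\<omega> \<in> sprinkled u w v"
  then have "reach (OB UNIV \<omega>) u (par w)"
    using reach_mono[OF OB_mono[of "{False}" UNIV \<omega>]] by (auto simp: sprinkled_def first_gap_def)
  moreover have "cov (OB UNIV \<omega>) u w" using * Y_reach w by (auto simp: sprinkled_def)
  ultimately have "reach (OB UNIV \<omega>) u w" using reach_par_iff[OF w(1,2)] w(3) by auto
  then show "\<omega> \<in> {\<omega>\<in>space N. reach (OB UNIV \<omega>) u v}"
    using * reach_trans by (auto simp: sprinkled_def)
qed

text \<open>For \<open>j \<ge> 1\<close> this is the expected number of first gaps ending at level
  \<open>j\<close>. At \<open>j = 0\<close> the summand is not a gap probability, so all uses start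
  at level 1.\<close>

definition F :: "'v \<Rightarrow> nat \<Rightarrow> real" where
  "F u j = (\<Sum>w\<in>Lv u j. p {False} u (par w) - p {False} u w)"

lemma Lv_pos: "w \<in> Lv u j \<Longrightarrow> 1 \<le> j \<Longrightarrow> w \<noteq> r \<and> desc u w \<and> w \<noteq> u"
  by (auto simp: Lv_def)

lemma F_nonneg: "1 \<le> j \<Longrightarrow> 0 \<le> F u j"
  unfolding F_def using Lv_pos[of _ u j] prob_first_gap[of _ u] by (intro sum_nonneg) (metis measure_nonneg)

text \<open>Every reached vertex offers d - 1 downward edges, each of which either is covered or
  becomes a first gap.\<close>

lemma F_eq:
  assumes u: "u \<noteq> r"
  shows "F u (Suc j) = (real d - 1) * M {False} u j - M {False} u (Suc j)"
proof -
  have "(\<Sum>w\<in>Lv u (Suc j). p {False} u (par w)) = (\<Sum>x\<in>Lv u j. \<Sum>w\<in>ch x. p {False} u x)"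
    unfolding sum_Lv_Suc by (intro sum.cong refl) (auto simp: ch_def)
  also have "\<dots> = (\<Sum>x\<in>Lv u j. (real d - 1) * p {False} u x)"
  proof (rule sum.cong[OF refl])
    fix x assume "x \<in> Lv u j"
    then have "x \<noteq> r" using desc_ne_root u by (auto simp: Lv_def)
    then show "(\<Sum>w\<in>ch x. p {False} u x) = (real d - 1) * p {False} u x"
      using d3 by (simp add: card_ch of_nat_diff)
  qed
  finally show ?thesis by (simp add: F_def M_def sum_subtractf sum_distrib_left)
qed

text \<open>A path has at most one first gap, so for fixed \<open>v\<close> the sprinkled events at
  different levels are disjoint, and each of them connects \<open>u\<close> to \<open>v\<close>.
  Summing over \<open>v\<close> and grouping by the ancestor at the gap gives the
  convolution.\<close>

lemma sprinkle_recursion: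
  assumes u: "u \<noteq> r"
  shows "\<epsilon> * (\<Sum>j=1..k. F u j * M UNIV u (k - j)) \<le> M UNIV u k"
proof -
  have one: "(\<Sum>j=1..k. N.prob (sprinkled u (anc v (depth u + j)) v)) \<le> p UNIV u v" if v: "v \<in> Lv u k" for v
  proof -
    let ?w = "\<lambda>j. anc v (depth u + j)"
    have v': "desc u v" "depth v = depth u + k" using v by (auto simp: Lv_def)
    have w: "?w j \<in> Lv u j" if "j \<le> k" for j
      using v' that desc_ancD[of u v "depth u + j"] depth_anc[of "depth u + j" v] by (simp add: Lv_def)
    have wp: "?w j \<noteq> r" "desc u (?w j)" "?w j \<noteq> u" if "j \<in> {1..k}" for j
      using Lv_pos[OF w, of j] that by auto
    \<comment> \<open>A first gap at the deeper level \<open>j\<close> requires that the base soup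
      reaches level \<open>j - 1\<close>, hence also level \<open>i\<close>.\<close>
    have gap: "first_gap u (?w i) \<inter> first_gap u (?w j) = {}" if ij: "i \<in> {1..k}" "j \<in> {1..k}" "i < j" for i j
    proof -
      have "par (?w j) = ?w (j - 1)" using par_anc[of "depth u + (j - 1)" v] ij v' by simp
      moreover have "desc (?w i) (?w (j - 1))"
        using ij v' desc_ancD[of "?w i" v "depth u + (j - 1)"] desc_anc[of "depth u + i" v] depth_anc[of "depth u + i" v] by auto
      ultimately have "reach Q u (?w i)" if "reach Q u (par (?w j))" for Q
        using reach_prefix[OF that, of "?w i"] wp(2)[OF ij(1)] by simp
      then show ?thesis by (auto simp: first_gap_def)
    qed
    have "disjoint_family_on (\<lambda>j. sprinkled u (?w j) v) {1..k}"
      unfolding disjoint_family_on_def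
    proof (intro ballI impI)
      fix i j assume ij: "i \<in> {1..k}" "j \<in> {1..k}" "i \<noteq> j"
      then have "first_gap u (?w i) \<inter> first_gap u (?w j) = {}"
        using gap[of i j] gap[of j i] by (cases "i < j") auto
      then show "sprinkled u (?w i) v \<inter> sprinkled u (?w j) v = {}" by (auto simp: sprinkled_def)
    qed
    then have "(\<Sum>j=1..k. N.prob (sprinkled u (?w j) v)) = N.prob (\<Union>j\<in>{1..k}. sprinkled u (?w j) v)"
      using prob_sprinkled(1)[OF wp] by (intro N.finite_measure_finite_Union[symmetric]) auto
    also have "\<dots> \<le> p UNIV u v" unfolding p_def
    proof (intro N.finite_measure_mono UN_least)
      fix j assume "j \<in> {1..k}"
      then show "sprinkled u (?w j) v \<subseteq> {\<omega>\<in>space N. reach (OB UNIV \<omega>) u v}"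
        by (intro sprinkled_reach wp)
    qed (intro ev_N reach_N)
    finally show ?thesis .
  qed
  have "\<epsilon> * (\<Sum>j=1..k. F u j * M UNIV u (k - j)) = (\<Sum>j=1..k. \<Sum>v\<in>Lv u k. N.prob (sprinkled u (anc v (depth u + j)) v))"
    unfolding sum_distrib_left
  proof (rule sum.cong[OF refl])
    fix j assume j: "j \<in> {1..k}"
    have "(\<Sum>v\<in>Lv u (j + (k - j)). N.prob (sprinkled u (anc v (depth u + j)) v)) =
       (\<Sum>w\<in>Lv u j. \<Sum>v\<in>Lv w (k - j). N.prob (sprinkled u (anc v (depth u + j)) v))"
      by (rule sum_Lv_add)
    also have "\<dots> = (\<Sum>w\<in>Lv u j. \<Sum>v\<in>Lv w (k - j). (p {False} u (par w) - p {False} u w) * (\<epsilon> * p UNIV w v))"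
    proof (intro sum.cong refl)
      fix w v assume w: "w \<in> Lv u j" and v: "v \<in> Lv w (k - j)"
      have "anc v (depth u + j) = w" using w v by (auto simp: Lv_def desc_def)
      then show "N.prob (sprinkled u (anc v (depth u + j)) v) = (p {False} u (par w) - p {False} u w) * (\<epsilon> * p UNIV w v)"
        using prob_sprinkled(2)[of w u v] Lv_pos[OF w] j by auto
    qed
    also have "\<dots> = (\<Sum>w\<in>Lv u j. (p {False} u (par w) - p {False} u w) * (\<epsilon> * M UNIV w (k - j)))"
      by (simp add: M_def sum_distrib_left)
    also have "\<dots> = (\<Sum>w\<in>Lv u j. (p {False} u (par w) - p {False} u w) * (\<epsilon> * M UNIV u (k - j)))"
      using Lv_pos[of _ u j] j M_homogeneous[OF u] by (intro sum.cong) auto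
    also have "\<dots> = \<epsilon> * (F u j * M UNIV u (k - j))" by (simp add: F_def sum_distrib_left sum_distrib_right mult.left_commute)
    finally show "\<epsilon> * (F u j * M UNIV u (k - j)) = (\<Sum>v\<in>Lv u k. N.prob (sprinkled u (anc v (depth u + j)) v))"
      using j by simp
  qed
  also have "\<dots> = (\<Sum>v\<in>Lv u k. \<Sum>j=1..k. N.prob (sprinkled u (anc v (depth u + j)) v))" by (rule sum.swap)
  also have "\<dots> \<le> M UNIV u k" unfolding M_def by (intro sum_mono one)
  finally show ?thesis .
qed

text \<open>If no mean of the union exceeds 1, the divergent base series makes the total gap weight
  as large as desired. The renewal inequality then forces exponential growth of partial sums whose
  terms are at most 1.\<close>

lemma supercritical_if_not_summable:
  assumes u: "u \<noteq> r" and beta0: "0 < \<beta>" and ns: "\<not> summable (M {False} u)"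
  shows "\<exists>k. 1 < M UNIV u k"
proof (rule ccontr)
  assume "\<not> ?thesis"
  then have y1: "M UNIV u k \<le> 1" for k by (simp add: not_less)
  let ?x = "M {False} u" and ?y = "M UNIV u"
  have x1: "?x k \<le> 1" for k using M_mono[of "{False}" UNIV u k] y1[of k] by simp
  \<comment> \<open>Telescoping gives (d - 2) times the left-hand sum plus \<open>1 - ?x n\<close>;
    here \<open>3 \<le> d\<close> and \<open>?x n \<le> 1\<close> are used.\<close>
  have sumF: "(\<Sum>i<n. ?x i) \<le> (\<Sum>j=1..n. F u j)" for n
  proof -
    have "(\<Sum>j=1..n. F u j) = (\<Sum>i<n. F u (Suc i))"
      by (rule sum.reindex_bij_witness[of _ Suc "\<lambda>j. j - 1"]) auto
    also have "\<dots> = (real d - 1) * (\<Sum>i<n. ?x i) - (\<Sum>i<n. ?x (Suc i))"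
      by (simp add: F_eq[OF u] sum_subtractf sum_distrib_left)
    also have "(\<Sum>i<n. ?x (Suc i)) = (\<Sum>i<n. ?x i) + ?x n - 1"
      by (induction n) auto
    finally have *: "(\<Sum>j=1..n. F u j) = (real d - 1) * (\<Sum>i<n. ?x i) - ((\<Sum>i<n. ?x i) + ?x n - 1)" .
    have "2 * (\<Sum>i<n. ?x i) \<le> (real d - 1) * (\<Sum>i<n. ?x i)"
      using d3 by (intro mult_right_mono sum_nonneg) auto
    with * x1[of n] show ?thesis by linarith
  qed
  have "\<exists>n. 2 / \<epsilon> < (\<Sum>i<n. ?x i)"
  proof (rule ccontr)
    assume "\<not> ?thesis"
    then have "(\<Sum>i<n. ?x i) \<le> 2 / \<epsilon>" for n by (simp add: not_less)
    then have "summable ?x" by (intro summableI_nonneg_bounded) auto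
    then show False using ns by simp
  qed
  then obtain n where "2 / \<epsilon> < (\<Sum>i<n. ?x i)" by blast
  then have "2 / \<epsilon> \<le> (\<Sum>j=1..n. F u j)" using sumF[of n] by linarith
  then have n: "2 \<le> \<epsilon> * (\<Sum>j=1..n. F u j)" using eps(2)[OF beta0] by (simp add: field_simps)
  then have n0: "1 \<le> n" by (cases n) auto
  define S where "S K = (\<Sum>k\<le>K. ?y k)" for K
  have S0: "0 \<le> S K" for K by (simp add: S_def sum_nonneg)
  \<comment> \<open>Sum the renewal inequality over \<open>k \<le> K + n\<close>. Each shift
    \<open>j \<le> n\<close> leaves room for a complete copy of \<open>S K\<close>, and the total
    weight of the shifts is at least 2.\<close>
  have grow: "2 * S K \<le> S (K + n)" for K
  proof -
    have inner: "S K \<le> (\<Sum>k\<le>K + n. if j \<le> k then ?y (k - j) else 0)" if "j \<in> {1..n}" for j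
    proof -
      have "S K = (\<Sum>k\<in>{j..j + K}. if j \<le> k then ?y (k - j) else 0)"
        unfolding S_def by (rule sum.reindex_bij_witness[of _ "\<lambda>k. k - j" "\<lambda>k. k + j"]) auto
      also have "\<dots> \<le> (\<Sum>k\<le>K + n. if j \<le> k then ?y (k - j) else 0)"
        using that by (intro sum_mono2) auto
      finally show ?thesis .
    qed
    have "2 * S K \<le> \<epsilon> * (\<Sum>j=1..n. F u j) * S K" using n S0 by (intro mult_right_mono) auto
    also have "\<dots> = \<epsilon> * (\<Sum>j=1..n. F u j * S K)" by (simp add: sum_distrib_right)
    also have "\<dots> \<le> \<epsilon> * (\<Sum>j=1..n. F u j * (\<Sum>k\<le>K + n. if j \<le> k then ?y (k - j) else 0))"
      using inner F_nonneg eps by (intro mult_left_mono sum_mono) auto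
    also have "\<dots> = (\<Sum>k\<le>K + n. \<epsilon> * (\<Sum>j=1..n. F u j * (if j \<le> k then ?y (k - j) else 0)))"
      by (simp only: sum_distrib_left sum.swap[of _ "{1..n}"])
    also have "\<dots> \<le> (\<Sum>k\<le>K + n. ?y k)"
    proof (rule sum_mono)
      fix k
      have "(\<Sum>j=1..n. F u j * (if j \<le> k then ?y (k - j) else 0)) =
          (\<Sum>j\<in>{1..n} \<inter> {1..k}. F u j * ?y (k - j))"
        by (rule sum.mono_neutral_cong_right) auto
      also have "\<dots> \<le> (\<Sum>j=1..k. F u j * ?y (k - j))"
        by (intro sum_mono2) (auto simp: F_nonneg)
      finally have "\<epsilon> * (\<Sum>j=1..n. F u j * (if j \<le> k then ?y (k - j) else 0)) \<le> \<epsilon> * (\<Sum>j=1..k. F u j * ?y (k - j))"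
        using eps by (intro mult_left_mono)
      then show "\<epsilon> * (\<Sum>j=1..n. F u j * (if j \<le> k then ?y (k - j) else 0)) \<le> ?y k"
        using sprinkle_recursion[OF u, of k] by linarith
    qed
    finally show ?thesis by (simp add: S_def)
  qed
  have "2 ^ m \<le> S (m * n)" for m
  proof (induction m)
    case 0
    then show ?case by (simp add: S_def)
  next
    case (Suc m)
    then show ?case using grow[of "m * n"] by (simp add: add.commute)
  qed
  \<comment> \<open>With 4 n doublings the left side is the square of 2 ^ (2 n), hence at least (2 n
    + 1)^2, which exceeds the linear bound 4 n^2 + 1.\<close>
  from this[of "4 * n"] have 1: "2 ^ (4 * n) \<le> S (4 * n * n)" .
  have "S (4 * n * n) \<le> (\<Sum>k\<le>4 * n * n. 1)" unfolding S_def by (intro sum_mono y1)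
  then have 2: "S (4 * n * n) \<le> real (4 * n * n + 1)" by simp
  have "2 * n + 1 \<le> (2::nat) ^ (2 * n)" using less_exp[of "2 * n"] by linarith
  then have "(2 * n + 1)\<^sup>2 \<le> ((2::nat) ^ (2 * n))\<^sup>2" by (rule power_mono) simp
  also have "\<dots> = 2 ^ (4 * n)" by (simp add: mult.commute flip: power_mult)
  finally have "real ((2 * n + 1)\<^sup>2) \<le> 2 ^ (4 * n)" by (metis of_nat_le_iff of_nat_numeral of_nat_power)
  then have "real ((2 * n + 1)\<^sup>2) \<le> real (4 * n * n + 1)" using 1 2 by linarith
  then have "(2 * n + 1)\<^sup>2 \<le> 4 * n * n + 1" by (simp only: of_nat_le_iff)
  then show False using n0 by (simp add: power2_eq_square algebra_simps)
qed

subsection \<open>Loops through the root\<close>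

text \<open>The only edge joining the subtree of \<open>c\<close> to its complement ends at
  \<open>c\<close>, so a walk avoiding \<open>c\<close> stays on one side.\<close>

lemma walk_stays:
  assumes "successively (\<lambda>u v. (u, v) \<in> E) xs" "c \<notin> set xs" "w \<in> set xs" "desc c w"
  shows "set xs \<subseteq> {v. desc c v}"
  using assms
proof (induction xs arbitrary: w)
  case (Cons x xs)
  show ?case
  proof (cases "xs = []")
    case False
    then have xy: "(x, hd xs) \<in> E" "successively (\<lambda>u v. (u, v) \<in> E) xs" "hd xs \<in> set xs"
      using Cons.prems by (auto simp: successively_Cons)
    have "desc c x \<longleftrightarrow> desc c (hd xs)"
      using edge_leaves[OF xy(1), of c] edge_leaves[OF E_sym[OF xy(1)], of c] Cons.prems xy(3) by auto
    then obtain w' where w': "w' \<in> set xs" "desc c w'" using Cons.prems xy(3) by (cases "w = x") auto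
    have "set xs \<subseteq> {v. desc c v}" using Cons.prems by (intro Cons.IH[OF xy(2) _ w']) auto
    with xy(3) \<open>desc c x \<longleftrightarrow> desc c (hd xs)\<close> show ?thesis by auto
  qed (use Cons in auto)
qed simp

lemma based_loopI: "xs = c # ys \<Longrightarrow> ys \<noteq> [] \<Longrightarrow> successively (\<lambda>u v. (u, v) \<in> E) xs \<Longrightarrow> (last xs, c) \<in> E \<Longrightarrow> xs \<in> based_loops E"
  by (cases ys) (auto simp: based_loops_def)

lemma loop_split:
  assumes l: "l \<in> loops E" "c \<in> loop_vertices l" "w \<in> loop_vertices l" and w: "desc c w" "w \<noteq> c"
  obtains ys zs where "c # ys \<in> based_loops E" "c \<notin> set ys" "w \<in> set ys" "set ys \<subseteq> {v. desc c v}"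
    "zs = [] \<or> successively (\<lambda>u v. (u, v) \<in> E) zs \<and> hd zs = c \<and> (last zs, c) \<in> E"
    "(c # ys) @ zs \<in> based_loops E" "l = cyclic_shift E `` {(c # ys) @ zs}"
proof -
  obtain xs where xs: "xs \<in> based_loops E" "l = cyclic_shift E `` {xs}" "hd xs = w"
    using loop_repr_hd[OF l(1,3)] .
  have "c \<in> set xs" using l(2) xs loop_vertices_class by auto
  \<comment> \<open>The loop starts at \<open>w\<close>. The excursion around \<open>w\<close>
    therefore runs from the last \<open>c\<close> through the end of the list and its beginning up
    to the first \<open>c\<close>; what remains of \<open>A\<close> is the closed walk.\<close>
  then obtain A B where AB: "xs = A @ c # B" "c \<notin> set B" using split_list_last by metis
  have A: "A \<noteq> []" "hd A = w" using AB xs(3) w by (cases A; auto)+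
  define A1 A2 where "A1 = takeWhile (\<lambda>x. x \<noteq> c) A" and "A2 = dropWhile (\<lambda>x. x \<noteq> c) A"
  have A12: "A = A1 @ A2" by (simp add: A1_def A2_def)
  obtain A' where "A = w # A'" using A by (cases A) auto
  then have A1: "c \<notin> set A1" "w \<in> set A1" using w(2) by (auto simp: A1_def dest: set_takeWhileD)
  have A2: "A2 = [] \<or> hd A2 = c" using hd_dropWhile[of "\<lambda>x. x \<noteq> c" A] unfolding A2_def by blast
  let ?ys = "B @ A1"
  have rot: "(c # ?ys) @ A2 = rotate (length A) xs" unfolding AB(1) rotate_append by (simp add: A12)
  have b: "(c # ?ys) @ A2 \<in> based_loops E" unfolding rot using xs by simp
  have cls: "l = cyclic_shift E `` {(c # ?ys) @ A2}" unfolding rot class_rotate[OF xs(1)] by (rule xs)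
  have succ: "successively (\<lambda>u v. (u, v) \<in> E) ((c # ?ys) @ A2)" and lst: "(last ((c # ?ys) @ A2), c) \<in> E"
    using b by (auto simp: based_loops_def)
  have ne: "?ys \<noteq> []" using A1 by auto
  have s1: "successively (\<lambda>u v. (u, v) \<in> E) (c # ?ys)" and
    s2: "A2 \<noteq> [] \<Longrightarrow> (last (c # ?ys), hd A2) \<in> E \<and> successively (\<lambda>u v. (u, v) \<in> E) A2"
    using succ unfolding successively_append_iff by auto
  have l1: "(last (c # ?ys), c) \<in> E" using lst s2 A2 by (cases "A2 = []") auto
  show thesis
  proof (rule that)
    show "c # ?ys \<in> based_loops E" by (rule based_loopI[OF refl ne s1 l1])
    show c: "c \<notin> set ?ys" using AB A1 by auto
    show "w \<in> set ?ys" using A1 by auto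
    show "set ?ys \<subseteq> {v. desc c v}"
      using s1 ne by (intro walk_stays[OF _ c _ w(1)]) (use A1 in \<open>auto simp: successively_Cons\<close>)
    show "A2 = [] \<or> successively (\<lambda>u v. (u, v) \<in> E) A2 \<and> hd A2 = c \<and> (last A2, c) \<in> E"
      using s2 A2 lst by auto
  qed (fact b cls)+
qed

text \<open>The single occurrence of \<open>c\<close> fixes the starting point, so distinct
  excursions from \<open>c\<close> are distinct loops and their masses add.\<close>

lemma excursion_class_inj:
  assumes "c # ys \<in> based_loops E" "c \<notin> set ys" "c # ys' \<in> based_loops E" "c \<notin> set ys'"
    and "cyclic_shift E `` {c # ys} = cyclic_shift E `` {c # ys'}"
  shows "ys = ys'"
proof -
  have "c # ys' \<in> cyclic_shift E `` {c # ys'}" using assms by (auto simp: cyclic_shift_def intro: exI[of _ 0])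
  then obtain k where k: "c # ys' = rotate k (c # ys)" using assms class_eq[OF assms(1)] by auto
  let ?n = "length (c # ys)"
  have n: "k mod ?n < ?n" by (rule mod_less_divisor) simp
  have "(c # ys) ! (k mod ?n) = c"
    using nth_rotate[of 0 "c # ys" k] k by (metis add.right_neutral length_greater_0_conv list.distinct(1) nth_Cons_0)
  moreover have "(c # ys) ! i \<noteq> c" if "i < ?n" "i \<noteq> 0" for i
    using that assms(2) by (cases i) auto
  ultimately have "k mod ?n = 0" using n by blast
  then have "rotate k (c # ys) = c # ys" using rotate_conv_mod[of k "c # ys"] by simp
  then show ?thesis using k by simp
qed

text \<open>
  Cutting a loop through \<open>c\<close> and \<open>w\<close> at two consecutive visits of \<open>c\<close> around a visit of \<open>w\<close> gives
  an excursion into the subtree below \<open>c\<close> and a closed walk at \<open>c\<close>; the closed walks have bounded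
  total weight because \<open>\<kappa> \<ge> \<kappa>\<^sub>c\<close>.
\<close>

lemma loop_mass_comparison:
  assumes w: "desc c w" "w \<noteq> c"
    and L: "finite L" "\<And>l. l \<in> L \<Longrightarrow> l \<in> loops E \<and> c \<in> loop_vertices l \<and> w \<in> loop_vertices l"
  shows "\<exists>L'. finite L' \<and> (\<forall>l\<in>L'. l \<in> LT c \<and> c \<in> loop_vertices l \<and> w \<in> loop_vertices l) \<and>
    (\<Sum>l\<in>L. mu l) \<le> 4 * (\<Sum>l\<in>L'. mu l) \<and> (\<Sum>l\<in>L'. mu l) \<le> 4"
proof -
  \<comment> \<open>Re-rooting at \<open>c\<close> makes the bound on closed walks available at
    \<open>c\<close>; the descendant relation of the statement still refers to
    \<open>r\<close>.\<close>
  interpret C: rooted_tree E d c by standard (rule tree)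
  let ?cl = "\<lambda>xs. cyclic_shift E `` {xs}"
  let ?good = "\<lambda>l ys zs. c # ys \<in> based_loops E \<and> c \<notin> set ys \<and> w \<in> set ys \<and> set ys \<subseteq> {v. desc c v} \<and>
    (zs = [] \<or> successively (\<lambda>u v. (u, v) \<in> E) zs \<and> hd zs = c \<and> (last zs, c) \<in> E) \<and>
    (c # ys) @ zs \<in> based_loops E \<and> l = ?cl ((c # ys) @ zs)"
  have "\<forall>l\<in>L. \<exists>yz. ?good l (fst yz) (snd yz)"
  proof
    fix l assume "l \<in> L"
    then have l: "l \<in> loops E" "c \<in> loop_vertices l" "w \<in> loop_vertices l" using L(2) by auto
    show "\<exists>yz. ?good l (fst yz) (snd yz)"
      by (rule loop_split[OF l w]) (metis fst_conv snd_conv)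
  qed
  from bchoice[OF this] obtain f where f: "\<forall>l\<in>L. ?good l (fst (f l)) (snd (f l))" ..
  define H where "H = (\<lambda>l. fst (f l)) ` L"
  define T where "T = (\<lambda>l. snd (f l)) ` L"
  have fin: "finite H" "finite T" using L by (auto simp: H_def T_def)
  have H: "c # ys \<in> based_loops E \<and> c \<notin> set ys \<and> w \<in> set ys \<and> set ys \<subseteq> {v. desc c v}" if "ys \<in> H" for ys
    using that f unfolding H_def by blast
  have Tr: "zs = [] \<or> successively (\<lambda>u v. (u, v) \<in> E) zs \<and> hd zs = c \<and> (last zs, c) \<in> E" if "zs \<in> T" for zs
    using that f unfolding T_def by blast
  have inj: "inj_on f L"
  proof (rule inj_onI)
    fix l l' assume "l \<in> L" "l' \<in> L" "f l = f l'"
    have "l = ?cl ((c # fst (f l)) @ snd (f l))" using bspec[OF f \<open>l \<in> L\<close>] by (elim conjE)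
    moreover have "l' = ?cl ((c # fst (f l)) @ snd (f l))"
      unfolding \<open>f l = f l'\<close> using bspec[OF f \<open>l' \<in> L\<close>] by (elim conjE)
    ultimately show "l = l'" by (rule trans[OF _ sym])
  qed
  have sT: "(\<Sum>zs\<in>T. s ^ length zs) \<le> 4"
    using s_props by (intro C.closed_walk_bound[OF d3 _ _ fin(2) Tr]) auto
  \<comment> \<open>An excursion is itself a closed walk at \<open>c\<close>. This gives the
    absolute bound on the mass of \<open>L'\<close>.\<close>
  have "(\<Sum>xs\<in>(#) c ` H. s ^ length xs) \<le> 4"
    using s_props fin(1) by (intro C.closed_walk_bound[OF d3]) (auto dest!: H simp: based_loops_def)
  then have sH: "(\<Sum>ys\<in>H. s ^ length (c # ys)) \<le> 4"
    by (subst (asm) sum.reindex) auto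
  have "(\<Sum>l\<in>L. mu l) \<le> (\<Sum>l\<in>L. s ^ length (c # fst (f l)) * s ^ length (snd (f l)))"
  proof (rule sum_mono)
    fix l assume "l \<in> L"
    have g1: "(c # fst (f l)) @ snd (f l) \<in> based_loops E" using bspec[OF f \<open>l \<in> L\<close>] by (elim conjE)
    have g2: "l = ?cl ((c # fst (f l)) @ snd (f l))" using bspec[OF f \<open>l \<in> L\<close>] by (elim conjE)
    have "mu l \<le> s ^ length ((c # fst (f l)) @ snd (f l))" by (rule ord_eq_le_trans[OF arg_cong[where f = mu, OF g2] mu_le[OF g1]])
    then show "mu l \<le> s ^ length (c # fst (f l)) * s ^ length (snd (f l))"
      by (simp only: length_append power_add)
  qed
  also have "\<dots> = (\<Sum>yz\<in>f ` L. s ^ length (c # fst yz) * s ^ length (snd yz))"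
    by (subst sum.reindex[OF inj]) simp
  \<comment> \<open>Admitting all pairs of excursions and closed walks makes the sum
    factorise.\<close>
  also have "\<dots> \<le> (\<Sum>yz\<in>H \<times> T. s ^ length (c # fst yz) * s ^ length (snd yz))"
  proof (rule sum_mono2)
    show "f ` L \<subseteq> H \<times> T" by (rule image_subsetI) (simp add: H_def T_def mem_Times_iff)
  qed (use fin s_props in auto)
  also have "\<dots> = (\<Sum>ys\<in>H. s ^ length (c # ys)) * (\<Sum>zs\<in>T. s ^ length zs)"
    by (simp add: sum_product sum.cartesian_product split_def)
  also have "\<dots> \<le> (\<Sum>ys\<in>H. s ^ length (c # ys)) * 4"
    using sT s_props by (intro mult_left_mono sum_nonneg) auto
  finally have le: "(\<Sum>l\<in>L. mu l) \<le> 4 * (\<Sum>ys\<in>H. s ^ length (c # ys))" by simp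
  define L' where "L' = (\<lambda>ys. ?cl (c # ys)) ` H"
  have "inj_on (\<lambda>ys. ?cl (c # ys)) H"
  proof (rule inj_onI)
    fix ys ys' assume "ys \<in> H" "ys' \<in> H" "?cl (c # ys) = ?cl (c # ys')"
    then show "ys = ys'" using H excursion_class_inj by blast
  qed
  then have "(\<Sum>l\<in>L'. mu l) = (\<Sum>ys\<in>H. mu (?cl (c # ys)))"
    unfolding L'_def by (subst sum.reindex) auto
  also have "\<dots> = (\<Sum>ys\<in>H. s ^ length (c # ys))"
    using H by (intro sum.cong refl mu_excursion) auto
  finally have eq: "(\<Sum>l\<in>L'. mu l) = (\<Sum>ys\<in>H. s ^ length (c # ys))" .
  have "l \<in> LT c \<and> c \<in> loop_vertices l \<and> w \<in> loop_vertices l" if lL: "l \<in> L'" for l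
  proof -
    obtain ys where ys: "ys \<in> H" "l = ?cl (c # ys)" using lL by (auto simp: L'_def)
    note h = H[OF ys(1)]
    have "loop_vertices l = set (c # ys)" using h ys loop_vertices_class by blast
    then show ?thesis using h ys by (auto simp: loops_repr)
  qed
  then show ?thesis using le sH eq fin by (intro exI[of _ L']) (auto simp: L'_def)
qed

section \<open>Comparison of the root with the subtrees below it\<close>

definition some_open :: "'v list set set \<Rightarrow> ('v list set \<times> bool \<Rightarrow> nat) set" where
  "some_open L = {\<omega>\<in>space N. \<exists>l\<in>L. l \<in> OB {False} \<omega>}"

lemma some_open_G:
  assumes "L \<subseteq> loops E" "L \<times> {False} \<subseteq> J" shows "some_open L \<in> sets (G J)"
proof -
  have "Measurable.pred (G J) (\<lambda>\<omega>. \<exists>l\<in>L. l \<in> OB {False} \<omega>)"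
  proof (rule pred_Bex_countable)
    show "countable L" using countable_loops[of L] assms(1) by (simp add: Int_absorb2)
    fix l assume "l \<in> L"
    then show "Measurable.pred (G J) (\<lambda>\<omega>. l \<in> OB {False} \<omega>)"
      using assms(2) by (intro OB_meas G_coord) auto
  qed
  then show ?thesis by (simp add: some_open_def pred_def)
qed

lemma some_open_N: "L \<subseteq> loops E \<Longrightarrow> some_open L \<in> sets N"
  using some_open_G[of L idx] G_sets_N[of idx] by (auto simp: idx_def)

lemma prob_some_open:
  assumes "finite L" "L \<subseteq> loops E"
  shows "N.prob (some_open L) = 1 - exp (- (\<alpha> * (\<Sum>l\<in>L. mu l)))"
proof -
  let ?A = "(\<lambda>l. (l, False)) ` L"
  have A: "finite ?A" "?A \<subseteq> idx" using assms by (auto simp: idx_def)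
  have eq: "{\<omega>\<in>space N. \<forall>x\<in>?A. \<omega> x = 0} = space N - some_open L"
    using assms by (auto simp: some_open_def OB_def)
  have "1 - N.prob (some_open L) = exp (- (\<Sum>x\<in>?A. rate x))"
    using prob_none[OF A] N.prob_compl[OF some_open_N[OF assms(2)]] unfolding eq by simp
  also have "(\<Sum>x\<in>?A. rate x) = \<alpha> * (\<Sum>l\<in>L. mu l)"
    by (subst sum.reindex) (auto simp: inj_on_def rate_def sum_distrib_left)
  finally show ?thesis by simp
qed

text \<open>Exhaustion of a countable family by finite ones, so that loop masses are summed over
  finite sets only.\<close>

lemma prob_some_open_le:
  assumes L: "L \<subseteq> loops E" and b: "\<And>L'. finite L' \<Longrightarrow> L' \<subseteq> L \<Longrightarrow> N.prob (some_open L') \<le> b"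
  shows "N.prob (some_open L) \<le> b"
proof (cases "L = {}")
  case True
  then show ?thesis using b[of L] by simp
next
  case False
  have "countable L" using countable_loops[of L] L by (simp add: Int_absorb2)
  then have range: "range (from_nat_into L) = L" using False by simp
  let ?S = "\<lambda>n. some_open (from_nat_into L ` {..<n})"
  have sub: "from_nat_into L ` {..<n} \<subseteq> L" for n using range by blast
  have "(\<lambda>n. N.prob (?S n)) \<longlonglongrightarrow> N.prob (\<Union>n. ?S n)"
  proof (rule N.finite_Lim_measure_incseq)
    show "range ?S \<subseteq> sets N" by (intro image_subsetI[of UNIV] some_open_N[OF order_trans[OF sub L]])
    show "incseq ?S" by (auto simp: incseq_def some_open_def)
  qed
  then have "N.prob (\<Union>n. ?S n) \<le> b" by (rule LIMSEQ_le_const2) (use b sub in auto)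
  also have "(\<Union>n. ?S n) = some_open L"
  proof -
    have "(\<Union>n. from_nat_into L ` {..<n}) = L" using range by blast
    then show ?thesis unfolding some_open_def by blast
  qed
  finally show ?thesis .
qed

definition thru :: "'v \<Rightarrow> 'v \<Rightarrow> 'v list set set" where
  "thru u w = {l \<in> loops E. u \<in> loop_vertices l \<and> w \<in> loop_vertices l}"

text \<open>The mass comparison bounds the left side by \<open>4 * t\<close>, with \<open>t\<close>
  the intensity of the loops of \<open>L'\<close>. One open loop of \<open>L'\<close> covers the
  whole path from \<open>c\<close> to \<open>w\<close>, so \<open>1 - exp (- t)\<close> bounds the
  connection probability from below.\<close>

lemma prob_thru_le:
  assumes w: "desc c w" "w \<noteq> c"
  shows "N.prob (some_open (thru c w)) \<le> 4 * (1 + 4 * \<alpha>) * p {False} c w"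
proof (rule prob_some_open_le)
  fix L assume L: "finite L" "L \<subseteq> thru c w"
  obtain L' where L': "finite L'" "\<And>l. l \<in> L' \<Longrightarrow> l \<in> LT c \<and> c \<in> loop_vertices l \<and> w \<in> loop_vertices l"
    "(\<Sum>l\<in>L. mu l) \<le> 4 * (\<Sum>l\<in>L'. mu l)" "(\<Sum>l\<in>L'. mu l) \<le> 4"
    using loop_mass_comparison[OF w L(1)] L(2) unfolding thru_def by blast
  define t where "t = \<alpha> * (\<Sum>l\<in>L'. mu l)"
  have t: "0 \<le> t" "t \<le> 4 * \<alpha>" using alpha L'(4) mult_left_mono[OF L'(4) alpha]
    by (auto simp: t_def intro!: mult_nonneg_nonneg sum_nonneg)
  have "1 - exp (- t) = N.prob (some_open L')"
    unfolding t_def using L' by (intro prob_some_open[symmetric]) auto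
  also have "\<dots> \<le> p {False} c w"
    unfolding p_def
  proof (rule N.finite_measure_mono)
    show "some_open L' \<subseteq> {\<omega>\<in>space N. reach (OB {False} \<omega>) c w}"
    proof
      fix \<omega> assume "\<omega> \<in> some_open L'"
      then obtain l where l: "\<omega> \<in> space N" "l \<in> L'" "l \<in> OB {False} \<omega>" by (auto simp: some_open_def)
      have "reach (OB {False} \<omega>) c w"
        unfolding reach_def
      proof (intro conjI allI impI w; elim conjE)
        fix i assume i: "depth c < i" "i \<le> depth w"
        show "cov (OB {False} \<omega>) c (anc w i)"
          using L'(2)[OF l(2)] i depth_anc[of i w] desc_depth[of "anc w i" c]
          by (intro loop_covers[OF l(3) OB_loops, of c w _ c] desc_anc) auto
      qed
      then show "\<omega> \<in> {\<omega>\<in>space N. reach (OB {False} \<omega>) c w}" using l by simp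
    qed
  qed (intro ev_N reach_N)
  finally have reach: "1 - exp (- t) \<le> p {False} c w" .
  have "N.prob (some_open L) = 1 - exp (- (\<alpha> * (\<Sum>l\<in>L. mu l)))"
    using L by (intro prob_some_open) (auto simp: thru_def)
  also have "\<dots> \<le> \<alpha> * (\<Sum>l\<in>L. mu l)" using exp_ge_add_one_self[of "- (\<alpha> * (\<Sum>l\<in>L. mu l))"] by linarith
  also have "\<dots> \<le> 4 * t" using mult_left_mono[OF L'(3) alpha] by (simp add: t_def algebra_simps)
  also have "\<dots> \<le> 4 * ((1 + 4 * \<alpha>) * (1 - exp (- t)))"
  proof -
    \<comment> \<open>Turns \<open>t\<close> back into \<open>1 - exp (- t)\<close>; the lost factor
      \<open>1 + t\<close> is at most \<open>1 + 4 * \<alpha>\<close> because the mass of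
      \<open>L'\<close> is at most 4.\<close>
    have "(1 + t) * exp (- t) \<le> exp t * exp (- t)"
      using exp_ge_add_one_self[of t] by (intro mult_right_mono) auto
    then have "t \<le> (1 + t) * (1 - exp (- t))" by (simp add: algebra_simps flip: exp_add)
    also have "\<dots> \<le> (1 + 4 * \<alpha>) * (1 - exp (- t))" using t by (intro mult_right_mono) auto
    finally show ?thesis by simp
  qed
  also have "\<dots> \<le> 4 * ((1 + 4 * \<alpha>) * p {False} c w)"
    using reach alpha by (intro mult_left_mono) auto
  finally show "N.prob (some_open L) \<le> 4 * (1 + 4 * \<alpha>) * p {False} c w" by (simp only: mult.assoc)
qed (auto simp: thru_def)

text \<open>A loop through the root and a vertex below its child \<open>c\<close> also passes
  through \<open>c\<close>, so the comparison applies in the subtree of \<open>c\<close>. For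
  \<open>w = c\<close> the bound is trivial as \<open>p {False} c c = 1\<close>.\<close>

lemma prob_thru_root_sum:
  assumes u: "u \<noteq> r"
  shows "(\<Sum>w\<in>Lv r (Suc i). N.prob (some_open (thru r w))) \<le> real d * (4 * (1 + 4 * \<alpha>)) * M {False} u i"
proof -
  have 1: "N.prob (some_open (thru r w)) \<le> 4 * (1 + 4 * \<alpha>) * p {False} c w" if c: "c \<in> ch r" and w: "desc c w" for c w
  proof (cases "w = c")
    case True
    have "N.prob (some_open (thru r w)) \<le> 1" by simp
    moreover have "p {False} c w = 1" using True by simp
    moreover have "1 \<le> 4 * (1 + 4 * \<alpha>)" using alpha by simp
    ultimately show ?thesis by (metis mult_1_right order_trans)
  next
    case False
    have "thru r w \<subseteq> thru c w"
    proof
      fix l assume l: "l \<in> thru r w"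
      have "\<not> desc c r" using c desc_depth[of c r] depth_ch[OF c] by auto
      then show "l \<in> thru c w" using l loop_crosses(1)[of l w c r] w by (auto simp: thru_def)
    qed
    then have "some_open (thru r w) \<subseteq> some_open (thru c w)" by (auto simp: some_open_def)
    then have "N.prob (some_open (thru r w)) \<le> N.prob (some_open (thru c w))"
      by (rule N.finite_measure_mono) (rule some_open_N, auto simp: thru_def)
    then show ?thesis using prob_thru_le[OF w False] by linarith
  qed
  have "(\<Sum>w\<in>Lv r (1 + i). N.prob (some_open (thru r w))) = (\<Sum>c\<in>Lv r 1. \<Sum>w\<in>Lv c i. N.prob (some_open (thru r w)))"
    by (rule sum_Lv_add)
  also have "Lv r 1 = ch r" using Lv_Suc[of r 0] by simp
  also have "(\<Sum>c\<in>ch r. \<Sum>w\<in>Lv c i. N.prob (some_open (thru r w))) \<le> (\<Sum>c\<in>ch r. \<Sum>w\<in>Lv c i. 4 * (1 + 4 * \<alpha>) * p {False} c w)"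
    by (intro sum_mono 1) (auto simp: Lv_def)
  also have "\<dots> = (\<Sum>c\<in>ch r. 4 * (1 + 4 * \<alpha>) * M {False} u i)"
    by (intro sum.cong refl) (auto simp: M_def ch_def M_homogeneous[OF u, of _ "{False}" i, symmetric] simp flip: sum_distrib_left M_def)
  also have "\<dots> = real d * (4 * (1 + 4 * \<alpha>)) * M {False} u i" by (simp add: card_ch_root)
  finally show ?thesis by simp
qed

text \<open>A union bound over \<open>reach_root_decompose\<close>. The factors are independent,
  because a loop through the root is never contained below \<open>anc v i\<close>.\<close>

lemma p_root_le:
  assumes v: "v \<noteq> r"
  shows "p {False} r v \<le> (\<Sum>i=1..depth v. N.prob (some_open (thru r (anc v i))) * p {False} (anc v i) v)"
proof -
  let ?w = "\<lambda>i. anc v i"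
  let ?A = "\<lambda>i. some_open (thru r (?w i)) \<inter> {\<omega>\<in>space N. reach (OB {False} \<omega>) (?w i) v}"
  have A: "?A i \<in> sets N" for i
    by (intro sets.Int some_open_N ev_N reach_N) (auto simp: thru_def)
  have "p {False} r v \<le> N.prob (\<Union>i\<in>{1..depth v}. ?A i)"
    unfolding p_def
  proof (rule N.finite_measure_mono)
    show "{\<omega>\<in>space N. reach (OB {False} \<omega>) r v} \<subseteq> (\<Union>i\<in>{1..depth v}. ?A i)"
    proof
      fix \<omega> assume *: "\<omega> \<in> {\<omega>\<in>space N. reach (OB {False} \<omega>) r v}"
      then obtain i where "1 \<le> i" "i \<le> depth v" "\<exists>l\<in>OB {False} \<omega>. r \<in> loop_vertices l \<and> ?w i \<in> loop_vertices l"
        "reach (OB {False} \<omega>) (?w i) v"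
        using reach_root_decompose[OF OB_loops v] by blast
      then show "\<omega> \<in> (\<Union>i\<in>{1..depth v}. ?A i)" using * OB_loops[of "{False}" \<omega>]
        by (auto simp: some_open_def thru_def intro!: bexI[of _ i])
    qed
    show "(\<Union>i\<in>{1..depth v}. ?A i) \<in> sets N" using A by (intro sets.finite_UN) auto
  qed
  also have "\<dots> \<le> (\<Sum>i=1..depth v. N.prob (?A i))"
    using A by (intro N.finite_measure_subadditive_finite) auto
  also have "\<dots> = (\<Sum>i=1..depth v. N.prob (some_open (thru r (?w i))) * p {False} (?w i) v)"
  proof (rule sum.cong[OF refl])
    fix i assume i: "i \<in> {1..depth v}"
    have "\<not> desc (?w i) r" using i desc_depth[of "?w i" r] depth_anc[of i v] by auto
    then have "thru r (?w i) \<times> {False} \<subseteq> above (?w i)" by (auto simp: thru_def above_def)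
    then have 1: "some_open (thru r (?w i)) \<in> sets (G (above (?w i)))"
      by (rule some_open_G[rotated]) (auto simp: thru_def)
    have "Measurable.pred (G (below (?w i))) (\<lambda>\<omega>. reach (OB {False} \<omega>) (?w i) v)"
      by (rule reach_below_G) (auto simp: below_def)
    then have 2: "{\<omega>\<in>space N. reach (OB {False} \<omega>) (?w i) v} \<in> sets (G (below (?w i)))" by (simp add: pred_def)
    show "N.prob (?A i) = N.prob (some_open (thru r (?w i))) * p {False} (?w i) v"
      unfolding p_def by (rule indep_G[OF above_below 1 2])
  qed
  finally show ?thesis .
qed

text \<open>Summing over a level turns the decomposition at an intermediate vertex into the
  convolution of the homogeneous means with themselves. Cauchy products then carry summability over
  to the root.\<close>

lemma M_root_le:
  assumes u: "u \<noteq> r"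
  shows "M {False} r (Suc k) \<le> real d * (4 * (1 + 4 * \<alpha>)) * (\<Sum>i\<le>k. M {False} u i * M {False} u (k - i))"
proof -
  let ?a = "\<lambda>w. N.prob (some_open (thru r w))"
  have "M {False} r (Suc k) \<le> (\<Sum>v\<in>Lv r (Suc k). \<Sum>i=1..Suc k. ?a (anc v i) * p {False} (anc v i) v)"
    unfolding M_def
  proof (rule sum_mono)
    fix v assume "v \<in> Lv r (Suc k)"
    then have "depth v = Suc k" "v \<noteq> r" by (auto simp: Lv_def)
    then show "p {False} r v \<le> (\<Sum>i=1..Suc k. ?a (anc v i) * p {False} (anc v i) v)" using p_root_le[of v] by simp
  qed
  also have "\<dots> = (\<Sum>i=1..Suc k. \<Sum>v\<in>Lv r (Suc k). ?a (anc v i) * p {False} (anc v i) v)" by (rule sum.swap)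
  also have "\<dots> = (\<Sum>i\<le>k. \<Sum>v\<in>Lv r (Suc k). ?a (anc v (Suc i)) * p {False} (anc v (Suc i)) v)"
    by (rule sum.reindex_bij_witness[of _ Suc "\<lambda>j. j - 1"]) auto
  also have "\<dots> \<le> (\<Sum>i\<le>k. real d * (4 * (1 + 4 * \<alpha>)) * M {False} u i * M {False} u (k - i))"
  proof (rule sum_mono)
    fix i assume i: "i \<in> {..k}"
    have "(\<Sum>v\<in>Lv r (Suc i + (k - i)). ?a (anc v (Suc i)) * p {False} (anc v (Suc i)) v) =
      (\<Sum>w\<in>Lv r (Suc i). \<Sum>v\<in>Lv w (k - i). ?a (anc v (Suc i)) * p {False} (anc v (Suc i)) v)"
      by (rule sum_Lv_add)
    also have "\<dots> = (\<Sum>w\<in>Lv r (Suc i). \<Sum>v\<in>Lv w (k - i). ?a w * p {False} w v)"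
    proof (intro sum.cong refl)
      fix w v assume "w \<in> Lv r (Suc i)" "v \<in> Lv w (k - i)"
      then have "anc v (Suc i) = w" by (auto simp: Lv_def desc_def)
      then show "?a (anc v (Suc i)) * p {False} (anc v (Suc i)) v = ?a w * p {False} w v" by simp
    qed
    also have "\<dots> = (\<Sum>w\<in>Lv r (Suc i). ?a w * M {False} w (k - i))"
      by (simp add: M_def sum_distrib_left)
    also have "\<dots> = (\<Sum>w\<in>Lv r (Suc i). ?a w) * M {False} u (k - i)"
      unfolding sum_distrib_right
    proof (intro sum.cong refl)
      fix w assume "w \<in> Lv r (Suc i)"
      then have "w \<noteq> r" by (auto simp: Lv_def)
      from M_homogeneous[OF u this] show "?a w * M {False} w (k - i) = ?a w * M {False} u (k - i)" by simp
    qed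
    also have "\<dots> \<le> real d * (4 * (1 + 4 * \<alpha>)) * M {False} u i * M {False} u (k - i)"
      using prob_thru_root_sum[OF u] by (intro mult_right_mono) auto
    finally show "(\<Sum>v\<in>Lv r (Suc k). ?a (anc v (Suc i)) * p {False} (anc v (Suc i)) v) \<le>
      real d * (4 * (1 + 4 * \<alpha>)) * M {False} u i * M {False} u (k - i)" using i by simp
  qed
  finally show ?thesis by (simp add: sum_distrib_left mult.assoc)
qed

lemma mean_finite_if_summable:
  assumes u: "u \<noteq> r" and sum: "summable (M {False} u)"
  shows "mean_cluster_size E d r (rt {False}) \<kappa> < \<infinity>"
proof -
  have "summable (\<lambda>k. \<Sum>i\<le>k. M {False} u i * M {False} u (k - i))"
    using sum by (intro summable_Cauchy_product) auto
  then have "summable (\<lambda>k. M {False} r (Suc k))"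
    by (rule summable_comparison_test'[OF summable_mult]) (use M_root_le[OF u] in auto)
  then have sr: "summable (M {False} r)" by (simp only: summable_Suc_iff)
  \<comment> \<open>The mean cluster size is the total mass of this measure, and the levels
    partition the vertices.\<close>
  define D where "D = density (count_space UNIV) (\<lambda>v. ennreal (p {False} r v))"
  have lev: "emeasure D (Lv r k) = ennreal (M {False} r k)" for k
  proof -
    have "emeasure D (Lv r k) = (\<integral>\<^sup>+v. ennreal (p {False} r v) * indicator (Lv r k) v \<partial>count_space UNIV)"
      by (simp add: D_def emeasure_density)
    also have "\<dots> = (\<integral>\<^sup>+v. ennreal (p {False} r v) \<partial>count_space (Lv r k))"
      by (simp add: nn_integral_count_space_indicator)
    also have "\<dots> = ennreal (M {False} r k)"
      by (simp add: nn_integral_count_space_finite M_def)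
    finally show ?thesis .
  qed
  have "mean_cluster_size E d r (rt {False}) \<kappa> = emeasure D UNIV"
    by (simp add: mean_cluster_size_eq D_def emeasure_density)
  also have "UNIV = (\<Union>k. Lv r k)" by (auto simp: Lv_def)
  also have "emeasure D (\<Union>k. Lv r k) = (\<Sum>k. emeasure D (Lv r k))"
    by (rule suminf_emeasure[symmetric]) (auto simp: D_def disjoint_family_on_def Lv_def)
  also have "\<dots> = (\<Sum>k. ennreal (M {False} r k))" by (simp only: lev)
  also have "\<dots> = ennreal (\<Sum>k. M {False} r k)"
    by (rule suminf_ennreal2[OF _ sr]) simp
  also have "\<dots> < \<infinity>" by simp
  finally show ?thesis .
qed

lemma percolation_mono: "percolation_prob E d r (rt {False}) \<kappa> \<le> percolation_prob E d r (rt UNIV) \<kappa>"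
  unfolding percolation_prob_eq
proof (rule N.finite_measure_mono)
  show "{\<omega>\<in>space N. infinite {v. reach (OB {False} \<omega>) r v}} \<subseteq> {\<omega>\<in>space N. infinite {v. reach (OB UNIV \<omega>) r v}}"
  proof safe
    fix \<omega> assume "infinite {v. reach (OB {False} \<omega>) r v}" "finite {v. reach (OB UNIV \<omega>) r v}"
    moreover have "{v. reach (OB {False} \<omega>) r v} \<subseteq> {v. reach (OB UNIV \<omega>) r v}"
      using reach_mono[OF OB_mono[of "{False}" UNIV \<omega>]] by auto
    ultimately show False using finite_subset by blast
  qed
qed (rule infinite_meas, rule reach_N)

lemma no_percolation_if_mean_finite:
  assumes "mean_cluster_size E d r (rt B) \<kappa> < \<infinity>"
  shows "percolation_prob E d r (rt B) \<kappa> = 0"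
proof -
  let ?L = "loop_soup_law E d (rt B) \<kappa>"
  let ?I = "{\<omega>\<in>space ?L. infinite (cluster E \<omega> r)}"
  have "AE \<omega> in ?L. emeasure (count_space UNIV) (cluster E \<omega> r) \<noteq> \<infinity>"
    using assms unfolding mean_cluster_size_def cluster_eq
    by (intro nn_integral_PInf_AE count_meas reach_soup) auto
  then have "AE \<omega> in ?L. \<not> infinite (cluster E \<omega> r)"
    by eventually_elim (auto simp: emeasure_count_space split: if_splits)
  moreover have "?I \<in> sets ?L" unfolding cluster_eq by (rule infinite_meas[OF reach_soup])
  ultimately have "emeasure ?L ?I = 0" by (subst (asm) AE_iff_measurable[of ?I]) auto
  then show ?thesis by (simp add: percolation_prob_def measure_def)
qed

end

section \<open>Equality of the critical intensities\<close>

theorem theorem1p7: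
  fixes E :: "'v rel" and v :: 'v and d :: nat and \<kappa> :: real
  assumes "3 \<le> d" and "regular_tree E d" and "kappa_c d \<le> \<kappa>"
  shows "alpha_c E d v \<kappa> = alpha_sharp E d v \<kappa>"
proof (rule antisym)
  have soup: "loop_soup E d \<kappa> \<alpha> \<beta>" if "0 \<le> \<alpha>" "0 \<le> \<beta>" for \<alpha> \<beta>
    using assms that by unfold_locales
  show "alpha_sharp E d v \<kappa> \<le> alpha_c E d v \<kappa>"
    unfolding alpha_sharp_def alpha_c_def
  proof (intro Sup_least Inf_greatest; elim imageE)
    fix x y a b
    assume a: "a \<in> {\<alpha>. 0 < \<alpha> \<and> mean_cluster_size E d v \<alpha> \<kappa> < \<infinity>}" "x = ennreal a"
      and b: "b \<in> {\<alpha>. 0 \<le> \<alpha> \<and> 0 < percolation_prob E d v \<alpha> \<kappa>}" "y = ennreal b"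
    have "a \<le> b"
    proof (rule ccontr)
      assume "\<not> a \<le> b"
      \<comment> \<open>Base intensity \<open>b\<close> and extra intensity \<open>a - b\<close>
        couple the soups at \<open>b\<close> and \<open>a\<close>, which gives monotonicity of the
        percolation probability.\<close>
      then interpret loop_soup E d v \<kappa> b "a - b" using b by (intro soup) auto
      have rt: "rt {False} = b" "rt UNIV = a" by (simp_all add: rt_def UNIV_bool)
      have "percolation_prob E d v a \<kappa> = 0" using no_percolation_if_mean_finite[of UNIV] a by (simp add: rt)
      then show False using percolation_mono b by (simp add: rt)
    qed
    then show "x \<le> y" using a b by (simp add: ennreal_leI)
  qed
  show "alpha_c E d v \<kappa> \<le> alpha_sharp E d v \<kappa>"
  proof (rule ccontr)
    assume "\<not> ?thesis"
    then have "alpha_sharp E d v \<kappa> < alpha_c E d v \<kappa>" by (simp add: not_le)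
    \<comment> \<open>Two intermediate intensities leave strict room for sprinkling: the mean is
      infinite at the lower one, and the positive difference makes \<epsilon> positive, so the
      higher one percolates.\<close>
    then obtain y where y: "alpha_sharp E d v \<kappa> < y" "y < alpha_c E d v \<kappa>" using dense by blast
    obtain x where x: "alpha_sharp E d v \<kappa> < x" "x < y" using dense[OF y(1)] by auto
    obtain a where a: "x = ennreal a" "0 \<le> a" using x(2) by (cases x) auto
    obtain b where b: "y = ennreal b" "0 \<le> b" using y(2) by (cases y) auto
    have ab: "0 < a" "a < b" using x a b by (auto simp: ennreal_less_iff intro: le_neq_trans)
    interpret loop_soup E d v \<kappa> a "b - a" using ab by (intro soup) auto
    have rt: "rt {False} = a" "rt UNIV = b" by (simp_all add: rt_def UNIV_bool)
    have "card (ch v) \<noteq> 0" using card_ch_root d3 by simp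
    then obtain u where "u \<in> ch v" by fastforce
    then have u: "u \<noteq> v" by (auto simp: ch_def)
    have "\<not> mean_cluster_size E d v a \<kappa> < \<infinity>"
    proof
      assume "mean_cluster_size E d v a \<kappa> < \<infinity>"
      then have "x \<le> alpha_sharp E d v \<kappa>" unfolding alpha_sharp_def a(1) using ab by (intro Sup_upper) auto
      then show False using x by simp
    qed
    then have "\<not> summable (M {False} u)" using mean_finite_if_summable[OF u] by (auto simp: rt)
    then obtain k where "1 < M UNIV u k" using supercritical_if_not_summable[OF u] ab by auto
    then have "0 < percolation_prob E d v b \<kappa>" using percolation_positive[OF u] ab by (auto simp: rt)
    then have "alpha_c E d v \<kappa> \<le> y" unfolding alpha_c_def b(1) using ab by (intro Inf_lower) auto
    then show False using y by simp
  qed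
qed

end
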